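(* Let $K=F\oplus F$ be split and $\chi=(\chi_1,\chi_1^{-1})$. Let $\phi,\psi\in\mathcal S(\chi,G)$ and fix $x\in F^\times$. Then there exist constants $a_{\pm,i},c_{\pm,i}\in\mathbb C$ ($i=1,2$), an integer $n>0$ and functions $A,C\in\mathcal S(F^\times)$ (locally constant with compact support in $F^\times$) such that for all $b\in F^\times$ $$\Bigl\langle\phi,\begin{pmatrix}b&0\\0&1\end{pmatrix}.\psi\Bigr\rangle_x=\chi_1^{-1}(b)\Bigl(\mathbf 1_{\wp^n}(b)|b|(a_{+,1}v(b)+a_{+,2})+A(b)+\mathbf 1_{\wp^n}(b^{-1})|b|^{-1}(a_{-,1}v(b)+a_{-,2})\Bigr)$$ $$\qquad+\chi_1(b)\Bigl(\mathbf 1_{\wp^n}(b)|b|(c_{+,1}v(b)+c_{+,2})+C(b)+\mathbf 1_{\wp^n}(b^{-1})|b|^{-1}(c_{-,1}v(b)+c_{-,2})\Bigr).$$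
   Context: $F$ is a non-archimedean local field of residue characteristic $\neq2$, $\wp$ the maximal ideal of its integers, $v$ the valuation, $|\cdot|$ the absolute value, $\mathbf 1_X$ the indicator function of $X$. $K=F\oplus F$ is embedded diagonally in $D=M_2(F)$, $G=\operatorname{PGL}_2(F)$, $T=F^\times\backslash K^\times$ the diagonal torus, with Haar measures on $T,G$ and quotient measure $dy$ on $T\backslash G$. $\chi_1$ is a character of $F^\times$ and $\chi\begin{pmatrix}a&0\\0&d\end{pmatrix}=\chi_1(a)\chi_1(d)^{-1}$. $\mathcal S(\chi,G)$: locally constant $\phi:G\to\mathbb C$, compactly supported modulo $T$, with $\phi(tg)=\chi(t)\phi(g)$. For $x\in F^\times\setminus\{1\}$ let $\gamma(x)=\begin{pmatrix}-1&x\\-1&1\end{pmatrix}$; the translated local linking number is $\langle\phi,\begin{pmatrix}b&0\\0&1\end{pmatrix}.\psi\rangle_x=\int_{T\backslash G}\int_T\phi(t^{-1}\gamma(x)ty)\,dt\,\overline{\psi(y\begin{pmatrix}b&0\\0&1\end{pmatrix})}\,dy$, and it is defined to be $0$ for $x=1$. *)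

theory Defs
  imports "HOL-Analysis.Analysis" "HOL-Algebra.Coset"
begin

section \<open>Non-archimedean local fields\<close>

text \<open>\<open>val\<close> is the normalised additive valuation; its value at \<open>0\<close> is left unspecified
  (mathematically it is \<open>\<infinity>\<close>), so every use below treats \<open>0\<close> separately.\<close>

class discrete_valued_field = field +
  fixes val :: "'a \<Rightarrow> int"
  assumes val_mult: "x \<noteq> 0 \<Longrightarrow> y \<noteq> 0 \<Longrightarrow> val (x * y) = val x + val y"
    and val_add: "x \<noteq> 0 \<Longrightarrow> y \<noteq> 0 \<Longrightarrow> x + y \<noteq> 0 \<Longrightarrow> min (val x) (val y) \<le> val (x + y)"
    and val_normalised: "\<exists>x. x \<noteq> 0 \<and> val x = 1"
begin

text \<open>\<open>max_ideal_pow n\<close> is the power \<open>\<wp>\<^sup>n\<close> of the maximal ideal of the valuation ring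
  \<open>max_ideal_pow 0\<close>.\<close>

definition max_ideal_pow :: "nat \<Rightarrow> 'a set"
  where "max_ideal_pow n = {x. x = 0 \<or> int n \<le> val x}"

definition residue_field :: "'a set set"
  where "residue_field = max_ideal_pow 0 //
    {(x, y). x \<in> max_ideal_pow 0 \<and> y \<in> max_ideal_pow 0 \<and> x - y \<in> max_ideal_pow 1}"

definition abs_val :: "'a \<Rightarrow> real"
  where "abs_val x = (if x = 0 then 0 else real (card residue_field) powi (- val x))"

end

text \<open>The topology is the one of the absolute value: \<open>complete_space\<close> is a subclass of
  \<open>metric_space\<close>, and the metric is the one induced by \<open>abs_val\<close>.\<close>

class nonarch_local_field = discrete_valued_field + complete_space +
  assumes finite_residue_field: "finite residue_field"
    and dist_abs_val: "dist x y = abs_val (x - y)"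

definition residue_char :: "'f::nonarch_local_field itself \<Rightarrow> nat"
  where "residue_char _ = (LEAST p. 0 < p \<and> (of_nat p :: 'f) \<in> max_ideal_pow 1)"

text \<open>Characters are unitary. This is what makes the integrand of the linking number below
  left invariant under the torus.\<close>

definition mult_character :: "('f::nonarch_local_field \<Rightarrow> complex) \<Rightarrow> bool"
  where "mult_character c \<longleftrightarrow> continuous_on (- {0}) c \<and>
    (\<forall>a b. a \<noteq> 0 \<longrightarrow> b \<noteq> 0 \<longrightarrow> c (a * b) = c a * c b) \<and> (\<forall>a. a \<noteq> 0 \<longrightarrow> norm (c a) = 1)"


section \<open>Topological groups and invariant measures\<close>

definition quotient_topology :: "'a topology \<Rightarrow> ('a \<Rightarrow> 'b) \<Rightarrow> 'b topology"
  where "quotient_topology X q =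
    topology (\<lambda>U. U \<subseteq> q ` topspace X \<and> openin X {x \<in> topspace X. q x \<in> U})"

lemma istopology_quotient:
  "istopology (\<lambda>U. U \<subseteq> q ` topspace X \<and> openin X {x \<in> topspace X. q x \<in> U})"
proof -
  have 1: "{x \<in> topspace X. q x \<in> S \<inter> T} =
    {x \<in> topspace X. q x \<in> S} \<inter> {x \<in> topspace X. q x \<in> T}" for S T by auto
  have 2: "{x \<in> topspace X. q x \<in> \<Union>K} = (\<Union>S\<in>K. {x \<in> topspace X. q x \<in> S})" for K by auto
  show ?thesis unfolding istopology_def 1 2 by (auto simp: openin_Int intro!: openin_Union)
qed

lemma openin_quotient_topology:
  "openin (quotient_topology X q) U \<longleftrightarrow> U \<subseteq> q ` topspace X \<and> openin X {x \<in> topspace X. q x \<in> U}"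
  by (simp add: quotient_topology_def istopology_quotient)

lemma topspace_quotient_topology [simp]: "topspace (quotient_topology X q) = q ` topspace X"
proof -
  have "{x \<in> topspace X. q x \<in> q ` topspace X} = topspace X" by auto
  then have "openin (quotient_topology X q) (q ` topspace X)" by (simp add: openin_quotient_topology)
  then show ?thesis
    by (meson openin_quotient_topology openin_subset openin_topspace subset_antisym)
qed

lemma quotient_map_quotient_topology: "quotient_map X (quotient_topology X q) q"
  by (simp add: quotient_map_def openin_quotient_topology)

definition locally_constant :: "'a topology \<Rightarrow> ('a \<Rightarrow> 'b) \<Rightarrow> bool"
  where "locally_constant X f \<longleftrightarrow>
    (\<forall>x \<in> topspace X. \<exists>U. openin X U \<and> x \<in> U \<and> (\<forall>y \<in> U. f y = f x))"

definition test_function :: "'a topology \<Rightarrow> ('a \<Rightarrow> complex) \<Rightarrow> bool"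
  where "test_function X f \<longleftrightarrow> locally_constant X f \<and>
    compactin X (X closure_of {x \<in> topspace X. f x \<noteq> 0})"

definition borel_measure_on :: "'a topology \<Rightarrow> 'a measure \<Rightarrow> bool"
  where "borel_measure_on X M \<longleftrightarrow>
    space M = topspace X \<and> sets M = sigma_sets (topspace X) {U. openin X U}"

text \<open>Left Haar measures. Regularity need not be required: all groups below are locally compact
  and second countable, where it is automatic.\<close>

definition haar_measure :: "'a monoid \<Rightarrow> 'a topology \<Rightarrow> 'a measure \<Rightarrow> bool"
  where "haar_measure G X M \<longleftrightarrow> borel_measure_on X M \<and>
    (\<forall>K. compactin X K \<longrightarrow> emeasure M K < \<infinity>) \<and>
    (\<forall>U. openin X U \<longrightarrow> U \<noteq> {} \<longrightarrow> 0 < emeasure M U) \<and>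
    (\<forall>g \<in> carrier G. \<forall>A \<in> sets M. emeasure M (g <#\<^bsub>G\<^esub> A) = emeasure M A)"

text \<open>\<open>coset_fun h\<close> is the function on the right cosets \<open>H g\<close> induced by a function \<open>h\<close> which is
  constant on each of them.\<close>

definition coset_fun :: "('a \<Rightarrow> 'b) \<Rightarrow> 'a set \<Rightarrow> 'b"
  where "coset_fun h Y = the_elem (h ` Y)"

text \<open>The quotient measure on the space \<open>rcosets H\<close> of the cosets \<open>H g\<close>, characterised by
  \<open>\<integral>\<^sub>G f(g) dg = \<integral>\<^bsub>H\G\<^esub> \<integral>\<^sub>H f(h y) dh dy\<close>, here for nonnegative Borel functions \<open>f\<close>.\<close>

definition quotient_measure ::
  "'a monoid \<Rightarrow> 'a topology \<Rightarrow> 'a set \<Rightarrow> 'a measure \<Rightarrow> 'a measure \<Rightarrow> 'a set measure \<Rightarrow> bool"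
  where "quotient_measure G X H MG MH N \<longleftrightarrow>
    borel_measure_on (quotient_topology X (\<lambda>g. H #>\<^bsub>G\<^esub> g)) N \<and>
    (\<forall>f \<in> borel_measurable MG.
      (\<integral>\<^sup>+ g. f g \<partial>MG) = (\<integral>\<^sup>+ Y. coset_fun (\<lambda>y. \<integral>\<^sup>+ h. f (h \<otimes>\<^bsub>G\<^esub> y) \<partial>MH) Y \<partial>N))"


section \<open>The group PGL(2,F) and its diagonal torus\<close>

definition mat2 :: "'f::zero \<Rightarrow> 'f \<Rightarrow> 'f \<Rightarrow> 'f \<Rightarrow> 'f^2^2"
  where "mat2 a b c d = vector [vector [a, b], vector [c, d]]"

definition GL2 :: "('f::field^2^2) monoid"
  where "GL2 = \<lparr>carrier = {A. invertible A}, mult = (**), one = mat 1\<rparr>"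

definition scalars :: "('f::field^2^2) set"
  where "scalars = {mat c | c. c \<noteq> 0}"

definition PGL2 :: "('f::field^2^2) set monoid"
  where "PGL2 = GL2 Mod scalars"

definition pgl :: "'f::field^2^2 \<Rightarrow> ('f^2^2) set"
  where "pgl A = scalars #>\<^bsub>GL2\<^esub> A"

definition PGL2_topology :: "('f::nonarch_local_field^2^2) set topology"
  where "PGL2_topology = quotient_topology (top_of_set (carrier GL2)) pgl"

definition torus :: "('f::field^2^2) set set"
  where "torus = {pgl (mat2 a 0 0 d) | a d. a \<noteq> 0 \<and> d \<noteq> 0}"

definition torus_character :: "('f::nonarch_local_field \<Rightarrow> complex) \<Rightarrow> ('f^2^2) set \<Rightarrow> complex"
  where "torus_character c = coset_fun (\<lambda>A. c (A $ 1 $ 1) * inverse (c (A $ 2 $ 2)))"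

abbreviation haar_PGL2 :: "('f::nonarch_local_field^2^2) set measure \<Rightarrow> bool"
  where "haar_PGL2 \<equiv> haar_measure PGL2 PGL2_topology"

abbreviation haar_torus :: "('f::nonarch_local_field^2^2) set measure \<Rightarrow> bool"
  where "haar_torus \<equiv> haar_measure (PGL2\<lparr>carrier := torus\<rparr>) (subtopology PGL2_topology torus)"

definition schwartz_space ::
  "(('f::nonarch_local_field^2^2) set \<Rightarrow> complex) \<Rightarrow> (('f^2^2) set \<Rightarrow> complex) set"
  where "schwartz_space \<chi>' = {\<phi>. locally_constant PGL2_topology \<phi> \<and>
    (\<exists>C. compactin PGL2_topology C \<and> {g \<in> carrier PGL2. \<phi> g \<noteq> 0} \<subseteq> torus <#>\<^bsub>PGL2\<^esub> C) \<and>
    (\<forall>t \<in> torus. \<forall>g \<in> carrier PGL2. \<phi> (t \<otimes>\<^bsub>PGL2\<^esub> g) = \<chi>' t * \<phi> g)}"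


section \<open>Translated local linking numbers\<close>

definition gamma :: "'f::field \<Rightarrow> ('f^2^2) set"
  where "gamma x = pgl (mat2 (- 1) x (- 1) 1)"

definition torus_orbital ::
  "('f::nonarch_local_field^2^2) set measure \<Rightarrow> (('f^2^2) set \<Rightarrow> complex) \<Rightarrow> 'f
    \<Rightarrow> ('f^2^2) set \<Rightarrow> complex"
  where "torus_orbital MT \<phi> x y =
    (\<integral>t. \<phi> (inv\<^bsub>PGL2\<^esub> t \<otimes>\<^bsub>PGL2\<^esub> gamma x \<otimes>\<^bsub>PGL2\<^esub> t \<otimes>\<^bsub>PGL2\<^esub> y) \<partial>MT)"

text \<open>\<open>MT\<close> is the measure on the torus, \<open>N\<close> the one on the coset space.\<close>

definition linking_number ::
  "('f::nonarch_local_field^2^2) set measure \<Rightarrow> ('f^2^2) set set measure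
    \<Rightarrow> (('f^2^2) set \<Rightarrow> complex) \<Rightarrow> 'f \<Rightarrow> (('f^2^2) set \<Rightarrow> complex) \<Rightarrow> 'f \<Rightarrow> complex"
  where "linking_number MT N \<phi> b \<psi> x = (if x = 1 then 0 else
    (\<integral>Y. coset_fun (\<lambda>y. torus_orbital MT \<phi> x y *
                       cnj (\<psi> (y \<otimes>\<^bsub>PGL2\<^esub> pgl (mat2 b 0 0 1)))) Y \<partial>N))"

end

theory Submission
  imports Defs
begin

text \<open>
  A coset \<open>T g\<close> is a pair of distinct points of the projective line, spanned by the rows of \<open>g\<close>, so
  \<open>\<S>(\<chi>,G)\<close> consists of homogeneous functions of two rows. Let \<open>\<phi>'\<close> be the orbital integral of \<open>\<phi>\<close>.
  It is invariant under a congruence subgroup, hence \<open>\<langle>\<phi>, b.\<psi>\<rangle>\<close>, for small \<open>b\<close>, only depends on the image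
  of \<open>\<psi>\<close> in the coinvariants under the upper unipotent group, which \<open>diag(b,1)\<close> contracts.

  If \<open>\<psi>\<close> vanishes near the fixed point \<open>(0:1)\<close> of that group, this reduces the pairing to the value of
  \<open>\<phi>'\<close> at the matrix with rows \<open>(1,0)\<close>, \<open>(1,c)\<close>, \<open>c\<close> a multiple of \<open>b\<close>. There the integrand is
  concentrated at \<open>t = 1\<close> and \<open>t = x\<close>, and the two contributions are multiples of
  \<open>|c| \<chi>\<^sub>1(c)\<^sup>-\<^sup>1\<close> and \<open>|c| \<chi>\<^sub>1(c)\<close>. If \<open>\<psi>\<close> is concentrated at \<open>(0:1)\<close>, dilation by a uniformizer
  multiplies it by \<open>\<chi>\<^sub>1\<^sup>\<plusminus>\<^sup>1 / q\<close> up to a function of the first kind, and summing this recurrence produces the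
  terms with \<open>v(b)\<close>. The behaviour for large \<open>b\<close> follows by exchanging the two columns.
\<close>

text \<open>The orbital integral is in general not compactly supported modulo \<open>T\<close>: it
  survives when its two points collide, and this germ is what produces the factor |b|. Two obstacles
  shape the rest. The measure on the coset space is known only through an integral identity, and the
  Haar measure on G is only assumed left invariant. So functions are integrated as finite sums over
  double cosets \<open>T A K_M\<close>, whose volume is that of \<open>K_M\<close> divided by that
  of the intersection of \<open>T\<close> with \<open>A K_M A^-1\<close>. Replacing \<open>A\<close>
  by \<open>A k\<close>, with \<open>k\<close> in GL(2) of the integers, changes neither number, and
  this is all the right invariance that is used. Secondly, a section concentrated at (0:1) is not a
  finite combination of cells at finite slopes. Enlarging its disc around (0:1) by one step adds an
  annulus at finite slopes; cutting the disc of the other point into q parts divides the pairing by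
  q, by shear invariance; dilation by a uniformizer does both at once, whence the 1/q in the
  recurrence. Solving it leaves a constant increment, which is linear in v(b), and a geometric one,
  which is linear only if its ratio is 1.\<close>

lemma val_1 [simp]: "val (1::'f::discrete_valued_field) = 0"
  using val_mult[of "1::'f" 1] by simp

lemma val_minus_1: "val (- 1::'f::discrete_valued_field) = 0"
  using val_mult[of "- 1::'f" "- 1"] by simp

lemma val_minus [simp]: "val (- x) = val x"
proof (cases "x = 0")
  case False
  then show ?thesis using val_mult[of "- 1" x] val_minus_1 by simp
qed simp

lemma val_inverse: "x \<noteq> 0 \<Longrightarrow> val (inverse x) = - val x"
  using val_mult[of x "inverse x"] by (simp add: field_simps)

lemma val_divide: "x \<noteq> 0 \<Longrightarrow> y \<noteq> 0 \<Longrightarrow> val (x / y) = val x - val y"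
  using val_mult[of x "inverse y"] val_inverse[of y] by (simp add: divide_inverse)

text \<open>Fractional ideals, with exponents of either sign. Estimates are phrased as membership
  rather than as inequalities for \<open>val\<close>, because \<open>val 0\<close> is unspecified
  while 0 lies in every fractional ideal.\<close>

definition fideal :: "int \<Rightarrow> 'f::discrete_valued_field set"
  where "fideal i = {x. x = 0 \<or> i \<le> val x}"

lemma fideal_iff: "x \<noteq> 0 \<Longrightarrow> x \<in> fideal i \<longleftrightarrow> i \<le> val x"
  by (simp add: fideal_def)

lemma max_ideal_pow_eq: "max_ideal_pow n = fideal (int n)"
  by (simp add: fideal_def max_ideal_pow_def)

lemma fideal_0 [simp]: "0 \<in> fideal i"
  by (simp add: fideal_def)

lemma fideal_minus [simp]: "- x \<in> fideal i \<longleftrightarrow> x \<in> fideal i"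
  by (simp add: fideal_def)

lemma fideal_add: "x \<in> fideal i \<Longrightarrow> y \<in> fideal i \<Longrightarrow> x + y \<in> fideal i"
  using val_add[of x y] by (cases "x = 0"; cases "y = 0"; cases "x + y = 0") (auto simp: fideal_def)

lemma fideal_diff: "x \<in> fideal i \<Longrightarrow> y \<in> fideal i \<Longrightarrow> x - y \<in> fideal i"
  using fideal_add[of x i "- y"] by simp

lemma fideal_diff_commute: "x - y \<in> fideal i \<longleftrightarrow> y - x \<in> fideal i"
  using fideal_minus[of "x - y" i] by simp

lemma fideal_diff_trans: "x - y \<in> fideal i \<Longrightarrow> y - z \<in> fideal i \<Longrightarrow> x - z \<in> fideal i"
  using fideal_add[of "x - y" i "y - z"] by simp

lemma fideal_mono: "x \<in> fideal i \<Longrightarrow> j \<le> i \<Longrightarrow> x \<in> fideal j"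
  by (auto simp: fideal_def)

lemma fideal_mult: "x \<in> fideal i \<Longrightarrow> y \<in> fideal j \<Longrightarrow> k \<le> i + j \<Longrightarrow> x * y \<in> fideal k"
  using val_mult[of x y] by (cases "x = 0"; cases "y = 0") (auto simp: fideal_def)

lemma fideal_self [simp]: "x \<in> fideal (val x)"
  by (simp add: fideal_def)

lemma fideal_mult_iff: "c \<noteq> 0 \<Longrightarrow> c * x \<in> fideal i \<longleftrightarrow> x \<in> fideal (i - val c)"
  using val_mult[of c x] by (cases "x = 0") (auto simp: fideal_def)

lemma fideal_divide_iff: "c \<noteq> 0 \<Longrightarrow> x / c \<in> fideal i \<longleftrightarrow> x \<in> fideal (i + val c)"
  using fideal_mult_iff[of c "x / c" "i + val c"] by simp

lemma one_in_fideal [simp]: "1 \<in> fideal i \<longleftrightarrow> i \<le> 0"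
  by (simp add: fideal_def)

text \<open>The equality case of the ultrametric inequality: if the sum were as small as
  \<open>y\<close>, then so would be \<open>x\<close>.\<close>

lemma val_add_eq:
  assumes "x \<noteq> 0" "y \<in> fideal (val x + 1)"
  shows "x + y \<noteq> 0" "val (x + y) = val x"
proof -
  have "x + y \<notin> fideal (val x + 1)"
    using assms fideal_diff[of "x + y" "val x + 1" y] by (auto simp: fideal_iff)
  then show "x + y \<noteq> 0" by auto
  with \<open>x + y \<notin> _\<close> have "val (x + y) \<le> val x" by (simp add: fideal_iff)
  moreover have "x + y \<in> fideal (val x)"
    using assms by (intro fideal_add) (auto intro: fideal_mono)
  ultimately show "val (x + y) = val x" using \<open>x + y \<noteq> 0\<close> by (simp add: fideal_iff)
qed

lemma val_eqI:
  assumes "x \<noteq> 0" "y - x \<in> fideal (val x + 1)"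
  shows "y \<noteq> 0" "val y = val x"
  using val_add_eq[of x "y - x"] assms by simp_all

lemma one_unit:
  assumes "u - 1 \<in> fideal i" "1 \<le> i"
  shows "u \<noteq> 0" "val u = 0"
  using val_eqI[of 1 u] fideal_mono[of "u - 1" i 1] assms by auto

lemma one_unit_mult:
  assumes "u - 1 \<in> fideal i" "w - 1 \<in> fideal i" "0 \<le> i"
  shows "u * w - 1 \<in> fideal i"
proof -
  have "u * w - 1 = (u - 1) * (w - 1) + (u - 1) + (w - 1)" by (simp add: algebra_simps)
  also have "\<dots> \<in> fideal i" using assms by (intro fideal_add fideal_mult[of _ i _ i]) auto
  finally show ?thesis .
qed

lemma one_unit_inverse:
  assumes "u - 1 \<in> fideal i" "1 \<le> i"
  shows "inverse u - 1 \<in> fideal i"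
proof -
  have u: "u \<noteq> 0" "val u = 0" using one_unit assms by auto
  have "inverse u - 1 = (1 - u) / u" using u by (simp add: field_simps)
  also have "\<dots> \<in> fideal i" using u assms fideal_diff_commute[of u 1] by (simp add: fideal_divide_iff)
  finally show ?thesis .
qed

lemma one_unit_divide:
  assumes "x \<noteq> 0" "y - x \<in> fideal (i + val x)"
  shows "y / x - 1 \<in> fideal i"
proof -
  have "y / x - 1 = (y - x) / x" using assms by (simp add: field_simps)
  then show ?thesis using assms by (simp add: fideal_divide_iff)
qed

definition uniformizer :: "'f::discrete_valued_field"
  where "uniformizer = (SOME x. x \<noteq> 0 \<and> val x = 1)"

lemma uniformizer [simp]: "uniformizer \<noteq> 0" "val uniformizer = 1"
  using someI_ex[OF val_normalised] by (auto simp: uniformizer_def)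

lemma val_power: "x \<noteq> 0 \<Longrightarrow> val (x ^ n) = int n * val x"
  by (induction n) (simp_all add: val_mult algebra_simps)

lemma ex_val: "\<exists>x. x \<noteq> 0 \<and> val x = i"
proof (cases "0 \<le> i")
  case True
  then show ?thesis by (intro exI[of _ "uniformizer ^ nat i"]) (simp add: val_power)
next
  case False
  then show ?thesis
    by (intro exI[of _ "inverse (uniformizer ^ nat (- i))"]) (simp add: val_power val_inverse)
qed

section \<open>The residue field and finite systems of representatives\<close>

definition residue_card :: "'f::nonarch_local_field itself \<Rightarrow> nat"
  where "residue_card _ = card (residue_field :: 'f set set)"

definition residue_rel :: "('f::nonarch_local_field \<times> 'f) set"
  where "residue_rel = {(x, y). x \<in> fideal 0 \<and> y \<in> fideal 0 \<and> x - y \<in> fideal 1}"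

lemma residue_field_eq: "residue_field = (fideal 0 :: 'f::nonarch_local_field set) // residue_rel"
  by (simp add: residue_field_def residue_rel_def max_ideal_pow_eq)

lemma equiv_residue_rel: "equiv (fideal 0) residue_rel"
  by (rule equivI)
    (auto simp: residue_rel_def refl_on_def sym_def trans_def intro: fideal_diff_trans
      simp: fideal_diff_commute)

text \<open>Representatives of one fractional ideal modulo a smaller one. They cut discs into
  finitely many smaller discs, for functions, measures and compactness alike.\<close>

definition reps :: "int \<Rightarrow> int \<Rightarrow> 'f::nonarch_local_field set \<Rightarrow> bool"
  where "reps i j R \<longleftrightarrow> finite R \<and> R \<subseteq> fideal i \<and> (\<forall>z \<in> fideal i. \<exists>!s. s \<in> R \<and> z - s \<in> fideal j)"

lemma reps_finite: "reps i j R \<Longrightarrow> finite R"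
  and reps_subset: "reps i j R \<Longrightarrow> s \<in> R \<Longrightarrow> s \<in> fideal i"
  by (auto simp: reps_def)

lemma repsE:
  assumes "reps i j R" "z \<in> fideal i"
  obtains s where "s \<in> R" "s \<in> fideal i" "z - s \<in> fideal j" "\<And>s'. s' \<in> R \<Longrightarrow> z - s' \<in> fideal j \<longleftrightarrow> s' = s"
  using assms unfolding reps_def by (metis in_mono)

text \<open>Exactly one representative contributes if \<open>z\<close> lies in the large ideal, and
  none otherwise, since \<open>z - s\<close> in the small ideal would put \<open>z\<close> into the
  large one. It expands a function that is constant on small discs into a finite sum.\<close>

lemma reps_sum:
  fixes f :: "'f::nonarch_local_field \<Rightarrow> complex"
  assumes R: "reps i j R" and out: "z \<notin> fideal i \<Longrightarrow> v = 0" and ij: "i \<le> j"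
    and inn: "\<And>s. z \<in> fideal i \<Longrightarrow> s \<in> R \<Longrightarrow> z - s \<in> fideal j \<Longrightarrow> f s = v"
  shows "(\<Sum>s\<in>R. if z - s \<in> fideal j then f s else 0) = v"
proof (cases "z \<in> fideal i")
  case True
  from repsE[OF R True] obtain s where s: "s \<in> R" "z - s \<in> fideal j"
      "\<And>s'. s' \<in> R \<Longrightarrow> z - s' \<in> fideal j \<longleftrightarrow> s' = s" by metis
  have "(\<Sum>s'\<in>R. if z - s' \<in> fideal j then f s' else 0) = (\<Sum>s'\<in>R. if s' = s then f s else 0)"
    using s by (intro sum.cong) auto
  also have "\<dots> = f s" using s reps_finite[OF R] by simp
  finally show ?thesis using inn[OF True s(1,2)] by simp
next
  case False
  have "z - s \<notin> fideal j" if "s \<in> R" for s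
    using False fideal_add[of "z - s" i s] reps_subset[OF R that] ij fideal_mono by fastforce
  then show ?thesis using out[OF False] by (simp add: sum.neutral)
qed

text \<open>Representatives of the residue classes, multiplied by an element of valuation
  \<open>i\<close>. That their number does not depend on \<open>i\<close> is the source of every
  factor q in volumes and in the recurrence.\<close>

lemma ex_reps_1: "\<exists>R::'f::nonarch_local_field set. reps i (i + 1) R \<and> card R = residue_card TYPE('f)"
proof -
  obtain c :: 'f where c: "c \<noteq> 0" "val c = i" using ex_val by blast
  define r where "r X = (SOME x. x \<in> X)" for X :: "'f set"
  have r: "r X \<in> X" if "X \<in> residue_field" for X :: "'f set"
    using that in_quotient_imp_non_empty[OF equiv_residue_rel] unfolding residue_field_eq r_def
    by (metis some_in_eq)
  have rO: "r X \<in> fideal 0" if "X \<in> residue_field" for X :: "'f set"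
    using r[OF that] that in_quotient_imp_subset[OF equiv_residue_rel] by (auto simp: residue_field_eq)
  have rel: "(r X, r Y) \<in> residue_rel \<longleftrightarrow> X = Y" if "X \<in> residue_field" "Y \<in> residue_field" for X Y :: "'f set"
    using that r quotient_eq_iff[OF equiv_residue_rel, of X Y "r X" "r Y"] by (auto simp: residue_field_eq)
  define R where "R = (\<lambda>X. c * r X) ` residue_field"
  have inj: "inj_on (\<lambda>X. c * r X) residue_field"
  proof (rule inj_onI)
    fix X Y :: "'f set" assume XY: "X \<in> residue_field" "Y \<in> residue_field" "c * r X = c * r Y"
    then have "(r X, r Y) \<in> residue_rel" using c rO by (simp add: residue_rel_def)
    then show "X = Y" using rel XY by blast
  qed
  have "\<exists>!s. s \<in> R \<and> z - s \<in> fideal (i + 1)" if z: "z \<in> fideal i" for z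
  proof -
    have z': "z / c \<in> fideal 0" using z c by (simp add: fideal_divide_iff)
    have *: "z - c * y \<in> fideal (i + 1) \<longleftrightarrow> z / c - y \<in> fideal 1" for y
      using c fideal_mult_iff[of c "z / c - y" "i + 1"] by (simp add: algebra_simps)
    define X where "X = residue_rel `` {z / c}"
    have X: "X \<in> residue_field" using z' by (auto simp: residue_field_eq X_def intro: quotientI)
    have key: "z / c - r Y \<in> fideal 1 \<longleftrightarrow> Y = X" if Y: "Y \<in> residue_field" for Y
    proof -
      have "z / c - r Y \<in> fideal 1 \<longleftrightarrow> (z / c, r Y) \<in> residue_rel"
        using z' rO[OF Y] by (simp add: residue_rel_def)
      also have "\<dots> \<longleftrightarrow> r Y \<in> X" by (simp add: X_def)
      also have "\<dots> \<longleftrightarrow> Y = X"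
        using r[OF Y] X Y quotient_disj[OF equiv_residue_rel] unfolding residue_field_eq by blast
      finally show ?thesis .
    qed
    show ?thesis unfolding R_def using key * X by (intro ex1I[of _ "c * r X"]) auto
  qed
  moreover have "R \<subseteq> fideal i" using rO c by (auto simp: R_def fideal_mult_iff)
  ultimately have "reps i (i + 1) R" using finite_residue_field by (auto simp: reps_def R_def)
  moreover have "card R = residue_card TYPE('f)" using card_image[OF inj] by (simp add: R_def residue_card_def)
  ultimately show ?thesis by blast
qed

lemma ex_reps: "i \<le> j \<Longrightarrow> \<exists>R::'f::nonarch_local_field set. reps i j R"
proof (induction j rule: int_ge_induct)
  case base
  have "reps i i {0::'f}" by (auto simp: reps_def)
  then show ?case by blast
next
  case (step j)
  from step obtain R :: "'f set" where R: "reps i j R" by blast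
  from ex_reps_1 obtain R' :: "'f set" where R': "reps j (j + 1) R'" by blast
  define Q where "Q = (\<lambda>(s, s'). s + s') ` (R \<times> R')"
  have "\<exists>!s. s \<in> Q \<and> z - s \<in> fideal (j + 1)" if z: "z \<in> fideal i" for z
  proof -
    from repsE[OF R z] obtain s where s: "s \<in> R" "z - s \<in> fideal j"
      "\<And>s'. s' \<in> R \<Longrightarrow> z - s' \<in> fideal j \<longleftrightarrow> s' = s" by metis
    from repsE[OF R' s(2)] obtain s' where s': "s' \<in> R'" "z - s - s' \<in> fideal (j+1)"
      "\<And>s''. s'' \<in> R' \<Longrightarrow> z - s - s'' \<in> fideal (j+1) \<longleftrightarrow> s'' = s'" by metis
    show ?thesis
    proof (intro ex1I[of _ "s + s'"] conjI)
      show "s + s' \<in> Q" using s s' by (auto simp: Q_def)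
      show "z - (s + s') \<in> fideal (j + 1)" using s' by (simp add: algebra_simps)
      fix y assume "y \<in> Q \<and> z - y \<in> fideal (j + 1)"
      then obtain a a' where a: "a \<in> R" "a' \<in> R'" "y = a + a'" "z - a - a' \<in> fideal (j + 1)"
        by (auto simp: Q_def algebra_simps)
      have "z - a \<in> fideal j"
        using fideal_add[of "z - a - a'" j a'] a reps_subset[OF R'] fideal_mono[of _ "j + 1" j] by auto
      then have "a = s" using s a by blast
      then show "y = s + s'" using a s' by auto
    qed
  qed
  moreover have "Q \<subseteq> fideal i"
    using reps_subset[OF R] reps_subset[OF R'] step.hyps
    by (auto simp: Q_def intro!: fideal_add intro: fideal_mono)
  ultimately show ?case using reps_finite[OF R] reps_finite[OF R'] by (intro exI[of _ Q]) (auto simp: reps_def Q_def)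
qed

text \<open>0 and 1 lie in different residue classes. This gives q > 1, hence powers of 1/q that
  tend to 0.\<close>

lemma residue_card_ge_2: "2 \<le> residue_card TYPE('f::nonarch_local_field)"
proof -
  obtain R :: "'f set" where R: "reps 0 (0+1) R" "card R = residue_card TYPE('f)" using ex_reps_1[of 0] by blast
  obtain a where a: "a \<in> R" "(0::'f) - a \<in> fideal 1" using R(1) unfolding reps_def by (metis add_0 fideal_0)
  have "(1::'f) \<in> fideal 0" by simp
  then obtain b where b: "b \<in> R" "(1::'f) - b \<in> fideal 1" using R(1) unfolding reps_def
    by (metis add_0)
  have "a \<noteq> b"
  proof
    assume "a = b"
    then have "1 - 0 \<in> fideal 1" using a b fideal_diff_trans[of "1::'f" b 1 0] fideal_diff_commute by fastforce
    then show False by simp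
  qed
  then have "card {a, b} \<le> card R" using a b R reps_finite by (intro card_mono) auto
  then show ?thesis using \<open>a \<noteq> b\<close> R by simp
qed

section \<open>Absolute value and topology\<close>

abbreviation rq :: "'f::nonarch_local_field itself \<Rightarrow> real" where "rq t \<equiv> real (residue_card t)"

lemma rq_gt_1: "1 < rq TYPE('f::nonarch_local_field)"
  using residue_card_ge_2[where 'f='f] by linarith

lemma abs_val_eq: "b \<noteq> 0 \<Longrightarrow> abs_val (b::'f::nonarch_local_field) = rq TYPE('f) powi (- val b)"
  by (simp add: abs_val_def residue_card_def)

lemma abs_val_mult: "abs_val (a * b :: 'f::nonarch_local_field) = abs_val a * abs_val b"
proof (cases "a = 0 \<or> b = 0")
  case False
  have "rq TYPE('f) \<noteq> 0" using rq_gt_1[where 'f='f] by linarith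
  then show ?thesis using False by (simp add: abs_val_eq val_mult power_int_add[symmetric] algebra_simps del: of_nat_eq_0_iff)
qed (auto simp: abs_val_def)

lemma abs_val_pos: "b \<noteq> 0 \<Longrightarrow> 0 < abs_val (b::'f::nonarch_local_field)"
  using rq_gt_1[where 'f='f] by (simp add: abs_val_eq)

lemma abs_val_inverse: "abs_val (inverse b :: 'f::nonarch_local_field) = inverse (abs_val b)"
  by (cases "b = 0") (auto simp: abs_val_def val_inverse power_int_minus)

text \<open>Closed balls are cosets of fractional ideals; topological statements become conditions
  on valuations.\<close>

lemma fideal_dist: "x - y \<in> fideal i \<longleftrightarrow> dist x (y::'f::nonarch_local_field) \<le> rq TYPE('f) powi (- i)"
proof (cases "x = y")
  case False
  have "(rq TYPE('f) powi - val (x - y) \<le> rq TYPE('f) powi - i) \<longleftrightarrow> i \<le> val (x - y)"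
    using power_int_increasing[of "- val (x - y)" "- i" "rq TYPE('f)"]
      power_int_strict_increasing[of "- i" "- val (x - y)" "rq TYPE('f)"] rq_gt_1[where 'f='f] by linarith
  with False show ?thesis
    by (simp add: dist_abs_val abs_val_eq fideal_iff)
next
  case True then show ?thesis using rq_gt_1[where 'f='f] by simp
qed

lemma ex_powi_less:
  fixes e :: real assumes "0 < e"
  shows "\<exists>J::int. J \<ge> J0 \<and> rq TYPE('f::nonarch_local_field) powi (- J) < e"
proof -
  have "0 < inverse (rq TYPE('f))" "inverse (rq TYPE('f)) < 1"
    using rq_gt_1[where 'f='f] by (simp_all add: field_simps)
  then obtain n where n: "inverse (rq TYPE('f)) ^ n < e" using real_arch_pow_inv[OF assms] by blast
  have "rq TYPE('f) powi (- max J0 (int n)) \<le> rq TYPE('f) powi (- int n)"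
    using rq_gt_1[where 'f='f] by (intro power_int_increasing) auto
  also have "\<dots> < e" using n by (simp add: power_int_minus power_inverse)
  finally show ?thesis by (intro exI[of _ "max J0 (int n)"]) auto
qed

lemma open_fideal_coset: "open {y::'f::nonarch_local_field. y - x \<in> fideal i}"
proof (subst open_dist, intro ballI)
  fix y assume y: "y \<in> {y. y - x \<in> fideal i}"
  show "\<exists>e>0. \<forall>z. dist z y < e \<longrightarrow> z \<in> {y. y - x \<in> fideal i}"
  proof (intro exI[of _ "rq TYPE('f) powi (- i)"] conjI allI impI)
    show "0 < rq TYPE('f) powi (- i)" using rq_gt_1[where 'f='f] by simp
    fix z assume "dist z y < rq TYPE('f) powi (- i)"
    then have "z - y \<in> fideal i" by (simp add: fideal_dist)
    then show "z \<in> {y. y - x \<in> fideal i}" using y fideal_diff_trans by auto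
  qed
qed

lemma open_nonarch_iff:
  "open (S :: 'f::nonarch_local_field set) \<longleftrightarrow> (\<forall>x\<in>S. \<exists>J\<ge>1. \<forall>y. y - x \<in> fideal J \<longrightarrow> y \<in> S)"
proof
  assume S: "open S"
  show "\<forall>x\<in>S. \<exists>J\<ge>1. \<forall>y. y - x \<in> fideal J \<longrightarrow> y \<in> S"
  proof
    fix x assume "x \<in> S"
    then obtain e where e: "e > 0" "\<forall>y. dist y x < e \<longrightarrow> y \<in> S" using S by (auto simp: open_dist)
    obtain J where "J \<ge> 1" "rq TYPE('f) powi (- J) < e" using ex_powi_less[OF e(1), where 'f='f] by blast
    then show "\<exists>J\<ge>1. \<forall>y. y - x \<in> fideal J \<longrightarrow> y \<in> S" using e fideal_dist by (meson le_less_trans)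
  qed
next
  assume *: "\<forall>x\<in>S. \<exists>J\<ge>1. \<forall>y. y - x \<in> fideal J \<longrightarrow> y \<in> S"
  show "open S"
  proof (subst open_subopen, intro ballI)
    fix x assume "x \<in> S"
    then obtain J where "\<forall>y. y - x \<in> fideal J \<longrightarrow> y \<in> S" using * by blast
    then show "\<exists>T. open T \<and> x \<in> T \<and> T \<subseteq> S"
      using open_fideal_coset[of x J] by (intro exI[of _ "{y. y - x \<in> fideal J}"]) auto
  qed
qed

lemma open_mat_iff:
  "open (S :: ('f::nonarch_local_field^2^2) set) \<longleftrightarrow>
    (\<forall>A\<in>S. \<exists>J\<ge>1. \<forall>B. (\<forall>i j. B $ i $ j - A $ i $ j \<in> fideal J) \<longrightarrow> B \<in> S)"
proof
  assume S: "open S"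
  show "\<forall>A\<in>S. \<exists>J\<ge>1. \<forall>B. (\<forall>i j. B $ i $ j - A $ i $ j \<in> fideal J) \<longrightarrow> B \<in> S"
  proof
    fix A assume "A \<in> S"
    then obtain e where e: "e > 0" "\<forall>y. dist y A < e \<longrightarrow> y \<in> S" using S by (auto simp: open_dist)
    \<comment> \<open>The distance of matrices is at most the sum of the four distances of the
      entries: e/2 for each row, e/4 for each entry.\<close>
    obtain J where J: "J \<ge> 1" "rq TYPE('f) powi (- J) < e/4" using ex_powi_less[of "e/4", where 'f='f] e by auto
    have "B \<in> S" if B: "\<forall>i j. B $ i $ j - A $ i $ j \<in> fideal J" for B
    proof -
      have *: "dist (B $ i $ j) (A $ i $ j) < e / 4" for i j
        using B J by (meson fideal_dist le_less_trans)
      have "dist (B $ i) (A $ i) < e / 2" for i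
      proof -
        have "dist (B $ i) (A $ i) \<le> (\<Sum>j\<in>UNIV. dist (B $ i $ j) (A $ i $ j))"
          by (simp add: dist_vec_def L2_set_le_sum)
        also have "\<dots> < e/2" using *[of i 1] *[of i 2] by (simp add: sum_2)
        finally show ?thesis .
      qed note ** = this
      have "dist B A \<le> (\<Sum>i\<in>UNIV. dist (B $ i) (A $ i))"
        by (simp add: dist_vec_def[of B A] L2_set_le_sum)
      also have "\<dots> < e" using **[of 1] **[of 2] by (simp add: sum_2)
      finally show ?thesis using e by blast
    qed
    then show "\<exists>J\<ge>1. \<forall>B. (\<forall>i j. B $ i $ j - A $ i $ j \<in> fideal J) \<longrightarrow> B \<in> S" using J by blast
  qed
next
  assume *: "\<forall>A\<in>S. \<exists>J\<ge>1. \<forall>B. (\<forall>i j. B $ i $ j - A $ i $ j \<in> fideal J) \<longrightarrow> B \<in> S"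
  show "open S"
  proof (subst open_dist, intro ballI)
    fix A assume "A \<in> S"
    then obtain J where J: "\<forall>B. (\<forall>i j. B $ i $ j - A $ i $ j \<in> fideal J) \<longrightarrow> B \<in> S" using * by blast
    show "\<exists>e>0. \<forall>B. dist B A < e \<longrightarrow> B \<in> S"
    proof (intro exI[of _ "rq TYPE('f) powi (- J)"] conjI allI impI)
      show "0 < rq TYPE('f) powi (- J)" using rq_gt_1[where 'f='f] by simp
      fix B assume B: "dist B A < rq TYPE('f) powi (- J)"
      have "dist (B $ i $ j) (A $ i $ j) \<le> dist B A" for i j
        using dist_vec_nth_le[of "B $ i" j "A $ i"] dist_vec_nth_le[of B i A] by linarith
      then have "dist (B $ i $ j) (A $ i $ j) \<le> rq TYPE('f) powi - J" for i j
        using B by (meson order_trans less_imp_le)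
      then show "B \<in> S" using J by (simp add: fideal_dist)
    qed
  qed
qed

text \<open>Closed in a complete space, and totally bounded by finite systems of representatives;
  this is where finiteness of the residue field enters the topology.\<close>

lemma compact_fideal: "compact (fideal i :: 'f::nonarch_local_field set)"
proof -
  have "closed (fideal i :: 'f set)"
  proof (simp add: closed_def open_nonarch_iff, intro ballI)
    fix x :: 'f assume "x \<in> - fideal i"
    have "x \<in> fideal i" if "y - x \<in> fideal (max 1 i)" "y \<in> fideal i" for y
      using fideal_diff[of y i "y - x"] fideal_mono[of "y - x" "max 1 i" i] that by simp
    with \<open>x \<in> - fideal i\<close> have "\<forall>y. y - x \<in> fideal (max 1 i) \<longrightarrow> y \<notin> fideal i" by auto
    then show "\<exists>J\<ge>1. \<forall>y. y - x \<in> fideal J \<longrightarrow> y \<notin> fideal i" by (intro exI[of _ "max 1 i"]) auto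
  qed
  then have "complete (fideal i :: 'f set)" using complete_eq_closed by blast
  moreover have "\<exists>k. finite k \<and> (fideal i :: 'f set) \<subseteq> (\<Union>x\<in>k. ball x e)" if e: "0 < e" for e :: real
  proof -
    obtain J where J: "J \<ge> i" "rq TYPE('f) powi (- J) < e" using ex_powi_less[OF e, of i, where 'f='f] by blast
    obtain R :: "'f set" where R: "reps i J R" using ex_reps[OF J(1)] by blast
    have "fideal i \<subseteq> (\<Union>x\<in>R. ball x e)"
    proof
      fix z :: 'f assume "z \<in> fideal i"
      from repsE[OF R this] obtain s where s: "s \<in> R" "z - s \<in> fideal J" by metis
      then have "dist z s < e" using J by (meson fideal_dist le_less_trans)
      then show "z \<in> (\<Union>x\<in>R. ball x e)" using s by (auto simp: dist_commute)
    qed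
    with reps_finite[OF R] show ?thesis by (intro exI[of _ R] conjI)
  qed
  ultimately show ?thesis unfolding compact_eq_totally_bounded by (intro conjI allI impI)
qed

section \<open>Two by two matrices\<close>

lemma mat2_nth [simp]:
  "mat2 a b c d $ 1 $ 1 = a" "mat2 a b c d $ 1 $ 2 = b"
  "mat2 a b c d $ 2 $ 1 = c" "mat2 a b c d $ 2 $ 2 = d"
  by (simp_all add: mat2_def vector_2)

lemma mat2_eta: "mat2 (A $ 1 $ 1) (A $ 1 $ 2) (A $ 2 $ 1) (A $ 2 $ 2) = A"
  by (simp add: vec_eq_iff forall_2)

lemma mat2_cases [case_names mat2]: obtains a b c d where "A = mat2 a b c d"
  using mat2_eta[of A] by metis

lemma mat2_eq_iff [simp]: "mat2 a b c d = mat2 a' b' c' d' \<longleftrightarrow> a = a' \<and> b = b' \<and> c = c' \<and> d = d'"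
  by (auto simp: vec_eq_iff forall_2)

lemma mat2_mult [simp]:
  "mat2 a b c d ** mat2 a' b' c' d' =
    mat2 (a * a' + b * c') (a * b' + b * d') (c * a' + d * c') (c * b' + d * (d' :: 'f::comm_ring_1))"
  by (simp add: vec_eq_iff forall_2 matrix_matrix_mult_def sum_2)

lemma mat_eq_mat2: "mat s = mat2 s 0 0 s"
  by (simp add: vec_eq_iff forall_2 mat_def)

lemma det_mat2 [simp]: "det (mat2 a b c d) = a * d - b * (c :: 'f::comm_ring_1)"
  by (simp add: det_2)

definition inv2 :: "'f::field^2^2 \<Rightarrow> 'f^2^2"
  where "inv2 A = mat2 (A $ 2 $ 2 / det A) (- A $ 1 $ 2 / det A) (- A $ 2 $ 1 / det A) (A $ 1 $ 1 / det A)"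

lemma inv2: assumes "det A \<noteq> 0" shows "A ** inv2 A = mat 1" "inv2 A ** A = mat 1"
proof -
  obtain a b c d where A: "A = mat2 a b c d" by (cases A rule: mat2_cases)
  define D where "D = det A"
  have D: "D \<noteq> 0" "a * d - b * c = D" using assms by (simp_all add: D_def A)
  have i: "inv2 A = mat2 (d / D) (- b / D) (- c / D) (a / D)" by (simp add: inv2_def D_def A)
  show "A ** inv2 A = mat 1" unfolding i unfolding A mat_eq_mat2 mat2_mult mat2_eq_iff
    using D by (simp add: divide_simps) (simp add: algebra_simps)
  show "inv2 A ** A = mat 1" unfolding i unfolding A mat_eq_mat2 mat2_mult mat2_eq_iff
    using D by (simp add: divide_simps) (simp add: algebra_simps)
qed

lemma det_inv2: assumes "det A \<noteq> 0" shows "det (inv2 A) = inverse (det A)"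
proof -
  have "det A * det (inv2 A) = 1" using inv2(1)[OF assms] det_mul[of A "inv2 A"] by simp
  then show ?thesis using assms by (simp add: field_simps)
qed

section \<open>Principal congruence subgroups and matrices with primitive rows\<close>

definition cong_subgroup :: "int \<Rightarrow> ('f::nonarch_local_field^2^2) set"
  where "cong_subgroup M = {k. k $ 1 $ 1 - 1 \<in> fideal M \<and> k $ 1 $ 2 \<in> fideal M \<and>
    k $ 2 $ 1 \<in> fideal M \<and> k $ 2 $ 2 - 1 \<in> fideal M}"

lemma mat2_cong_subgroup [simp]: "mat2 p q r s \<in> cong_subgroup M \<longleftrightarrow>
    p - 1 \<in> fideal M \<and> q \<in> fideal M \<and> r \<in> fideal M \<and> s - 1 \<in> fideal M"
  by (simp add: cong_subgroup_def)

lemma cong_subgroupE: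
  assumes "k \<in> cong_subgroup M"
  obtains p q r s where "k = mat2 (1 + p) q r (1 + s)"
    "p \<in> fideal M" "q \<in> fideal M" "r \<in> fideal M" "s \<in> fideal M"
proof (cases k rule: mat2_cases)
  case (mat2 p q r s)
  with assms show thesis by (intro that[of "p - 1" q r "s - 1"]) auto
qed

lemma cong_subgroup_mono: "k \<in> cong_subgroup M \<Longrightarrow> M' \<le> M \<Longrightarrow> k \<in> cong_subgroup M'"
  by (auto simp: cong_subgroup_def intro: fideal_mono)

lemma mat_1_cong_subgroup [simp]: "mat 1 \<in> cong_subgroup M"
  by (simp add: mat_eq_mat2)

lemma cong_subgroup_det:
  assumes "k \<in> cong_subgroup M" "1 \<le> M"
  shows "det k - 1 \<in> fideal M" "det k \<noteq> 0" "val (det k) = 0"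
proof -
  from assms(1) obtain p q r s where k: "k = mat2 (1 + p) q r (1 + s)"
    "p \<in> fideal M" "q \<in> fideal M" "r \<in> fideal M" "s \<in> fideal M" by (rule cong_subgroupE)
  have "det k - 1 = p * s + p + s - q * r" by (simp add: k algebra_simps)
  also have "\<dots> \<in> fideal M"
    using k assms by (intro fideal_add fideal_diff fideal_mult[of _ M _ M]) auto
  finally show *: "det k - 1 \<in> fideal M" .
  show "det k \<noteq> 0" "val (det k) = 0" using one_unit[OF *] assms by auto
qed

lemma cong_subgroup_mult:
  assumes "k \<in> cong_subgroup M" "l \<in> cong_subgroup M" "1 \<le> M"
  shows "k ** l \<in> cong_subgroup M"
proof -
  from assms(1) obtain p q r s where k: "k = mat2 (1 + p) q r (1 + s)"
    "p \<in> fideal M" "q \<in> fideal M" "r \<in> fideal M" "s \<in> fideal M" by (rule cong_subgroupE)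
  from assms(2) obtain p' q' r' s' where l: "l = mat2 (1 + p') q' r' (1 + s')"
    "p' \<in> fideal M" "q' \<in> fideal M" "r' \<in> fideal M" "s' \<in> fideal M" by (rule cong_subgroupE)
  have m: "x * y \<in> fideal M" if "x \<in> fideal M" "y \<in> fideal M" for x y :: 'a
    using that assms by (auto intro: fideal_mult[of _ M _ M])
  have e: "(1 + p) * (1 + p') + q * r' - 1 = p + p' + p * p' + q * r'"
      "r * q' + (1 + s) * (1 + s') - 1 = s + s' + s * s' + r * q'"
      "(1 + p) * q' + q * (1 + s') = q' + q + p * q' + q * s'"
      "r * (1 + p') + (1 + s) * r' = r + r' + r * p' + s * r'"
    by (simp_all add: algebra_simps)
  show ?thesis unfolding k l mat2_mult mat2_cong_subgroup e
    using k l by (intro conjI fideal_add m) auto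
qed

lemma cong_subgroup_inv:
  assumes "k \<in> cong_subgroup M" "1 \<le> M"
  shows "inv2 k \<in> cong_subgroup M"
proof -
  from assms(1) obtain p q r s where k: "k = mat2 (1 + p) q r (1 + s)"
    "p \<in> fideal M" "q \<in> fideal M" "r \<in> fideal M" "s \<in> fideal M" by (rule cong_subgroupE)
  note D = cong_subgroup_det[OF assms]
  have *: "(1 + x) / det k - 1 \<in> fideal M" if "x \<in> fideal M" for x
  proof -
    have "(1 + x) / det k - 1 = (x - (det k - 1)) / det k" using D by (simp add: field_simps)
    also have "\<dots> \<in> fideal M" using D that by (simp add: fideal_divide_iff fideal_diff)
    finally show ?thesis .
  qed
  have "inv2 k = mat2 ((1 + s) / det k) (- q / det k) (- r / det k) ((1 + p) / det k)"
    by (simp add: inv2_def k)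
  then show ?thesis using * k D by (simp add: fideal_divide_iff)
qed

text \<open>A normalised representative of a point of the projective line, unique up to a unit. If
  both rows of a matrix are primitive, the valuation of its determinant measures how close the two
  points are.\<close>

definition prim :: "'f::nonarch_local_field \<Rightarrow> 'f \<Rightarrow> bool"
  where "prim a b \<longleftrightarrow> a \<in> fideal 0 \<and> b \<in> fideal 0 \<and> (a \<notin> fideal 1 \<or> b \<notin> fideal 1)"

lemma prim_ex:
  assumes "a \<noteq> 0 \<or> b \<noteq> 0"
  obtains s where "s \<noteq> 0" "prim (a / s) (b / s)" "s = a \<or> s = b"
proof -
  consider "a \<noteq> 0" "b \<in> fideal (val a)" | "b \<noteq> 0" "a \<in> fideal (val b)"
    using assms linear[of "val a" "val b"] by (cases "a = 0"; cases "b = 0") (auto simp: fideal_iff)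
  then show thesis
  proof cases
    case 1 then show ?thesis by (intro that[of a]) (auto simp: prim_def fideal_divide_iff)
  next
    case 2 then show ?thesis by (intro that[of b]) (auto simp: prim_def fideal_divide_iff)
  qed
qed

definition prim_rows :: "'f::nonarch_local_field^2^2 \<Rightarrow> bool"
  where "prim_rows A \<longleftrightarrow> prim (A $ 1 $ 1) (A $ 1 $ 2) \<and> prim (A $ 2 $ 1) (A $ 2 $ 2)"

lemma prim_rows_mat2 [simp]: "prim_rows (mat2 a b c d) \<longleftrightarrow> prim a b \<and> prim c d"
  by (simp add: prim_rows_def)

lemma prim_rows_ex:
  assumes "det A \<noteq> 0"
  obtains s s' B where "s \<noteq> 0" "s' \<noteq> 0" "A = mat2 s 0 0 s' ** B" "prim_rows B" "det A = s * s' * det B"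
    "s = A $ 1 $ 1 \<or> s = A $ 1 $ 2" "s' = A $ 2 $ 1 \<or> s' = A $ 2 $ 2"
proof (cases A rule: mat2_cases)
  case (mat2 a b c d)
  have "a \<noteq> 0 \<or> b \<noteq> 0" "c \<noteq> 0 \<or> d \<noteq> 0" using assms mat2 by auto
  obtain s where s: "s \<noteq> 0" "prim (a / s) (b / s)" "s = a \<or> s = b" using prim_ex[OF \<open>a \<noteq> 0 \<or> b \<noteq> 0\<close>] .
  obtain s' where s': "s' \<noteq> 0" "prim (c / s') (d / s')" "s' = c \<or> s' = d" using prim_ex[OF \<open>c \<noteq> 0 \<or> d \<noteq> 0\<close>] .
  show thesis using s s' mat2
    by (intro that[of s s' "mat2 (a / s) (b / s) (c / s') (d / s')"]) (auto simp: field_simps)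
qed

lemma prim_pert:
  assumes "prim a b" "a' - a \<in> fideal M" "b' - b \<in> fideal M" "1 \<le> M"
  shows "prim a' b'"
proof -
  have "a' \<in> fideal i \<longleftrightarrow> a \<in> fideal i" "b' \<in> fideal i \<longleftrightarrow> b \<in> fideal i" if "i \<le> 1" for i
    using fideal_add[of "a' - a" i a] fideal_diff[of a' i "a' - a"]
      fideal_add[of "b' - b" i b] fideal_diff[of b' i "b' - b"] that assms fideal_mono[of _ M i] by auto
  then show ?thesis using assms by (simp add: prim_def)
qed

lemma prim_rows_cong_subgroup:
  assumes "prim_rows A" "k \<in> cong_subgroup M" "0 \<le> M"
  shows "(A ** k) $ i $ j - A $ i $ j \<in> fideal M"
proof (cases A rule: mat2_cases)
  case (mat2 a b c d)
  from assms(2) obtain p q r s where k: "k = mat2 (1 + p) q r (1 + s)"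
    "p \<in> fideal M" "q \<in> fideal M" "r \<in> fideal M" "s \<in> fideal M" by (rule cong_subgroupE)
  have *: "a \<in> fideal 0" "b \<in> fideal 0" "c \<in> fideal 0" "d \<in> fideal 0"
    using assms(1) mat2 by (auto simp: prim_def)
  have m: "x * y \<in> fideal M" if "x \<in> fideal 0" "y \<in> fideal M" for x y :: 'a
    using that assms by (auto intro: fideal_mult[of _ 0 _ M])
  have "a * p + b * r \<in> fideal M" "a * q + b * s \<in> fideal M" "c * p + d * r \<in> fideal M" "c * q + d * s \<in> fideal M"
    using * k by (auto intro!: fideal_add m)
  then show ?thesis using exhaust_2[of i] exhaust_2[of j] mat2 k by (auto simp: algebra_simps)
qed

section \<open>Sections over the torus quotient\<close>

text \<open>Functions on \<open>G\<close> are lifted to functions of matrices, extended by \<open>0\<close> to singular matrices.\<close>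

definition level :: "int \<Rightarrow> ('f::nonarch_local_field^2^2 \<Rightarrow> complex) \<Rightarrow> bool"
  where "level M f \<longleftrightarrow> 1 \<le> M \<and> (\<forall>A. \<forall>k\<in>cong_subgroup M. f (A ** k) = f A)"

definition equiv_section :: "('f::nonarch_local_field \<Rightarrow> complex) \<Rightarrow> ('f^2^2 \<Rightarrow> complex) \<Rightarrow> bool"
  where "equiv_section \<theta> f \<longleftrightarrow>
    (\<forall>s s' A. s \<noteq> 0 \<longrightarrow> s' \<noteq> 0 \<longrightarrow> f (mat2 s 0 0 s' ** A) = \<theta> s * inverse (\<theta> s') * f A) \<and>
    (\<forall>A. det A = 0 \<longrightarrow> f A = 0) \<and> (\<exists>M. level M f)"

definition support_bound :: "int \<Rightarrow> ('f::nonarch_local_field^2^2 \<Rightarrow> complex) \<Rightarrow> bool"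
  where "support_bound e f \<longleftrightarrow> (\<forall>A. prim_rows A \<longrightarrow> f A \<noteq> 0 \<longrightarrow> det A \<notin> fideal e)"

text \<open>\<open>support_bound\<close> expresses compact support modulo the torus: the coset space is the set of
  pairs of distinct points of the projective line.\<close>

definition compact_section :: "('f::nonarch_local_field \<Rightarrow> complex) \<Rightarrow> ('f^2^2 \<Rightarrow> complex) \<Rightarrow> bool"
  where "compact_section \<theta> f \<longleftrightarrow> equiv_section \<theta> f \<and> (\<exists>e. support_bound e f)"

lemma levelD: "level M f \<Longrightarrow> k \<in> cong_subgroup M \<Longrightarrow> f (A ** k) = f A"
  by (auto simp: level_def)

lemma level_mono: "level M f \<Longrightarrow> M \<le> M' \<Longrightarrow> level M' f"
  by (auto simp: level_def intro: cong_subgroup_mono)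

text \<open>Invariance need only be tested where \<open>f\<close> does not vanish: if
  \<open>f\<close> vanishes at \<open>A\<close> but not at \<open>A ** k\<close>, the hypothesis for
  \<open>A ** k\<close> and the inverse of \<open>k\<close> gives a contradiction.\<close>

lemma levelI:
  assumes "1 \<le> M" "\<And>A k. f A \<noteq> 0 \<Longrightarrow> k \<in> cong_subgroup M \<Longrightarrow> f (A ** k) = f A"
  shows "level M f"
proof -
  have "f (A ** k) = f A" if k: "k \<in> cong_subgroup M" for A k
  proof (cases "f A = 0 \<and> f (A ** k) \<noteq> 0")
    case True
    have "A ** k ** inv2 k = A"
      using inv2(1)[OF cong_subgroup_det(2)[OF k assms(1)]] by (simp flip: matrix_mul_assoc)
    then show ?thesis using assms(2)[of "A ** k" "inv2 k"] True cong_subgroup_inv[OF k assms(1)] by simp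
  qed (use assms(2)[OF _ k, of A] in metis)
  then show ?thesis using assms by (auto simp: level_def)
qed

lemma equiv_section_scale:
  "equiv_section \<theta> f \<Longrightarrow> s \<noteq> 0 \<Longrightarrow> s' \<noteq> 0 \<Longrightarrow> f (mat2 s 0 0 s' ** A) = \<theta> s * inverse (\<theta> s') * f A"
  by (auto simp: equiv_section_def)

lemma equiv_section_scale2:
  assumes "equiv_section \<theta> f" "s \<noteq> 0" "s' \<noteq> 0"
  shows "f (mat2 (s * a) (s * b) (s' * c) (s' * d)) = \<theta> s * inverse (\<theta> s') * f (mat2 a b c d)"
  using equiv_section_scale[OF assms, of "mat2 a b c d"] by simp

lemma compact_section_scale:
  "compact_section \<theta> f \<Longrightarrow> s \<noteq> 0 \<Longrightarrow> s' \<noteq> 0 \<Longrightarrow> f (mat2 s 0 0 s' ** A) = \<theta> s * inverse (\<theta> s') * f A"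
  "compact_section \<theta> f \<Longrightarrow> s \<noteq> 0 \<Longrightarrow> s' \<noteq> 0 \<Longrightarrow>
    f (mat2 (s * a) (s * b) (s' * c) (s' * d)) = \<theta> s * inverse (\<theta> s') * f (mat2 a b c d)"
  using equiv_section_scale equiv_section_scale2 by (auto simp: compact_section_def)

lemma compact_section_singular: "compact_section \<theta> f \<Longrightarrow> det A = 0 \<Longrightarrow> f A = 0"
  by (auto simp: equiv_section_def compact_section_def)

lemma compact_sectionE:
  assumes "compact_section \<theta> f"
  obtains M e where "level M f" "support_bound e f"
  using assms by (auto simp: equiv_section_def compact_section_def)

lemma level_add: "level M f \<Longrightarrow> level M g \<Longrightarrow> level M (\<lambda>A. f A + g A)"
  and level_mult: "level M f \<Longrightarrow> level M g \<Longrightarrow> level M (\<lambda>A. f A * g A)"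
  by (simp_all add: level_def)

lemma support_bound_mono: "support_bound e f \<Longrightarrow> e \<le> e' \<Longrightarrow> support_bound e' f"
  unfolding support_bound_def by (meson fideal_mono)

lemma compact_section_0 [simp]: "compact_section \<theta> (\<lambda>_. 0)"
  unfolding compact_section_def equiv_section_def level_def support_bound_def by auto

lemma compact_section_add:
  assumes "compact_section \<theta> f" "compact_section \<theta> g"
  shows "compact_section \<theta> (\<lambda>A. f A + g A)"
proof -
  obtain M e where f: "level M f" "support_bound e f" using assms(1) by (rule compact_sectionE)
  obtain M' e' where g: "level M' g" "support_bound e' g" using assms(2) by (rule compact_sectionE)
  have "level (max M M') (\<lambda>A. f A + g A)"
    using level_mono[OF f(1), of "max M M'"] level_mono[OF g(1), of "max M M'"] by (simp add: level_add)
  moreover have "support_bound (max e e') (\<lambda>A. f A + g A)"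
    using support_bound_mono[OF f(2), of "max e e'"] support_bound_mono[OF g(2), of "max e e'"]
    unfolding support_bound_def by auto
  ultimately show ?thesis using assms unfolding compact_section_def equiv_section_def
    by (auto simp: algebra_simps)
qed

lemma compact_section_cmult:
  assumes "compact_section \<theta> f"
  shows "compact_section \<theta> (\<lambda>A. c * f A)"
  using assms unfolding compact_section_def equiv_section_def level_def support_bound_def
  by (auto simp: algebra_simps)

lemma compact_section_sum:
  "finite I \<Longrightarrow> (\<And>i. i \<in> I \<Longrightarrow> compact_section \<theta> (f i)) \<Longrightarrow> compact_section \<theta> (\<lambda>A. \<Sum>i\<in>I. f i A)"
  by (induction I rule: finite_induct) (auto intro: compact_section_add)

lemma compact_section_diff:
  assumes "compact_section \<theta> f" "compact_section \<theta> g"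
  shows "compact_section \<theta> (\<lambda>A. f A - g A)"
  using compact_section_add[OF assms(1) compact_section_cmult[OF assms(2), of "- 1"]] by simp

lemma compact_section_prod:
  assumes "equiv_section \<theta> f" "compact_section \<theta>' g" "\<And>s. s \<noteq> 0 \<Longrightarrow> \<theta> s * \<theta>' s = 1"
  shows "compact_section (\<lambda>_. 1) (\<lambda>A. f A * g A)"
proof -
  obtain M e where g: "level M g" "support_bound e g" using assms(2) by (rule compact_sectionE)
  obtain M' where f: "level M' f" using assms(1) by (auto simp: equiv_section_def)
  have "level (max M M') (\<lambda>A. f A * g A)"
    using level_mono[OF f, of "max M M'"] level_mono[OF g(1), of "max M M'"] by (simp add: level_mult)
  moreover have "support_bound e (\<lambda>A. f A * g A)" using g(2) by (auto simp: support_bound_def)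
  moreover have "f (mat2 s 0 0 s' ** A) * g (mat2 s 0 0 s' ** A) = f A * g A" if "s \<noteq> 0" "s' \<noteq> 0" for s s' A
  proof -
    have "f (mat2 s 0 0 s' ** A) * g (mat2 s 0 0 s' ** A) =
        (\<theta> s * \<theta>' s) * inverse (\<theta> s' * \<theta>' s') * (f A * g A)"
      using equiv_section_scale[OF assms(1) that, of A] compact_section_scale(1)[OF assms(2) that, of A]
      by (simp add: algebra_simps)
    then show ?thesis using assms(3) that by simp
  qed
  ultimately show ?thesis using assms(1)
    unfolding compact_section_def equiv_section_def by auto
qed

text \<open>The support condition without normalising the rows: the scalar that makes a row
  primitive has valuation at most that of any nonzero entry. It is used to show that a section
  vanishes at a matrix whose determinant is too small compared with its entries.\<close>

lemma support_bound_val: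
  assumes f: "compact_section \<theta> f" "support_bound e f" and A: "f A \<noteq> 0"
    and x: "x = A $ 1 $ 1 \<or> x = A $ 1 $ 2" "x \<noteq> 0" and y: "y = A $ 2 $ 1 \<or> y = A $ 2 $ 2" "y \<noteq> 0"
  shows "val (det A) < e + val x + val y"
proof -
  have d: "det A \<noteq> 0" using compact_section_singular[OF f(1)] A by auto
  obtain s s' B where B: "s \<noteq> 0" "s' \<noteq> 0" "A = mat2 s 0 0 s' ** B" "prim_rows B" "det A = s * s' * det B"
    using prim_rows_ex[OF d] by metis
  have dB: "det B \<noteq> 0" using B d by auto
  have "f B \<noteq> 0" using A B compact_section_scale(1)[OF f(1), of s s' B] by auto
  then have 1: "val (det B) < e" using f(2) B dB by (auto simp: support_bound_def fideal_iff)
  obtain a b c d where B': "B = mat2 a b c d" by (cases B rule: mat2_cases)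
  have "a \<in> fideal 0" "b \<in> fideal 0" "c \<in> fideal 0" "d \<in> fideal 0" using B(4) by (auto simp: B' prim_def)
  moreover have "x = s * a \<or> x = s * b" "y = s' * c \<or> y = s' * d" using x y B by (auto simp: B')
  ultimately have "x \<in> fideal (val s)" "y \<in> fideal (val s')" using B(1,2) by (auto simp: fideal_mult_iff)
  then have "val s \<le> val x" "val s' \<le> val y" using x y by (auto simp: fideal_iff)
  then show ?thesis using 1 B dB by (simp add: val_mult)
qed

text \<open>The four conditions say that the adjugate of the old matrix times the difference of the
  two matrices, divided by the determinant \<open>D\<close>, has entries in the ideal of exponent
  \<open>M\<close>; hence the new matrix is the old one times an element of
  \<open>cong_subgroup M\<close>.\<close>

lemma level_perturb:
  assumes "level M f" and D: "D = a * d - b * c" "D \<noteq> 0"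
    and "d * (a' - a) - b * (c' - c) \<in> fideal (M + val D)" "d * (b' - b) - b * (d' - d) \<in> fideal (M + val D)"
      "a * (c' - c) - c * (a' - a) \<in> fideal (M + val D)" "a * (d' - d) - c * (b' - b) \<in> fideal (M + val D)"
  shows "f (mat2 a' b' c' d') = f (mat2 a b c d)"
proof -
  define k where "k = inv2 (mat2 a b c d) ** mat2 a' b' c' d'"
  have B: "mat2 a' b' c' d' = mat2 a b c d ** k"
    using inv2(1)[of "mat2 a b c d"] D by (simp add: k_def matrix_mul_assoc del: mat2_mult)
  have 1: "d * a' / D - b * c' / D - 1 = (d * (a' - a) - b * (c' - c)) / D"
    "a * d' / D - c * b' / D - 1 = (a * (d' - d) - c * (b' - b)) / D"
    "d * b' / D - b * d' / D = (d * (b' - b) - b * (d' - d)) / D"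
    "a * c' / D - c * a' / D = (a * (c' - c) - c * (a' - a)) / D"
    using D(2) by (simp_all add: field_simps) (simp_all add: D(1) algebra_simps)
  have "k = mat2 (d * a' / D - b * c' / D) (d * b' / D - b * d' / D)
      (a * c' / D - c * a' / D) (a * d' / D - c * b' / D)"
    by (simp add: k_def inv2_def D(1))
  then have "k \<in> cong_subgroup M" using assms(3-) by (simp add: 1 fideal_divide_iff)
  then show ?thesis using B levelD[OF assms(1)] by simp
qed

lemma ex_fideal4: "\<exists>i. x \<in> fideal i \<and> y \<in> fideal i \<and> z \<in> fideal i \<and> w \<in> fideal i"
  by (rule exI[of _ "min (min (val x) (val y)) (min (val z) (val w))"])
    (intro conjI fideal_mono[OF fideal_self], auto)

lemma mat_entries_bounded: "\<exists>i\<le>i0. \<forall>m n. (A :: 'f::nonarch_local_field^2^2) $ m $ n \<in> fideal i"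
proof -
  obtain i where i: "A $ 1 $ 1 \<in> fideal i" "A $ 1 $ 2 \<in> fideal i" "A $ 2 $ 1 \<in> fideal i" "A $ 2 $ 2 \<in> fideal i"
    using ex_fideal4 by blast
  then show ?thesis by (intro exI[of _ "min i i0"]) (auto simp: forall_2 intro: fideal_mono)
qed

text \<open>With \<open>h ** h' = mat 1\<close>, conjugation sends 1 + X to 1 + h X h', so the level
  drops at most by the denominators of \<open>h\<close> and \<open>h'\<close>.\<close>

lemma cong_subgroup_conj:
  assumes h: "\<And>m n. h $ m $ n \<in> fideal i" and h': "\<And>m n. h' $ m $ n \<in> fideal j" "h ** h' = mat 1"
    and k: "k \<in> cong_subgroup M'" and M: "M \<le> M' + i + j"
  shows "h ** k ** h' \<in> cong_subgroup M"
proof -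
  obtain p q r s where k: "k = mat2 (1 + p) q r (1 + s)"
    "p \<in> fideal M'" "q \<in> fideal M'" "r \<in> fideal M'" "s \<in> fideal M'" using cong_subgroupE[OF k] .
  obtain a b c d where A: "h = mat2 a b c d" by (cases h rule: mat2_cases)
  obtain a' b' c' d' where B: "h' = mat2 a' b' c' d'" by (cases h' rule: mat2_cases)
  have 1: "a * a' + b * c' = 1" "a * b' + b * d' = 0" "c * a' + d * c' = 0" "c * b' + d * d' = 1"
    using h'(2) by (auto simp: A B mat_eq_mat2)
  have *: "x * y * z \<in> fideal M"
    if "x = a \<or> x = b \<or> x = c \<or> x = d" "y \<in> fideal M'" "z = a' \<or> z = b' \<or> z = c' \<or> z = d'" for x y z
  proof -
    have "x \<in> fideal i" using that(1) h[of 1 1] h[of 1 2] h[of 2 1] h[of 2 2] by (auto simp: A)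
    moreover have "z \<in> fideal j" using that(3) h'(1)[of 1 1] h'(1)[of 1 2] h'(1)[of 2 1] h'(1)[of 2 2]
      by (auto simp: B)
    ultimately show ?thesis using that(2) M
      by (intro fideal_mult[of _ "i + M'" _ j] fideal_mult[of x i y M']) auto
  qed
  have e: "(a * (1 + p) + b * r) * a' + (a * q + b * (1 + s)) * c' - 1 =
      a * p * a' + b * r * a' + a * q * c' + b * s * c'"
    "(a * (1 + p) + b * r) * b' + (a * q + b * (1 + s)) * d' =
      a * p * b' + b * r * b' + a * q * d' + b * s * d'"
    "(c * (1 + p) + d * r) * a' + (c * q + d * (1 + s)) * c' =
      c * p * a' + d * r * a' + c * q * c' + d * s * c'"
    "(c * (1 + p) + d * r) * b' + (c * q + d * (1 + s)) * d' - 1 =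
      c * p * b' + d * r * b' + c * q * d' + d * s * d'"
    using 1 by algebra+
  show ?thesis unfolding A B k(1) mat2_mult mat2_cong_subgroup e
    using k by (intro conjI fideal_add *) auto
qed

lemma level_right:
  assumes "level M f" "det h \<noteq> 0"
  shows "\<exists>M'. level M' (\<lambda>A. f (A ** h))"
proof -
  obtain i where i: "i \<le> 0" "\<And>m n. h $ m $ n \<in> fideal i" using mat_entries_bounded[of 0 h] by blast
  obtain j where j: "j \<le> 0" "\<And>m n. inv2 h $ m $ n \<in> fideal j" using mat_entries_bounded[of 0 "inv2 h"] by blast
  have M: "1 \<le> M" using assms by (auto simp: level_def)
  have "f (A ** k ** h) = f (A ** h)" if k: "k \<in> cong_subgroup (M - i - j)" for A k
  proof -
    have "inv2 h ** k ** h \<in> cong_subgroup M"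
      using cong_subgroup_conj[OF j(2) i(2) inv2(2)[OF assms(2)] k, of M] by simp
    moreover have "A ** k ** h = A ** h ** (inv2 h ** k ** h)"
      using inv2(1)[OF assms(2)] by (metis matrix_mul_assoc matrix_mul_rid)
    ultimately show ?thesis using levelD[OF assms(1)] by simp
  qed
  then show ?thesis using M i j by (intro exI[of _ "M - i - j"]) (auto simp: level_def)
qed

lemma compact_section_right:
  assumes f: "compact_section \<theta> f" and h: "det h \<noteq> 0"
  shows "compact_section \<theta> (\<lambda>A. f (A ** h))"
proof -
  obtain M e where M: "level M f" "support_bound e f" using f by (rule compact_sectionE)
  obtain j where j: "j \<le> 0" "\<And>m n. inv2 h $ m $ n \<in> fideal j" using mat_entries_bounded[of 0 "inv2 h"] by blast
  \<comment> \<open>A row of \<open>A ** h\<close> cannot be very divisible: multiplying back by the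
    inverse of \<open>h\<close> would make the primitive row of \<open>A\<close> divisible by the
    uniformizer.\<close>
  have row: "\<exists>n. (A ** h) $ m $ n \<noteq> 0 \<and> val ((A ** h) $ m $ n) \<le> - j" if A: "prim_rows A" for A m
  proof (rule ccontr)
    assume *: "\<not> ?thesis"
    define B where "B = A ** h"
    have B: "B $ m $ n \<in> fideal (1 - j)" for n using * by (cases "B $ m $ n = 0") (auto simp: B_def fideal_iff not_le)
    have "A = B ** inv2 h" using inv2(1)[OF h] by (simp add: B_def flip: matrix_mul_assoc)
    then have "A $ m $ n = B $ m $ 1 * inv2 h $ 1 $ n + B $ m $ 2 * inv2 h $ 2 $ n" for n
      by (simp add: matrix_matrix_mult_def sum_2)
    also have "\<dots> n \<in> fideal 1" for n
      using B j by (intro fideal_add fideal_mult[of _ "1 - j" _ j]) auto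
    finally have "A $ m $ n \<in> fideal 1" for n .
    then show False using A exhaust_2[of m] by (auto simp: prim_rows_def prim_def)
  qed
  have "support_bound (e - 2 * j - val (det h)) (\<lambda>A. f (A ** h))"
    unfolding support_bound_def
  proof (intro allI impI)
    fix A assume A: "prim_rows A" "f (A ** h) \<noteq> 0"
    obtain n where n: "(A ** h) $ 1 $ n \<noteq> 0" "val ((A ** h) $ 1 $ n) \<le> - j" using row[OF A(1)] by blast
    obtain n' where n': "(A ** h) $ 2 $ n' \<noteq> 0" "val ((A ** h) $ 2 $ n') \<le> - j" using row[OF A(1)] by blast
    have "val (det (A ** h)) < e + val ((A ** h) $ 1 $ n) + val ((A ** h) $ 2 $ n')"
      using A n n' exhaust_2[of n] exhaust_2[of n'] by (intro support_bound_val[OF f M(2)]) auto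
    moreover have "det (A ** h) \<noteq> 0" using compact_section_singular[OF f] A by auto
    ultimately show "det A \<notin> fideal (e - 2 * j - val (det h))"
      using n n' by (auto simp: det_mul val_mult fideal_iff)
  qed
  moreover have "\<exists>M. level M (\<lambda>A. f (A ** h))" using level_right[OF M(1) h] .
  ultimately show ?thesis using f unfolding compact_section_def equiv_section_def
    by (auto simp: det_mul simp flip: matrix_mul_assoc)
qed

text \<open>Left multiplication by the Weyl element exchanges the two points of the pair, hence
  inverts the character. It commutes with all right translations, so statements about the first
  point carry over to the second.\<close>

lemma compact_section_swap:
  assumes f: "compact_section \<theta> f"
  shows "compact_section (\<lambda>s. inverse (\<theta> s)) (\<lambda>A. f (mat2 0 1 1 0 ** A))"
proof -
  obtain M e where M: "level M f" "support_bound e f" using f by (rule compact_sectionE)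
  have "level M (\<lambda>A. f (mat2 0 1 1 0 ** A))" using M(1) by (simp add: level_def matrix_mul_assoc)
  moreover have "support_bound e (\<lambda>A. f (mat2 0 1 1 0 ** A))"
    unfolding support_bound_def
  proof (intro allI impI)
    fix A assume A: "prim_rows A" "f (mat2 0 1 1 0 ** A) \<noteq> 0"
    moreover have "prim_rows (mat2 0 1 1 0 ** A)" using A by (cases A rule: mat2_cases) auto
    ultimately have "det (mat2 0 1 1 0 ** A) \<notin> fideal e" using M(2) by (auto simp: support_bound_def)
    then show "det A \<notin> fideal e" by (simp add: det_mul)
  qed
  moreover have "f (mat2 0 1 1 0 ** (mat2 s 0 0 s' ** A)) = inverse (\<theta> s) * inverse (inverse (\<theta> s')) * f (mat2 0 1 1 0 ** A)"
    if "s \<noteq> 0" "s' \<noteq> 0" for s s' A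
    using compact_section_scale(1)[OF f that(2,1), of "mat2 0 1 1 0 ** A"] by (simp add: matrix_mul_assoc)
  ultimately show ?thesis using f unfolding compact_section_def equiv_section_def
    by (auto simp: det_mul)
qed

lemma compact_section_cnj:
  assumes "compact_section \<theta> f"
  shows "compact_section (\<lambda>s. cnj (\<theta> s)) (\<lambda>A. cnj (f A))"
  using assms unfolding compact_section_def equiv_section_def level_def support_bound_def by auto

section \<open>Unitary characters\<close>

lemma mult_character_mult: "mult_character c \<Longrightarrow> a \<noteq> 0 \<Longrightarrow> b \<noteq> 0 \<Longrightarrow> c (a * b) = c a * c b"
  by (auto simp: mult_character_def)

lemma mult_character_nz: "mult_character c \<Longrightarrow> a \<noteq> 0 \<Longrightarrow> c a \<noteq> 0"
  by (auto simp: mult_character_def)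

lemma mult_character_1: "mult_character c \<Longrightarrow> c 1 = 1"
  using mult_character_mult[of c 1 1] mult_character_nz[of c 1] by simp

lemma mult_character_inverse: "mult_character c \<Longrightarrow> a \<noteq> 0 \<Longrightarrow> c (inverse a) = inverse (c a)"
  using mult_character_mult[of c a "inverse a"] mult_character_1[of c] mult_character_nz[of c a]
  by (simp add: field_simps)

lemma mult_character_cnj: "mult_character c \<Longrightarrow> a \<noteq> 0 \<Longrightarrow> cnj (c a) = inverse (c a)"
  by (auto simp: mult_character_def inverse_eq_divide complex_div_cnj[of 1])

lemma mult_character_inv: "mult_character c \<Longrightarrow> mult_character (\<lambda>a. inverse (c a))"
  unfolding mult_character_def by (auto intro!: continuous_on_inverse simp: norm_inverse)

lemma mult_character_power: "mult_character c \<Longrightarrow> a \<noteq> 0 \<Longrightarrow> c (a ^ n) = c a ^ n"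
  by (induction n) (simp_all add: mult_character_1 mult_character_mult)

text \<open>If w is on the unit circle within distance 1 of 1, then Re w > 1/2 and |w + 1| is at
  least 3/2, so squaring stretches the distance to 1 by at least 3/2. Repeated squaring would leave
  the disc unless z = 1.\<close>

lemma unit_circle_no_small_subgroup:
  assumes z: "norm z = 1" and n: "\<And>n::nat. norm (z ^ n - 1) < 1"
  shows "z = (1::complex)"
proof (rule ccontr)
  assume "z \<noteq> 1"
  have *: "norm (z ^ (2 ^ n) - 1) \<ge> (3/2) ^ n * norm (z - 1)" for n :: nat
  proof (induction n)
    case (Suc n)
    define w where "w = z ^ (2 ^ n)"
    have w: "norm w = 1" "norm (w - 1) < 1" using z n by (auto simp: w_def norm_power)
    have "(norm (w - 1))\<^sup>2 = (norm w)\<^sup>2 + 1 - 2 * Re w" unfolding cmod_power2 by (simp add: power2_eq_square algebra_simps)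
    moreover have "(norm (w - 1))\<^sup>2 < 1" using w by (simp add: power_less_one_iff abs_square_less_1)
    ultimately have "Re w > 1/2" using w by simp
    then have "norm (w + 1) \<ge> 3/2" using complex_Re_le_cmod[of "w + 1"] by simp
    then have "norm (w - 1) * (3/2) \<le> norm (w - 1) * norm (w + 1)" by (intro mult_left_mono) auto
    also have "\<dots> = norm (w ^ 2 - 1)" by (simp flip: norm_mult) (simp add: algebra_simps power2_eq_square)
    finally have "norm (w - 1) * (3/2) \<le> norm (z ^ (2 ^ Suc n) - 1)"
      by (simp add: w_def power_mult[symmetric] mult.commute)
    then show ?case using Suc by (simp add: w_def)
  qed simp
  obtain n where "inverse (norm (z - 1)) < (3/2) ^ n" using real_arch_pow[of "3/2"] by auto
  then have "1 < (3/2) ^ n * norm (z - 1)" using \<open>z \<noteq> 1\<close> by (simp add: field_simps)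
  then show False using *[of n] n[of "2 ^ n"] by linarith
qed

text \<open>By continuity the principal units of high level, which are closed under powers, are
  mapped into the open disc of radius 1 around 1; this disc contains no nontrivial subgroup of the
  circle.\<close>

lemma mult_character_conductor:
  assumes c: "mult_character (c :: 'f::nonarch_local_field \<Rightarrow> complex)"
  obtains M where "1 \<le> M" "\<And>u. u - 1 \<in> fideal M \<Longrightarrow> c u = 1"
proof -
  have "open (- {0 :: 'f})" by (intro open_Compl closed_singleton)
  moreover have "continuous_on (- {0}) c" using c by (auto simp: mult_character_def)
  ultimately have "isCont c 1" by (simp add: continuous_on_eq_continuous_at)
  then have "\<exists>d>0. \<forall>u. dist u 1 < d \<longrightarrow> dist (c u) (c 1) < 1" by (auto simp: continuous_at_eps_delta)
  then obtain d where d: "d > 0" "\<And>u. dist u 1 < d \<Longrightarrow> dist (c u) 1 < 1" using mult_character_1[OF c] by auto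
  obtain M where M: "1 \<le> M" "rq TYPE('f) powi (- M) < d" using ex_powi_less[OF d(1), of 1, where 'f='f] by blast
  have "c u = 1" if u: "u - 1 \<in> fideal M" for u
  proof (rule unit_circle_no_small_subgroup)
    have u0: "u \<noteq> 0" using one_unit[OF u M(1)] by simp
    then show "norm (c u) = 1" using c by (auto simp: mult_character_def)
    fix n
    have "u ^ n - 1 \<in> fideal M" by (induction n) (use u M in \<open>auto intro: one_unit_mult\<close>)
    then have "dist (u ^ n) 1 < d" using M(2) by (meson fideal_dist le_less_trans)
    then show "norm (c u ^ n - 1) < 1" using d(2)[of "u ^ n"] mult_character_power[OF c u0] by (simp add: dist_norm)
  qed
  then show thesis using M(1) that by blast
qed

section \<open>Cells\<close>

text \<open>A row (a,b) with a nonzero is the point of slope b/a. The cell is the equivariant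
  extension of the indicator function of two discs of slopes, equal to 1 when both first entries are
  1.\<close>

definition cell :: "('f::nonarch_local_field \<Rightarrow> complex) \<Rightarrow> 'f \<Rightarrow> 'f \<Rightarrow> int \<Rightarrow> 'f^2^2 \<Rightarrow> complex"
  where "cell \<eta> z z' j A = (if A $ 1 $ 1 \<noteq> 0 \<and> A $ 2 $ 1 \<noteq> 0 \<and>
    A $ 1 $ 2 / A $ 1 $ 1 - z \<in> fideal j \<and> A $ 2 $ 2 / A $ 2 $ 1 - z' \<in> fideal j
    then \<eta> (A $ 1 $ 1) * inverse (\<eta> (A $ 2 $ 1)) else 0)"

text \<open>The analogue with the first point near (0:1), where the coordinate is the inverse slope
  and the row is normalised by its second entry.\<close>

definition cusp_cell :: "('f::nonarch_local_field \<Rightarrow> complex) \<Rightarrow> int \<Rightarrow> 'f \<Rightarrow> int \<Rightarrow> 'f^2^2 \<Rightarrow> complex"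
  where "cusp_cell \<eta> k v j A = (if A $ 1 $ 2 \<noteq> 0 \<and> A $ 2 $ 1 \<noteq> 0 \<and>
    A $ 1 $ 1 / A $ 1 $ 2 \<in> fideal k \<and> A $ 2 $ 2 / A $ 2 $ 1 - v \<in> fideal j
    then \<eta> (A $ 1 $ 2) * inverse (\<eta> (A $ 2 $ 1)) else 0)"

definition dilate :: "'f::nonarch_local_field \<Rightarrow> ('f^2^2 \<Rightarrow> complex) \<Rightarrow> 'f^2^2 \<Rightarrow> complex"
  where "dilate b f A = f (A ** mat2 b 0 0 1)"

definition shear :: "'f::nonarch_local_field \<Rightarrow> ('f^2^2 \<Rightarrow> complex) \<Rightarrow> 'f^2^2 \<Rightarrow> complex"
  where "shear s f A = f (A ** mat2 1 s 0 1)"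

lemma dilate_section: "compact_section \<theta> f \<Longrightarrow> b \<noteq> 0 \<Longrightarrow> compact_section \<theta> (dilate b f)"
  unfolding dilate_def by (rule compact_section_right) auto

lemma shear_section: "compact_section \<theta> f \<Longrightarrow> compact_section \<theta> (shear s f)"
  unfolding shear_def by (rule compact_section_right) auto

lemma dilate_shear: "dilate b (shear s f) = shear (b * s) (dilate b f)"
  by (rule ext) (simp add: dilate_def shear_def flip: matrix_mul_assoc)

lemma dilate_dilate: "dilate b (dilate c f) = dilate (b * c) f"
  by (rule ext) (simp add: dilate_def flip: matrix_mul_assoc)

lemma dilate_linear:
  "dilate b (\<lambda>A. f A + g A) = (\<lambda>A. dilate b f A + dilate b g A)"
  "dilate b (\<lambda>A. c * f A) = (\<lambda>A. c * dilate b f A)"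
  "dilate b (\<lambda>A. \<Sum>i\<in>I. h i A) = (\<lambda>A. \<Sum>i\<in>I. dilate b (h i) A)"
  by (auto simp: dilate_def)

text \<open>Dilation divides slopes by \<open>b\<close>, so the supporting discs are multiplied by
  \<open>b\<close>. Both normalising entries acquire the same factor \<open>b\<close>, and the
  values of \<eta> cancel.\<close>

lemma dilate_cell:
  assumes \<eta>: "mult_character \<eta>" and b: "b \<noteq> 0"
  shows "dilate b (cell \<eta> z z' j) = cell \<eta> (b * z) (b * z') (j + val b)"
proof
  fix A :: "'a^2^2"
  obtain a0 b0 c0 d0 where A: "A = mat2 a0 b0 c0 d0" by (cases A rule: mat2_cases)
  have *: "y / (x * b) - z \<in> fideal j \<longleftrightarrow> y / x - b * z \<in> fideal (j + val b)" if "x \<noteq> 0" for x y z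
  proof -
    have "y / (x * b) - z = (y / x - b * z) / b" using that b by (simp add: field_simps)
    then show ?thesis using b by (simp add: fideal_divide_iff)
  qed
  have "\<eta> (a0 * b) * inverse (\<eta> (c0 * b)) = \<eta> a0 * inverse (\<eta> c0)" if "a0 \<noteq> 0" "c0 \<noteq> 0"
    using that b mult_character_mult[OF \<eta>] mult_character_nz[OF \<eta>] by (simp add: field_simps)
  then show "dilate b (cell \<eta> z z' j) A = cell \<eta> (b * z) (b * z') (j + val b) A"
    using b * by (auto simp: A dilate_def cell_def)
qed

lemma shear_cell: "shear (- s) (cell \<eta> z z' j) = cell \<eta> (z + s) (z' + s) j"
proof
  fix A :: "'a^2^2"
  obtain a0 b0 c0 d0 where A: "A = mat2 a0 b0 c0 d0" by (cases A rule: mat2_cases)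
  have "(y - x * s) / x - z = y / x - (z + s)" if "x \<noteq> 0" for x y z using that by (simp add: field_simps)
  then show "shear (- s) (cell \<eta> z z' j) A = cell \<eta> (z + s) (z' + s) j A"
    by (auto simp: A shear_def cell_def diff_diff_eq add.commute)
qed

definition conductor_bound :: "('f::nonarch_local_field \<Rightarrow> complex) \<Rightarrow> int \<Rightarrow> bool"
  where "conductor_bound \<eta> M \<longleftrightarrow> 1 \<le> M \<and> (\<forall>u. u - 1 \<in> fideal M \<longrightarrow> \<eta> u = 1)"

lemma conductor_boundD: "conductor_bound \<eta> M \<Longrightarrow> u - 1 \<in> fideal i \<Longrightarrow> M \<le> i \<Longrightarrow> \<eta> u = 1"
  by (auto simp: conductor_bound_def intro: fideal_mono)

lemma character_scale_unit:
  assumes "mult_character \<eta>" "conductor_bound \<eta> M" "x \<noteq> 0" "u - 1 \<in> fideal i" "M \<le> i"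
  shows "\<eta> (x * u) = \<eta> x" "x * u \<noteq> 0"
proof -
  have "u \<noteq> 0" using assms one_unit[of u i] by (auto simp: conductor_bound_def)
  then show "\<eta> (x * u) = \<eta> x" "x * u \<noteq> 0"
    using assms conductor_boundD[OF assms(2,4,5)] by (auto simp: mult_character_mult)
qed

text \<open>The model cell at the slopes 0 and 1. Its points have integral slopes, so a congruence
  subgroup of level \<open>j\<close> moves slopes within their discs and multiplies the first
  entries by principal units in the kernel of \<eta>.\<close>

lemma cell_section_1:
  assumes \<eta>: "mult_character \<eta>" "conductor_bound \<eta> M0" and j: "M0 \<le> j"
  shows "compact_section \<eta> (cell \<eta> 0 1 j)"
proof -
  have j1: "1 \<le> j" using \<eta> j by (auto simp: conductor_bound_def)
  \<comment> \<open>\<open>u\<close> is the factor by which the first entry of the row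
    changes.\<close>
  have row: "\<exists>u. u - 1 \<in> fideal j \<and> a * (1 + p) + b * r = a * u \<and> (a * q + b * (1 + s)) / (a * u) - z \<in> fideal j"
    if "a \<noteq> 0" "b / a - z \<in> fideal j" "z \<in> fideal 0"
      "p \<in> fideal j" "q \<in> fideal j" "r \<in> fideal j" "s \<in> fideal j" for a b p q r s z :: 'a
  proof -
    define t where "t = b / a"
    have b: "b = a * t" using that by (simp add: t_def)
    have t: "t \<in> fideal 0" using fideal_add[of "t - z" 0 z] that j1 fideal_mono[of "t - z" j 0] by (simp add: t_def)
    define u where "u = 1 + p + t * r"
    have u: "u - 1 \<in> fideal j" using that t by (auto simp: u_def intro!: fideal_add fideal_mult[of _ 0 _ j])
    note u0 = one_unit[OF u j1]
    have "(a * q + b * (1 + s)) / (a * u) - z = (q + t * s + (t - z) - z * (u - 1)) / u"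
      using that(1) u0 by (simp add: b field_simps)
    also have "\<dots> \<in> fideal j"
    proof -
      have "t * s \<in> fideal j" "z * (u - 1) \<in> fideal j"
        using that t u by (auto intro: fideal_mult[of _ 0 _ j])
      moreover have "t - z \<in> fideal j" using that by (simp add: t_def)
      ultimately have "q + t * s + (t - z) - z * (u - 1) \<in> fideal j"
        using fideal_diff[OF fideal_add[OF fideal_add[OF that(5)]]] by blast
      then show ?thesis using u0 by (simp add: fideal_divide_iff)
    qed
    finally show ?thesis using u by (intro exI[of _ u]) (auto simp: b u_def algebra_simps)
  qed
  have "level j (cell \<eta> 0 1 j)"
  proof (rule levelI[OF j1])
    fix A k :: "'a^2^2" assume A: "cell \<eta> 0 1 j A \<noteq> 0" and k: "k \<in> cong_subgroup j"
    obtain p q r s where k: "k = mat2 (1 + p) q r (1 + s)"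
      "p \<in> fideal j" "q \<in> fideal j" "r \<in> fideal j" "s \<in> fideal j" using cong_subgroupE[OF k] .
    obtain a b c d where A': "A = mat2 a b c d" by (cases A rule: mat2_cases)
    have h: "a \<noteq> 0" "c \<noteq> 0" "b / a - 0 \<in> fideal j" "d / c - 1 \<in> fideal j"
      using A by (auto simp: A' cell_def split: if_splits)
    obtain u where u: "u - 1 \<in> fideal j" "a * (1 + p) + b * r = a * u"
      "(a * q + b * (1 + s)) / (a * u) - 0 \<in> fideal j" using row[OF h(1,3) _ k(2-)] by auto
    obtain u' where u': "u' - 1 \<in> fideal j" "c * (1 + p) + d * r = c * u'"
      "(c * q + d * (1 + s)) / (c * u') - 1 \<in> fideal j" using row[OF h(2,4) _ k(2-)] by auto
    have "cell \<eta> 0 1 j (A ** k) = \<eta> (a * u) * inverse (\<eta> (c * u'))"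
      using u u' character_scale_unit(2)[OF \<eta> h(1) u(1) j] character_scale_unit(2)[OF \<eta> h(2) u'(1) j]
      by (simp add: A' k(1) cell_def)
    also have "\<dots> = \<eta> a * inverse (\<eta> c)"
      using character_scale_unit(1)[OF \<eta> h(1) u(1) j] character_scale_unit(1)[OF \<eta> h(2) u'(1) j] by simp
    also have "\<dots> = cell \<eta> 0 1 j A" using h by (simp add: A' cell_def)
    finally show "cell \<eta> 0 1 j (A ** k) = cell \<eta> 0 1 j A" .
  qed
  moreover have "support_bound 1 (cell \<eta> 0 1 j)" unfolding support_bound_def
  proof (intro allI impI)
    fix A assume A: "prim_rows A" "cell \<eta> 0 1 j A \<noteq> 0"
    obtain a b c d where A': "A = mat2 a b c d" by (cases A rule: mat2_cases)
    have h: "a \<noteq> 0" "c \<noteq> 0" "b / a \<in> fideal j" "d / c - 1 \<in> fideal j"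
      using A by (auto simp: A' cell_def split: if_splits)
    have d0: "d \<noteq> 0" "val d = val c" using one_unit[OF h(4) j1] h by (auto simp: val_divide)
    have b: "b \<in> fideal (j + val a)" using h by (simp add: fideal_divide_iff)
    have "val a = 0" "val c = 0"
      using A(1) h b j1 d0 fideal_mono[OF b, of 1] by (auto simp: A' prim_def fideal_iff)
    have "val (a * d) = 0" "a * d \<noteq> 0" using h d0 \<open>val a = 0\<close> \<open>val c = 0\<close> by (auto simp: val_mult)
    moreover have "b * c \<in> fideal 1" using b \<open>val a = 0\<close> \<open>val c = 0\<close> j1 fideal_self[of c]
      by (intro fideal_mult[of _ j _ 0]) auto
    ultimately have "a * d - b * c \<noteq> 0" "val (a * d - b * c) = 0"
      using val_eqI[of "a * d" "a * d - b * c"] by auto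
    then show "det A \<notin> fideal 1" by (simp add: A' fideal_iff)
  qed
  moreover have "cell \<eta> 0 1 j (mat2 s 0 0 s' ** A) = \<eta> s * inverse (\<eta> s') * cell \<eta> 0 1 j A"
    if "s \<noteq> 0" "s' \<noteq> 0" for s s' A
    using that by (cases A rule: mat2_cases) (auto simp: cell_def mult_character_mult[OF \<eta>(1)])
  moreover have "cell \<eta> 0 1 j A = 0" if "det A = 0" for A
  proof (rule ccontr)
    assume *: "cell \<eta> 0 1 j A \<noteq> 0"
    obtain a b c d where A': "A = mat2 a b c d" by (cases A rule: mat2_cases)
    have h: "a \<noteq> 0" "c \<noteq> 0" "b / a \<in> fideal j" "d / c - 1 \<in> fideal j"
      using * by (auto simp: A' cell_def split: if_splits)
    have "b / a = d / c" using that h by (simp add: A' field_simps)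
    then have "1 \<in> fideal j" using fideal_diff[OF h(3,4)] by simp
    then show False using j1 by simp
  qed
  ultimately show ?thesis unfolding compact_section_def equiv_section_def by blast
qed

text \<open>An affine change of slope, that is a dilation by \<open>z' - z\<close> followed by a
  shear, carries the model pair (0,1) to (z,z'); the bound on \<open>j\<close> is the transported
  bound of the model.\<close>

lemma cell_section:
  assumes \<eta>: "mult_character \<eta>" "conductor_bound \<eta> M0" and z: "z \<noteq> z'" "val (z' - z) + M0 \<le> j"
  shows "compact_section \<eta> (cell \<eta> z z' j)"
proof -
  have c: "z' - z \<noteq> 0" using z by simp
  have "cell \<eta> z z' j = shear (- z) (dilate (z' - z) (cell \<eta> 0 1 (j - val (z' - z))))"
    using dilate_cell[OF \<eta>(1) c, of 0 1] by (simp add: shear_cell)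
  then show ?thesis using cell_section_1[OF \<eta>, of "j - val (z' - z)"] z c
    by (simp add: shear_section dilate_section)
qed

text \<open>The first row is normalised by its second entry, which dilation fixes, so the values of
  \<eta> no longer cancel. One disc grows while the other shrinks, and \<open>k + j\<close> is
  preserved. This makes the recurrence possible.\<close>

lemma dilate_cusp_cell:
  assumes \<eta>: "mult_character \<eta>" and b: "b \<noteq> 0"
  shows "dilate b (cusp_cell \<eta> k 0 j) = (\<lambda>A. inverse (\<eta> b) * cusp_cell \<eta> (k - val b) 0 (j + val b) A)"
proof
  fix A :: "'a^2^2"
  obtain a0 b0 c0 d0 where A: "A = mat2 a0 b0 c0 d0" by (cases A rule: mat2_cases)
  have "y * b / x \<in> fideal k \<longleftrightarrow> y / x \<in> fideal (k - val b)" if "x \<noteq> 0" for x y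
    using fideal_mult_iff[OF b, of "y / x"] by (simp add: mult.commute)
  moreover have "y / (x * b) \<in> fideal j \<longleftrightarrow> y / x \<in> fideal (j + val b)" if "x \<noteq> 0" for x y
    using fideal_divide_iff[OF b, of "y / x"] by simp
  ultimately show "dilate b (cusp_cell \<eta> k 0 j) A = inverse (\<eta> b) * cusp_cell \<eta> (k - val b) 0 (j + val b) A"
    using b by (auto simp: A dilate_def cusp_cell_def mult_character_mult[OF \<eta>])
qed

text \<open>Here the product of the antidiagonal entries dominates the determinant, and a congruence
  subgroup of level \<open>K\<close> changes the two normalising entries by principal units on which
  \<eta> is trivial.\<close>

lemma cusp_cell_section_1:
  assumes \<eta>: "mult_character \<eta>" "conductor_bound \<eta> M0" and K: "M0 \<le> K"
  shows "compact_section \<eta> (cusp_cell \<eta> K 0 0)"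
proof -
  have K1: "1 \<le> K" using \<eta> K by (auto simp: conductor_bound_def)
  have "level K (cusp_cell \<eta> K 0 0)"
  proof (rule levelI[OF K1])
    fix A k :: "'a^2^2" assume A: "cusp_cell \<eta> K 0 0 A \<noteq> 0" and k: "k \<in> cong_subgroup K"
    obtain p q r s where k: "k = mat2 (1 + p) q r (1 + s)"
      "p \<in> fideal K" "q \<in> fideal K" "r \<in> fideal K" "s \<in> fideal K" using cong_subgroupE[OF k] .
    obtain a b c d where A': "A = mat2 a b c d" by (cases A rule: mat2_cases)
    have h: "b \<noteq> 0" "c \<noteq> 0" "a / b \<in> fideal K" "d / c \<in> fideal 0"
      using A by (auto simp: A' cusp_cell_def split: if_splits)
    define t where "t = a / b"
    define t' where "t' = d / c"
    have t: "a = b * t" "d = c * t'" "t \<in> fideal K" "t' \<in> fideal 0" "t \<in> fideal 0"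
      using h K1 fideal_mono[of t K 0] by (auto simp: t_def t'_def)
    define u where "u = 1 + s + t * q"
    define u' where "u' = 1 + p + t' * r"
    have u: "u - 1 \<in> fideal K" "u' - 1 \<in> fideal K"
      using k t by (auto simp: u_def u'_def intro!: fideal_add fideal_mult[of _ 0 _ K])
    note u0 = one_unit[OF u(1) K1] one_unit[OF u(2) K1]
    have k0: "p \<in> fideal 0" "s \<in> fideal 0" "q \<in> fideal 0" using k K1 fideal_mono[of _ K 0] by auto
    have n: "t * (1 + p) + r \<in> fideal K" "q + t' * (1 + s) \<in> fideal 0"
    proof -
      have "1 + p \<in> fideal 0" "1 + s \<in> fideal 0" using k0 by (auto intro: fideal_add)
      then have "t * (1 + p) \<in> fideal K" "t' * (1 + s) \<in> fideal 0"
        using t by (auto intro: fideal_mult[of t K _ 0] fideal_mult[of t' 0 _ 0])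
      then show "t * (1 + p) + r \<in> fideal K" "q + t' * (1 + s) \<in> fideal 0"
        using k k0 by (auto intro: fideal_add)
    qed
    have e: "a * (1 + p) + b * r = b * (t * (1 + p) + r)" "a * q + b * (1 + s) = b * u"
      "c * (1 + p) + d * r = c * u'" "c * q + d * (1 + s) = c * (q + t' * (1 + s))"
      by (simp_all add: t u_def u'_def algebra_simps)
    have "cusp_cell \<eta> K 0 0 (A ** k) = \<eta> (b * u) * inverse (\<eta> (c * u'))"
      unfolding A' k(1) mat2_mult e using h u0 n by (simp add: cusp_cell_def fideal_divide_iff)
    also have "\<dots> = \<eta> b * inverse (\<eta> c)"
      using character_scale_unit(1)[OF \<eta> h(1) u(1) K] character_scale_unit(1)[OF \<eta> h(2) u(2) K] by simp
    also have "\<dots> = cusp_cell \<eta> K 0 0 A" using h by (simp add: A' cusp_cell_def)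
    finally show "cusp_cell \<eta> K 0 0 (A ** k) = cusp_cell \<eta> K 0 0 A" .
  qed
  moreover have nd: "val (a * d - b * c) = val b + val c" "a * d - b * c \<noteq> 0"
    if "b \<noteq> 0" "c \<noteq> 0" "a / b \<in> fideal K" "d / c \<in> fideal 0" for a b c d :: 'a
  proof -
    have "a * d - b * c = (- (b * c)) + (b * c) * ((a / b) * (d / c))" using that by simp
    moreover have "(b * c) * ((a / b) * (d / c)) \<in> fideal (val (b * c) + 1)"
      by (rule fideal_mult[OF fideal_self fideal_mult[OF that(3,4), of 1]]) (use K1 in auto)
    ultimately show "val (a * d - b * c) = val b + val c" "a * d - b * c \<noteq> 0"
      using that val_add_eq[of "- (b * c)" "(b * c) * ((a / b) * (d / c))"] by (auto simp: val_mult)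
  qed
  moreover have "support_bound 1 (cusp_cell \<eta> K 0 0)" unfolding support_bound_def
  proof (intro allI impI)
    fix A assume A: "prim_rows A" "cusp_cell \<eta> K 0 0 A \<noteq> 0"
    obtain a b c d where A': "A = mat2 a b c d" by (cases A rule: mat2_cases)
    have h: "b \<noteq> 0" "c \<noteq> 0" "a / b \<in> fideal K" "d / c \<in> fideal 0"
      using A by (auto simp: A' cusp_cell_def split: if_splits)
    have a: "a \<in> fideal (K + val b)" "d \<in> fideal (val c)" using h by (simp_all add: fideal_divide_iff)
    have "val b = 0" "val c = 0"
      using A(1) h a K1 fideal_mono[OF a(1), of 1] fideal_mono[OF a(2), of 1]
      by (auto simp: A' prim_def fideal_iff)
    then show "det A \<notin> fideal 1" using nd[OF h] by (simp add: A' fideal_iff)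
  qed
  moreover have "cusp_cell \<eta> K 0 0 (mat2 s 0 0 s' ** A) = \<eta> s * inverse (\<eta> s') * cusp_cell \<eta> K 0 0 A"
    if "s \<noteq> 0" "s' \<noteq> 0" for s s' A
    using that by (cases A rule: mat2_cases) (auto simp: cusp_cell_def mult_character_mult[OF \<eta>(1)])
  moreover have "cusp_cell \<eta> K 0 0 A = 0" if "det A = 0" for A
    using that nd by (cases A rule: mat2_cases) (auto simp: cusp_cell_def)
  ultimately show ?thesis unfolding compact_section_def equiv_section_def by blast
qed

lemma cusp_cell_section:
  assumes \<eta>: "mult_character \<eta>" "conductor_bound \<eta> M0" and K: "M0 \<le> k + j"
  shows "compact_section \<eta> (cusp_cell \<eta> k 0 j)"
proof -
  obtain b :: 'a where b: "b \<noteq> 0" "val b = j" using ex_val by blast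
  have "cusp_cell \<eta> k 0 j = (\<lambda>A. \<eta> b * dilate b (cusp_cell \<eta> (k + j) 0 0) A)"
    using dilate_cusp_cell[OF \<eta>(1) b(1), of "k + j" 0] b mult_character_nz[OF \<eta>(1) b(1)] by auto
  then show ?thesis
    using compact_section_cmult[OF dilate_section[OF cusp_cell_section_1[OF \<eta> K] b(1)], of "\<eta> b"] by simp
qed

text \<open>The shear moves the second disc by \<open>v\<close>, while in the first row b - a v = b
  (1 - (a/b) v) differs from b by a principal unit of level \<open>k + l\<close>; so the condition
  near (0:1) and the value of \<eta> stay the same.\<close>

lemma shear_cusp_cell:
  assumes \<eta>: "mult_character \<eta>" "conductor_bound \<eta> M0" and v: "v \<in> fideal l" "M0 \<le> k + l"
  shows "shear (- v) (cusp_cell \<eta> k 0 j) = cusp_cell \<eta> k v j"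
proof
  fix A :: "'a^2^2"
  obtain a b c d where A: "A = mat2 a b c d" by (cases A rule: mat2_cases)
  have *: "b - a * w \<noteq> 0 \<and> a / (b - a * w) \<in> fideal k \<and> \<eta> (b - a * w) = \<eta> b"
    if h: "b \<noteq> 0" "a / b \<in> fideal k" "w \<in> fideal l" for a b w :: 'a
  proof -
    define t where "t = a / b"
    have t: "a = b * t" "t \<in> fideal k" using h by (auto simp: t_def)
    have u: "(1 - t * w) - 1 \<in> fideal M0"
      using t h v by (auto intro!: fideal_mult[of t k w l])
    have "1 \<le> M0" using \<eta> by (auto simp: conductor_bound_def)
    note u0 = one_unit[OF u this]
    have e: "b - a * w = b * (1 - t * w)" by (simp add: t algebra_simps)
    show ?thesis unfolding e using character_scale_unit[OF \<eta> h(1) u order_refl] h(1) t u0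
      by (simp add: fideal_divide_iff)
  qed
  have "b \<noteq> 0 \<and> a / b \<in> fideal k \<longleftrightarrow> b - a * v \<noteq> 0 \<and> a / (b - a * v) \<in> fideal k"
    using *[of b a v] *[of "b - a * v" a "- v"] v by auto
  moreover have "\<eta> (b - a * v) = \<eta> b" if "b \<noteq> 0" "a / b \<in> fideal k" using *[of b a v] that v by auto
  moreover have "(d - c * v) / c = d / c - v" if "c \<noteq> 0" using that by (simp add: field_simps)
  ultimately show "shear (- v) (cusp_cell \<eta> k 0 j) A = cusp_cell \<eta> k v j A"
    by (auto simp: A shear_def cusp_cell_def)
qed

section \<open>Asymptotics\<close>

definition asymptotic :: "('f::nonarch_local_field \<Rightarrow> complex) \<Rightarrow> ('f \<Rightarrow> complex) \<Rightarrow> bool"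
  where "asymptotic \<eta> L \<longleftrightarrow> (\<exists>p1 p2 q1 q2 n. \<forall>b. b \<noteq> 0 \<longrightarrow> n \<le> val b \<longrightarrow>
    L b = of_real (abs_val b) * (\<eta> b * (p1 * of_int (val b) + p2) + inverse (\<eta> b) * (q1 * of_int (val b) + q2)))"

text \<open>The form without logarithmic terms, which arises from sections supported at bounded
  slopes.\<close>

definition pure_asymptotic :: "('f::nonarch_local_field \<Rightarrow> complex) \<Rightarrow> ('f \<Rightarrow> complex) \<Rightarrow> bool"
  where "pure_asymptotic \<eta> L \<longleftrightarrow> (\<exists>\<alpha> \<beta> n. \<forall>b. b \<noteq> 0 \<longrightarrow> n \<le> val b \<longrightarrow>
    L b = of_real (abs_val b) * (\<alpha> * \<eta> b + \<beta> * inverse (\<eta> b)))"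

lemma pure_asymptotic_imp: "pure_asymptotic \<eta> L \<Longrightarrow> asymptotic \<eta> L"
  unfolding asymptotic_def pure_asymptotic_def
  apply (elim exE)
  subgoal for \<alpha> \<beta> n by (intro exI[of _ 0] exI[of _ \<alpha>] exI[of _ 0] exI[of _ \<beta>] exI[of _ n]) (simp add: mult.commute)
  done

lemma pure_asymptotic_cong:
  assumes "pure_asymptotic \<eta> L" "\<And>b. b \<noteq> 0 \<Longrightarrow> n \<le> val b \<Longrightarrow> L' b = L b"
  shows "pure_asymptotic \<eta> L'"
proof -
  obtain \<alpha> \<beta> n1 where "\<forall>b. b \<noteq> 0 \<longrightarrow> n1 \<le> val b \<longrightarrow> L b = of_real (abs_val b) * (\<alpha> * \<eta> b + \<beta> * inverse (\<eta> b))"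
    using assms(1) by (auto simp: pure_asymptotic_def)
  then show ?thesis using assms(2) unfolding pure_asymptotic_def
    by (intro exI[of _ \<alpha>] exI[of _ \<beta>] exI[of _ "max n n1"]) auto
qed

lemma asymptotic_cong:
  assumes "asymptotic \<eta> L" "\<And>b. b \<noteq> 0 \<Longrightarrow> n \<le> val b \<Longrightarrow> L' b = L b"
  shows "asymptotic \<eta> L'"
proof -
  obtain p1 p2 q1 q2 n1 where "\<forall>b. b \<noteq> 0 \<longrightarrow> n1 \<le> val b \<longrightarrow> L b = of_real (abs_val b) *
      (\<eta> b * (p1 * of_int (val b) + p2) + inverse (\<eta> b) * (q1 * of_int (val b) + q2))"
    using assms(1) by (auto simp: asymptotic_def)
  then show ?thesis using assms(2) unfolding asymptotic_def
    by (intro exI[of _ p1] exI[of _ p2] exI[of _ q1] exI[of _ q2] exI[of _ "max n n1"]) auto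
qed

lemma pure_asymptotic_cmult: "pure_asymptotic \<eta> L \<Longrightarrow> pure_asymptotic \<eta> (\<lambda>b. c * L b)"
  unfolding pure_asymptotic_def
  apply (elim exE)
  subgoal for \<alpha> \<beta> n by (intro exI[of _ "c * \<alpha>"] exI[of _ "c * \<beta>"] exI[of _ n]) (simp add: algebra_simps)
  done

lemma pure_asymptotic_add:
  assumes "pure_asymptotic \<eta> L" "pure_asymptotic \<eta> L'"
  shows "pure_asymptotic \<eta> (\<lambda>b. L b + L' b)"
proof -
  obtain \<alpha> \<beta> n where 1: "\<And>b. b \<noteq> 0 \<Longrightarrow> n \<le> val b \<Longrightarrow> L b = of_real (abs_val b) * (\<alpha> * \<eta> b + \<beta> * inverse (\<eta> b))"
    using assms(1) by (auto simp: pure_asymptotic_def)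
  obtain \<alpha>' \<beta>' n' where 2: "\<And>b. b \<noteq> 0 \<Longrightarrow> n' \<le> val b \<Longrightarrow> L' b = of_real (abs_val b) * (\<alpha>' * \<eta> b + \<beta>' * inverse (\<eta> b))"
    using assms(2) by (auto simp: pure_asymptotic_def)
  show ?thesis unfolding pure_asymptotic_def
    by (intro exI[of _ "\<alpha> + \<alpha>'"] exI[of _ "\<beta> + \<beta>'"] exI[of _ "max n n'"]) (auto simp: 1 2 algebra_simps)
qed

lemma pure_asymptotic_sum:
  "finite I \<Longrightarrow> (\<And>i. i \<in> I \<Longrightarrow> pure_asymptotic \<eta> (L i)) \<Longrightarrow> pure_asymptotic \<eta> (\<lambda>b. \<Sum>i\<in>I. L i b)"
proof (induction I rule: finite_induct)
  case empty
  show ?case unfolding pure_asymptotic_def by (intro exI[of _ 0]) simp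
qed (auto intro: pure_asymptotic_add)

lemma asymptotic_cmult: "asymptotic \<eta> L \<Longrightarrow> asymptotic \<eta> (\<lambda>b. c * L b)"
  unfolding asymptotic_def
  apply (elim exE)
  subgoal for p1 p2 q1 q2 n by (intro exI[of _ "c * p1"] exI[of _ "c * p2"] exI[of _ "c * q1"] exI[of _ "c * q2"] exI[of _ n]) (simp add: algebra_simps)
  done

lemma asymptotic_add:
  assumes "asymptotic \<eta> L" "asymptotic \<eta> L'"
  shows "asymptotic \<eta> (\<lambda>b. L b + L' b)"
proof -
  obtain p1 p2 q1 q2 n where 1: "\<And>b. b \<noteq> 0 \<Longrightarrow> n \<le> val b \<Longrightarrow> L b = of_real (abs_val b) *
      (\<eta> b * (p1 * of_int (val b) + p2) + inverse (\<eta> b) * (q1 * of_int (val b) + q2))"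
    using assms(1) unfolding asymptotic_def by blast
  obtain p1' p2' q1' q2' n' where 2: "\<And>b. b \<noteq> 0 \<Longrightarrow> n' \<le> val b \<Longrightarrow> L' b = of_real (abs_val b) *
      (\<eta> b * (p1' * of_int (val b) + p2') + inverse (\<eta> b) * (q1' * of_int (val b) + q2'))"
    using assms(2) unfolding asymptotic_def by blast
  show ?thesis unfolding asymptotic_def
    by (intro exI[of _ "p1 + p1'"] exI[of _ "p2 + p2'"] exI[of _ "q1 + q1'"] exI[of _ "q2 + q2'"] exI[of _ "max n n'"])
      (auto simp: 1 2 algebra_simps)
qed

lemma asymptotic_sum:
  "finite I \<Longrightarrow> (\<And>i. i \<in> I \<Longrightarrow> asymptotic \<eta> (L i)) \<Longrightarrow> asymptotic \<eta> (\<lambda>b. \<Sum>i\<in>I. L i b)"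
proof (induction I rule: finite_induct)
  case empty
  show ?case unfolding asymptotic_def by (intro exI[of _ 0]) simp
qed (auto intro: asymptotic_add)

lemma pure_asymptotic_inverse: "pure_asymptotic \<eta> L \<Longrightarrow> pure_asymptotic (\<lambda>s. inverse (\<eta> s)) L"
  unfolding pure_asymptotic_def
  apply (elim exE)
  subgoal for \<alpha> \<beta> n by (intro exI[of _ \<beta>] exI[of _ \<alpha>] exI[of _ n]) (simp add: add.commute)
  done

lemma asymptotic_inverse: "asymptotic (\<lambda>s. inverse (\<eta> s)) L \<Longrightarrow> asymptotic \<eta> L"
  unfolding asymptotic_def
  apply (elim exE)
  subgoal for p1 p2 q1 q2 n by (intro exI[of _ q1] exI[of _ q2] exI[of _ p1] exI[of _ p2] exI[of _ n]) (simp add: add.commute)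
  done

text \<open>The logarithmic terms come from the summation of this recurrence; \<open>\<alpha> \<noteq> 0\<close> forces \<open>\<eta>\<^sup>2\<close> to be
  unramified.\<close>

lemma recurrence_asymptotic:
  fixes \<eta> :: "'f::nonarch_local_field \<Rightarrow> complex"
  assumes \<eta>: "mult_character \<eta>"
    and rec: "\<And>b. b \<noteq> 0 \<Longrightarrow> n \<le> val b \<Longrightarrow> L (b * uniformizer) = inverse (\<eta> uniformizer) *
      (of_real (abs_val b) * (\<alpha> * \<eta> b + \<beta> * inverse (\<eta> b)) + L b / of_real (rq TYPE('f)))"
    and unit: "\<And>b u. b \<noteq> 0 \<Longrightarrow> u \<noteq> 0 \<Longrightarrow> val u = 0 \<Longrightarrow> L (b * u) = inverse (\<eta> u) * L b"
  shows "asymptotic \<eta> L"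
proof -
  define w :: 'f where "w = uniformizer"
  define q where "q = complex_of_real (rq TYPE('f))"
  define h where "h = \<eta> w"
  define N where "N = nat n"
  have w: "w \<noteq> 0" "val w = 1" by (auto simp: w_def)
  have q: "q \<noteq> 0" using rq_gt_1[where 'f='f] by (auto simp: q_def)
  have h: "h \<noteq> 0" using mult_character_nz[OF \<eta> w(1)] by (simp add: h_def)
  have wi: "w ^ i \<noteq> 0" "val (w ^ i) = int i" "\<eta> (w ^ i) = h ^ i" for i
    using w by (auto simp: val_power mult_character_power[OF \<eta>] h_def)
  have aw: "of_real (abs_val (w ^ i)) = inverse q ^ i" for i
    using wi by (simp add: abs_val_eq q_def power_int_minus power_inverse)
  \<comment> \<open>This normalisation turns the recurrence into a pure summation, with increment q
    (\<alpha> h^(2i) + \<beta>).\<close>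
  define m where "m i = q ^ i * h ^ i * L (w ^ i)" for i
  have m: "m (Suc i) = m i + q * (\<alpha> * (h^2) ^ i + \<beta>)" if "i \<ge> N" for i
  proof -
    have "L (w ^ Suc i) = inverse h * (inverse q ^ i * (\<alpha> * h ^ i + \<beta> * inverse (h ^ i)) + L (w ^ i) / q)"
      using rec[of "w ^ i"] wi that aw by (simp add: h_def w_def q_def N_def mult.commute)
    moreover have "(h^2) ^ i = h ^ i * h ^ i" by (simp add: power2_eq_square power_mult_distrib)
    ultimately show ?thesis using q h unfolding m_def by (simp add: field_simps)
  qed
  \<comment> \<open>A closed form, up to a constant, of the sum of the powers of h^2: linear if h^2
    = 1, geometric otherwise.\<close>
  define S where "S i = (if h^2 = 1 then of_nat i else (h^2) ^ i / (h^2 - 1))" for i :: nat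
  have S: "S (Suc i) = S i + (h^2) ^ i" for i
    by (auto simp: S_def field_simps)
  define C where "C = m N - q * \<beta> * of_nat N - q * \<alpha> * S N"
  have M: "m i = C + q * \<beta> * of_nat i + q * \<alpha> * S i" if "i \<ge> N" for i
    using that by (induction i rule: dec_induct) (auto simp: C_def m S algebra_simps)
  have Lb: "L b = of_real (abs_val b) * inverse (\<eta> b) * m (nat (val b))" if b: "b \<noteq> 0" "n \<le> val b" "0 \<le> val b" for b
  proof -
    define i where "i = nat (val b)"
    define u where "u = b / w ^ i"
    have u: "u \<noteq> 0" "val u = 0" "b = w ^ i * u" using b w wi[of i] by (auto simp: u_def i_def val_divide)
    have "\<eta> b = h ^ i * \<eta> u" using u wi[of i] by (simp add: mult_character_mult[OF \<eta>])
    moreover have "L b = inverse (\<eta> u) * L (w ^ i)" using unit[of "w ^ i" u] u wi by simp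
    moreover have "of_real (abs_val b) = inverse q ^ i"
      using b by (simp add: abs_val_eq i_def q_def power_int_def power_inverse)
    ultimately show ?thesis using q h by (simp add: i_def[symmetric] m_def field_simps)
  qed
  \<comment> \<open>The recurrence at \<open>b\<close> and at \<open>b * u\<close>, together with
    the transformation of \<open>L\<close> under units, forces \<eta>(u) and its inverse to agree
    unless \<alpha> = 0.\<close>
  have un: "\<alpha> = 0 \<or> (\<forall>u. u \<noteq> 0 \<longrightarrow> val u = 0 \<longrightarrow> (\<eta> u)\<^sup>2 = 1)"
  proof (rule ccontr)
    assume "\<not> ?thesis"
    then obtain u where u: "\<alpha> \<noteq> 0" "u \<noteq> 0" "val u = 0" "(\<eta> u)\<^sup>2 \<noteq> 1" by blast
    define b where "b = w ^ N"
    have b: "b \<noteq> 0" "n \<le> val b" using wi by (auto simp: b_def N_def)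
    have bu: "b * u \<noteq> 0" "n \<le> val (b * u)" "abs_val (b * u) = abs_val b"
      using b u by (auto simp: val_mult abs_val_eq)
    note nz = mult_character_nz[OF \<eta>]
    have "L (b * u * w) = inverse (\<eta> u) * L (b * w)" using unit[of "b * w" u] b u w by (simp add: algebra_simps)
    moreover have "L (b * u * w) = inverse h * (of_real (abs_val b) * (\<alpha> * \<eta> (b * u) + \<beta> * inverse (\<eta> (b * u))) + L (b * u) / q)"
      using rec[OF bu(1,2)] bu by (simp add: w_def h_def q_def)
    moreover have "L (b * w) = inverse h * (of_real (abs_val b) * (\<alpha> * \<eta> b + \<beta> * inverse (\<eta> b)) + L b / q)"
      using rec[OF b] by (simp add: w_def h_def q_def)
    moreover have "L (b * u) = inverse (\<eta> u) * L b" using unit b u by simp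
    ultimately have "inverse h * (of_real (abs_val b) * (\<alpha> * \<eta> (b * u) + \<beta> * inverse (\<eta> (b * u))) + inverse (\<eta> u) * L b / q)
        = inverse (\<eta> u) * (inverse h * (of_real (abs_val b) * (\<alpha> * \<eta> b + \<beta> * inverse (\<eta> b)) + L b / q))" by simp
    then have "of_real (abs_val b) * (\<alpha> * \<eta> b) * \<eta> u = of_real (abs_val b) * (\<alpha> * \<eta> b) * inverse (\<eta> u)"
      using h b u mult_character_mult[OF \<eta> b(1) u(2)] by (simp add: algebra_simps)
    then have "\<eta> u = inverse (\<eta> u)" using abs_val_pos[OF b(1)] u(1) nz[OF b(1)] by simp
    then show False using u nz[OF u(2)] by (metis power2_eq_square right_inverse)
  qed
  show ?thesis
  proof (cases "\<alpha> = 0 \<or> h^2 = 1")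
    case True
    define Q where "Q = (if h^2 = 1 then q * \<alpha> else 0)"
    have "m i = (q * \<beta> + Q) * of_nat i + C" if "i \<ge> N" for i
      using M[OF that] True by (auto simp: S_def Q_def algebra_simps)
    then show ?thesis unfolding asymptotic_def
      by (intro exI[of _ 0] exI[of _ 0] exI[of _ "q * \<beta> + Q"] exI[of _ C] exI[of _ "max n 0"]) (auto simp: Lb N_def)
  next
    case False
    \<comment> \<open>Since \<eta>^2 is trivial on units, \<eta>(b)^2 is h^2 raised to the power
      v(b). So the geometric part of the sum turns \<eta>(b)^-1 into \<eta>(b) and carries no
      logarithm.\<close>
    have e: "inverse (\<eta> b) * (h^2) ^ nat (val b) = \<eta> b" if b: "b \<noteq> 0" "0 \<le> val b" for b
    proof -
      define i where "i = nat (val b)"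
      define u where "u = b / w ^ i"
      have u: "u \<noteq> 0" "val u = 0" "b = w ^ i * u" using b w wi[of i] by (auto simp: u_def i_def val_divide)
      have "\<eta> b = h ^ i * \<eta> u" using u wi[of i] by (simp add: mult_character_mult[OF \<eta>])
      moreover have "(\<eta> u)\<^sup>2 = 1" using un False u by blast
      ultimately have "(\<eta> b)\<^sup>2 = (h^2)^i" by (simp add: power_mult_distrib power_mult[symmetric] mult.commute)
      then show ?thesis using mult_character_nz[OF \<eta> b(1)] by (simp add: i_def[symmetric] field_simps power2_eq_square)
    qed
    have "L b = of_real (abs_val b) * (\<eta> b * (0 * of_int (val b) + q * \<alpha> / (h^2 - 1)) + inverse (\<eta> b) * ((q * \<beta>) * of_int (val b) + C))"
      if b: "b \<noteq> 0" "max n 0 \<le> val b" for b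
    proof -
      have "L b = of_real (abs_val b) * (inverse (\<eta> b) * (q * \<beta> * of_int (val b) + C)
        + (inverse (\<eta> b) * (h^2) ^ nat (val b)) * (q * \<alpha> / (h^2 - 1)))"
        using Lb[of b] M[of "nat (val b)"] b False by (simp add: S_def N_def algebra_simps)
      then show ?thesis using e[of b] b by (simp add: algebra_simps)
    qed
    then show ?thesis unfolding asymptotic_def by blast
  qed
qed

text \<open>The properties of the pairing on which the asymptotics rest, isolated so that they can
  be used a second time with the two points exchanged and \<eta> inverted. In
  \<open>lam_cell\<close> the relative radius \<open>m'\<close> is uniform in \<open>c\<close>;
  without this a section could not be cut into admissible cells.\<close>

locale section_functional =
  fixes \<eta> :: "'f::nonarch_local_field \<Rightarrow> complex" and lam :: "('f^2^2 \<Rightarrow> complex) \<Rightarrow> complex" and m :: int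
  assumes character: "mult_character \<eta>"
    and lam_add: "compact_section \<eta> f \<Longrightarrow> compact_section \<eta> g \<Longrightarrow> lam (\<lambda>A. f A + g A) = lam f + lam g"
    and lam_cmult: "compact_section \<eta> f \<Longrightarrow> lam (\<lambda>A. c * f A) = c * lam f"
    and lam_shear: "compact_section \<eta> f \<Longrightarrow> s \<in> fideal m \<Longrightarrow> lam (shear s f) = lam f"
    and lam_cell: "\<exists>m'. \<forall>c j. c \<noteq> 0 \<longrightarrow> val c + m' \<le> j \<longrightarrow> pure_asymptotic \<eta> (\<lambda>b. lam (dilate b (cell \<eta> 0 c j)))"
begin

lemma lam_sum:
  "finite I \<Longrightarrow> (\<And>i. i \<in> I \<Longrightarrow> compact_section \<eta> (f i)) \<Longrightarrow> lam (\<lambda>A. \<Sum>i\<in>I. f i A) = (\<Sum>i\<in>I. lam (f i))"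
proof (induction I rule: finite_induct)
  case empty
  show ?case using lam_cmult[of "\<lambda>_. 0" 0] by simp
next
  case (insert i I)
  then show ?case using lam_add[of "f i" "\<lambda>A. \<Sum>i\<in>I. f i A"] by (simp add: compact_section_sum)
qed

definition germ :: "('f^2^2 \<Rightarrow> complex) \<Rightarrow> 'f \<Rightarrow> complex"
  where "germ f b = lam (dilate b f)"

lemma germ_add: "compact_section \<eta> f \<Longrightarrow> compact_section \<eta> g \<Longrightarrow> b \<noteq> 0 \<Longrightarrow>
    germ (\<lambda>A. f A + g A) b = germ f b + germ g b"
  by (simp add: germ_def dilate_linear lam_add dilate_section)

lemma germ_cmult: "compact_section \<eta> f \<Longrightarrow> b \<noteq> 0 \<Longrightarrow> germ (\<lambda>A. c * f A) b = c * germ f b"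
  by (simp add: germ_def dilate_linear lam_cmult dilate_section)

lemma germ_sum: "finite I \<Longrightarrow> (\<And>i. i \<in> I \<Longrightarrow> compact_section \<eta> (f i)) \<Longrightarrow> b \<noteq> 0 \<Longrightarrow>
    germ (\<lambda>A. \<Sum>i\<in>I. f i A) b = (\<Sum>i\<in>I. germ (f i) b)"
  by (simp add: germ_def dilate_linear lam_sum dilate_section)

text \<open>Dilation by \<open>b\<close> turns the shear by \<open>s\<close> into the shear by
  \<open>b * s\<close>, which the functional ignores once \<open>b\<close> is small. This is the
  passage to coinvariants.\<close>

lemma germ_shear:
  assumes "compact_section \<eta> f" "b \<noteq> 0" "m - val s \<le> val b"
  shows "germ (shear s f) b = germ f b"
proof -
  have "b * s \<in> fideal m" using assms by (intro fideal_mult[of b "val b" s "val s"]) auto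
  then show ?thesis using assms by (simp add: germ_def dilate_shear lam_shear dilate_section)
qed

lemma ex_conductor: obtains M0 where "conductor_bound \<eta> M0"
  using mult_character_conductor[OF character] by (metis conductor_bound_def)

lemma germ_cell:
  "\<exists>m'. \<forall>z z' j. z \<noteq> z' \<longrightarrow> val (z' - z) + m' \<le> j \<longrightarrow>
    compact_section \<eta> (cell \<eta> z z' j) \<and> pure_asymptotic \<eta> (germ (cell \<eta> z z' j))"
proof -
  obtain m' where m': "\<And>c j. c \<noteq> 0 \<Longrightarrow> val c + m' \<le> j \<Longrightarrow> pure_asymptotic \<eta> (germ (cell \<eta> 0 c j))"
    using lam_cell unfolding germ_def[abs_def] by blast
  obtain M0 where M0: "conductor_bound \<eta> M0" by (rule ex_conductor)
  have "compact_section \<eta> (cell \<eta> z z' j) \<and> pure_asymptotic \<eta> (germ (cell \<eta> z z' j))"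
    if z: "z \<noteq> z'" "val (z' - z) + max m' M0 \<le> j" for z z' j
  proof
    show "compact_section \<eta> (cell \<eta> z z' j)" using z by (intro cell_section[OF character M0]) auto
    have c: "compact_section \<eta> (cell \<eta> 0 (z' - z) j)" using z by (intro cell_section[OF character M0]) auto
    have "cell \<eta> z z' j = shear (- z) (cell \<eta> 0 (z' - z) j)" by (simp add: shear_cell)
    then have "germ (cell \<eta> z z' j) b = germ (cell \<eta> 0 (z' - z) j) b" if "b \<noteq> 0" "m - val (- z) \<le> val b" for b
      using germ_shear[OF c that] by simp
    then show "pure_asymptotic \<eta> (germ (cell \<eta> z z' j))"
      using z by (intro pure_asymptotic_cong[OF m'[of "z' - z" j], of "m - val (- z)"]) auto
  qed
  then show ?thesis by (intro exI[of _ "max m' M0"]) blast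
qed

text \<open>With both slopes bounded, the support is covered by finitely many products of two small
  discs, on each of which the section is a multiple of a cell.\<close>

lemma germ_interior:
  assumes f: "compact_section \<eta> f"
    and supp: "\<And>A. f A \<noteq> 0 \<Longrightarrow> A $ 1 $ 1 \<noteq> 0 \<and> A $ 2 $ 1 \<noteq> 0 \<and>
      A $ 1 $ 2 / A $ 1 $ 1 \<in> fideal K \<and> A $ 2 $ 2 / A $ 2 $ 1 \<in> fideal K"
  shows "pure_asymptotic \<eta> (germ f)"
proof -
  obtain M e where M: "level M f" "support_bound e f" using f by (rule compact_sectionE)
  obtain m' where m': "\<And>z z' j. z \<noteq> z' \<Longrightarrow> val (z' - z) + m' \<le> j \<Longrightarrow>
      compact_section \<eta> (cell \<eta> z z' j) \<and> pure_asymptotic \<eta> (germ (cell \<eta> z z' j))"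
    using germ_cell by blast
  define g where "g z1 z2 = f (mat2 1 z1 1 z2)" for z1 z2
  have g: "z1 \<noteq> z2 \<and> val (z2 - z1) < e" if "g z1 z2 \<noteq> 0" for z1 z2
    using support_bound_val[OF f M(2), of "mat2 1 z1 1 z2" 1 1] that
      compact_section_singular[OF f, of "mat2 1 z1 1 z2"] by (auto simp: g_def)
  \<comment> \<open>Fine enough for three purposes: \<open>f\<close> is constant on cells, the cells
    meeting the support are admissible in \<open>germ_cell\<close>, and \<open>j\<close> is at least
    \<open>K\<close> so that representatives exist.\<close>
  define j where "j = max (max (M + e) (M + e - K)) (max (e + m') K)"
  \<comment> \<open>Nonvanishing bounds the valuation of the difference of the slopes, which is the
    determinant in \<open>level_perturb\<close>. The unconditional version below follows by
    symmetry.\<close>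
  have per: "g z1' z2' = g z1 z2"
    if h: "g z1 z2 \<noteq> 0" "z1' - z1 \<in> fideal j" "z2' - z2 \<in> fideal j" for z1 z1' z2 z2'
  proof -
    have z: "z1 \<in> fideal K" "z2 \<in> fideal K" using supp[of "mat2 1 z1 1 z2"] h(1) by (auto simp: g_def)
    have d: "z2 - z1 \<noteq> 0" "val (z2 - z1) < e" using g[OF h(1)] by auto
    have "z2 * (z1' - z1) \<in> fideal (M + val (z2 - z1))" "z1 * (z2' - z2) \<in> fideal (M + val (z2 - z1))"
      using z h d by (auto intro!: fideal_mult[of _ K _ j] simp: j_def)
    moreover have "z2' - z2 \<in> fideal (M + val (z2 - z1))" "z1' - z1 \<in> fideal (M + val (z2 - z1))"
      using h d by (auto elim!: fideal_mono simp: j_def)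
    ultimately show ?thesis unfolding g_def using d
      by (intro level_perturb[OF M(1), of "z2 - z1"]) (auto intro: fideal_diff simp: fideal_diff_commute)
  qed
  have per': "g z1' z2' = g z1 z2" if h: "z1' - z1 \<in> fideal j" "z2' - z2 \<in> fideal j" for z1 z1' z2 z2'
    using per[of z1 z2 z1' z2'] per[of z1' z2' z1 z2] h fideal_diff_commute by metis
  have "K \<le> j" by (simp add: j_def)
  then obtain R :: "'f set" where R: "reps K j R" using ex_reps by blast
  have fA: "f A = (\<Sum>p\<in>R \<times> R. g (fst p) (snd p) * cell \<eta> (fst p) (snd p) j A)" for A
  proof (cases A rule: mat2_cases)
    case (mat2 a b c d)
    show ?thesis
    proof (cases "a \<noteq> 0 \<and> c \<noteq> 0")
      case False
      then have "f A = 0" using supp[of A] by (auto simp: mat2)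
      moreover have "cell \<eta> z z' j A = 0" for z z' using False by (auto simp: mat2 cell_def)
      ultimately show ?thesis by simp
    next
      case True
      have fa: "f A = \<eta> a * inverse (\<eta> c) * g (b / a) (d / c)"
        using compact_section_scale(2)[OF f, of a c 1 "b / a" 1 "d / c"] True by (simp add: mat2 g_def)
      have out: "g (b / a) (d / c) = 0" if "b / a \<notin> fideal K \<or> d / c \<notin> fideal K"
        using supp[of "mat2 1 (b / a) 1 (d / c)"] that by (auto simp: g_def)
      have "(\<Sum>p\<in>R \<times> R. g (fst p) (snd p) * cell \<eta> (fst p) (snd p) j A) =
        (\<Sum>s\<in>R. \<Sum>s'\<in>R. g s s' * cell \<eta> s s' j A)" by (simp add: sum.cartesian_product case_prod_beta)
      also have "\<dots> = (\<Sum>s\<in>R. if b / a - s \<in> fideal j then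
          (\<Sum>s'\<in>R. if d / c - s' \<in> fideal j then \<eta> a * inverse (\<eta> c) * g s s' else 0) else 0)"
        using True by (intro sum.cong) (auto simp: mat2 cell_def intro!: sum.cong sum.neutral)
      also have "\<dots> = (\<Sum>s\<in>R. if b / a - s \<in> fideal j then \<eta> a * inverse (\<eta> c) * g (b / a) (d / c) else 0)"
      proof (intro sum.cong refl if_cong)
        fix s assume s: "b / a - s \<in> fideal j"
        show "(\<Sum>s'\<in>R. if d / c - s' \<in> fideal j then \<eta> a * inverse (\<eta> c) * g s s' else 0) =
            \<eta> a * inverse (\<eta> c) * g (b / a) (d / c)"
          using out s per'[of "b / a" s "d / c"] by (intro reps_sum[OF R]) (auto simp: j_def)
      qed
      also have "\<dots> = \<eta> a * inverse (\<eta> c) * g (b / a) (d / c)"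
        using out by (intro reps_sum[OF R]) (auto simp: j_def)
      finally show ?thesis using fa by simp
    qed
  qed
  have summand: "compact_section \<eta> (\<lambda>A. g (fst p) (snd p) * cell \<eta> (fst p) (snd p) j A) \<and>
      pure_asymptotic \<eta> (germ (\<lambda>A. g (fst p) (snd p) * cell \<eta> (fst p) (snd p) j A))" for p
  proof (cases "g (fst p) (snd p) = 0")
    case True
    have "pure_asymptotic \<eta> (germ (\<lambda>A. 0))"
      using lam_cmult[of "\<lambda>_. 0" 0] unfolding pure_asymptotic_def by (intro exI[of _ 0]) (simp add: germ_def dilate_def[abs_def])
    with True show ?thesis by simp
  next
    case False
    have *: "compact_section \<eta> (cell \<eta> (fst p) (snd p) j)" "pure_asymptotic \<eta> (germ (cell \<eta> (fst p) (snd p) j))"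
      using g[OF False] m'[of "fst p" "snd p" j] by (auto simp: j_def)
    have "pure_asymptotic \<eta> (germ (\<lambda>A. g (fst p) (snd p) * cell \<eta> (fst p) (snd p) j A))"
      using *(1) by (intro pure_asymptotic_cong[OF pure_asymptotic_cmult[OF *(2), of "g (fst p) (snd p)"], of 0]) (simp add: germ_cmult)
    then show ?thesis using *(1) by (simp add: compact_section_cmult)
  qed
  have fin: "finite (R \<times> R)" using reps_finite[OF R] by simp
  have "f = (\<lambda>A. \<Sum>p\<in>R \<times> R. g (fst p) (snd p) * cell \<eta> (fst p) (snd p) j A)" using fA by blast
  then have eq: "germ f b = (\<Sum>p\<in>R \<times> R. germ (\<lambda>A. g (fst p) (snd p) * cell \<eta> (fst p) (snd p) j A) b)" if "b \<noteq> 0" for b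
    using germ_sum[OF fin, of "\<lambda>p A. g (fst p) (snd p) * cell \<eta> (fst p) (snd p) j A" b] summand that by simp
  have "pure_asymptotic \<eta> (\<lambda>b. \<Sum>p\<in>R \<times> R. germ (\<lambda>A. g (fst p) (snd p) * cell \<eta> (fst p) (snd p) j A) b)"
    using summand by (intro pure_asymptotic_sum[OF fin]) blast
  then show ?thesis using eq by (rule pure_asymptotic_cong)
qed

text \<open>Dilation by a uniformizer replaces \<open>(k, j)\<close> by
  \<open>(k - 1, j + 1)\<close> with a factor \<eta>(w)^-1. The larger first disc adds the annulus
  \<open>p\<close>, which is interior, and the smaller second disc costs a factor 1/q, because the q
  translates that make up the old one are shears of each other.\<close>

lemma germ_cusp_cell:
  assumes M0: "conductor_bound \<eta> M0" "M0 \<le> k + j"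
  shows "asymptotic \<eta> (germ (cusp_cell \<eta> k 0 j))"
proof -
  define w :: 'f where "w = uniformizer"
  have w: "w \<noteq> 0" "val w = 1" by (auto simp: w_def)
  define p where "p = (\<lambda>A. cusp_cell \<eta> (k - 1) 0 (j + 1) A - cusp_cell \<eta> k 0 (j + 1) A)"
  note sec = cusp_cell_section[OF character M0(1)]
  have s1: "compact_section \<eta> (cusp_cell \<eta> (k - 1) 0 (j + 1))" "compact_section \<eta> (cusp_cell \<eta> k 0 (j + 1))"
    "compact_section \<eta> (cusp_cell \<eta> k 0 j)"
    using M0 by (auto intro!: sec)
  have p: "compact_section \<eta> p" unfolding p_def by (intro compact_section_diff s1)
  have "pure_asymptotic \<eta> (germ p)"
  proof (rule germ_interior[OF p])
    fix A assume A: "p A \<noteq> 0"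
    have h: "A $ 1 $ 2 \<noteq> 0" "A $ 2 $ 1 \<noteq> 0" "A $ 2 $ 2 / A $ 2 $ 1 \<in> fideal (j + 1)"
      "A $ 1 $ 1 / A $ 1 $ 2 \<notin> fideal k"
      using A fideal_mono[of "A $ 1 $ 1 / A $ 1 $ 2" k "k - 1"] by (auto simp: p_def cusp_cell_def split: if_splits)
    then have n: "A $ 1 $ 1 \<noteq> 0" by auto
    have "A $ 1 $ 2 / A $ 1 $ 1 \<in> fideal (1 - k)" using h n by (simp add: fideal_iff val_divide)
    then show "A $ 1 $ 1 \<noteq> 0 \<and> A $ 2 $ 1 \<noteq> 0 \<and> A $ 1 $ 2 / A $ 1 $ 1 \<in> fideal (min (1 - k) (j + 1)) \<and>
        A $ 2 $ 2 / A $ 2 $ 1 \<in> fideal (min (1 - k) (j + 1))"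
      using h n by (auto intro: fideal_mono)
  qed
  then obtain \<alpha> \<beta> n where n: "\<And>b. b \<noteq> 0 \<Longrightarrow> n \<le> val b \<Longrightarrow>
      germ p b = of_real (abs_val b) * (\<alpha> * \<eta> b + \<beta> * inverse (\<eta> b))"
    unfolding pure_asymptotic_def by blast
  obtain R :: "'f set" where R: "reps j (j + 1) R" "card R = residue_card TYPE('f)" using ex_reps_1 by blast
  have sh: "cusp_cell \<eta> k s (j + 1) = shear (- s) (cusp_cell \<eta> k 0 (j + 1))" if "s \<in> R" for s
    using shear_cusp_cell[OF character M0(1) reps_subset[OF R(1) that] M0(2)] by simp
  have sum: "cusp_cell \<eta> k 0 j = (\<lambda>A. \<Sum>s\<in>R. cusp_cell \<eta> k s (j + 1) A)"
  proof
    fix A :: "'f^2^2"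
    show "cusp_cell \<eta> k 0 j A = (\<Sum>s\<in>R. cusp_cell \<eta> k s (j + 1) A)"
    proof (cases "A $ 1 $ 2 \<noteq> 0 \<and> A $ 2 $ 1 \<noteq> 0 \<and> A $ 1 $ 1 / A $ 1 $ 2 \<in> fideal k")
      case True
      have "(\<Sum>s\<in>R. cusp_cell \<eta> k s (j + 1) A) = (\<Sum>s\<in>R. if A $ 2 $ 2 / A $ 2 $ 1 - s \<in> fideal (j + 1)
          then \<eta> (A $ 1 $ 2) * inverse (\<eta> (A $ 2 $ 1)) else 0)"
        using True by (intro sum.cong) (auto simp: cusp_cell_def)
      also have "\<dots> = cusp_cell \<eta> k 0 j A"
        using True by (intro reps_sum[OF R(1)]) (auto simp: cusp_cell_def)
      finally show ?thesis by simp
    next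
      case False
      then have "cusp_cell \<eta> k s i A = 0" for s i by (auto simp: cusp_cell_def)
      then show ?thesis by simp
    qed
  qed
  \<comment> \<open>Beyond this valuation of \<open>b\<close> none of the finitely many shears is
    visible to the functional.\<close>
  define n' where "n' = Max ((\<lambda>s. m - val (- s)) ` R)"
  have q: "germ (cusp_cell \<eta> k 0 j) b = of_real (rq TYPE('f)) * germ (cusp_cell \<eta> k 0 (j + 1)) b"
    if b: "b \<noteq> 0" "n' \<le> val b" for b
  proof -
    have "germ (cusp_cell \<eta> k 0 j) b = (\<Sum>s\<in>R. germ (cusp_cell \<eta> k s (j + 1)) b)"
      unfolding sum using b reps_finite[OF R(1)] s1 by (intro germ_sum) (auto simp: sh shear_section)
    also have "\<dots> = (\<Sum>s\<in>R. germ (cusp_cell \<eta> k 0 (j + 1)) b)"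
    proof (rule sum.cong[OF refl])
      fix s assume s: "s \<in> R"
      have "m - val (- s) \<le> n'" unfolding n'_def using s reps_finite[OF R(1)] by (intro Max_ge) auto
      then show "germ (cusp_cell \<eta> k s (j + 1)) b = germ (cusp_cell \<eta> k 0 (j + 1)) b"
        unfolding sh[OF s] using b by (intro germ_shear s1) auto
    qed
    finally show ?thesis using R(2) by simp
  qed
  have dil: "germ (cusp_cell \<eta> k 0 j) (b * u) = inverse (\<eta> u) * germ (cusp_cell \<eta> (k - val u) 0 (j + val u)) b"
    if "b \<noteq> 0" "u \<noteq> 0" for b u
  proof -
    have "compact_section \<eta> (cusp_cell \<eta> (k - val u) 0 (j + val u))" using M0 by (intro sec) auto
    then have "germ (\<lambda>A. inverse (\<eta> u) * cusp_cell \<eta> (k - val u) 0 (j + val u) A) b =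
        inverse (\<eta> u) * germ (cusp_cell \<eta> (k - val u) 0 (j + val u)) b" using that by (intro germ_cmult)
    then show ?thesis using dilate_cusp_cell[OF character that(2), of k j]
      by (simp add: germ_def flip: dilate_dilate)
  qed
  show ?thesis
  proof (rule recurrence_asymptotic[OF character, of "max n n'"])
    fix b :: 'f assume b: "b \<noteq> 0" "max n n' \<le> val b"
    have "cusp_cell \<eta> (k - 1) 0 (j + 1) = (\<lambda>A. p A + cusp_cell \<eta> k 0 (j + 1) A)" by (auto simp: p_def)
    then have "germ (cusp_cell \<eta> (k - 1) 0 (j + 1)) b = germ p b + germ (cusp_cell \<eta> k 0 (j + 1)) b"
      using germ_add[OF p s1(2) b(1)] by simp
    moreover have "germ (cusp_cell \<eta> k 0 (j + 1)) b = germ (cusp_cell \<eta> k 0 j) b / of_real (rq TYPE('f))"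
      using q[of b] b rq_gt_1[where 'f='f] by simp
    ultimately show "germ (cusp_cell \<eta> k 0 j) (b * uniformizer) = inverse (\<eta> uniformizer) *
       (of_real (abs_val b) * (\<alpha> * \<eta> b + \<beta> * inverse (\<eta> b)) + germ (cusp_cell \<eta> k 0 j) b / of_real (rq TYPE('f)))"
      using dil[OF b(1), of uniformizer] n[of b] b by simp
  next
    fix b u :: 'f assume "b \<noteq> 0" "u \<noteq> 0" "val u = 0"
    then show "germ (cusp_cell \<eta> k 0 j) (b * u) = inverse (\<eta> u) * germ (cusp_cell \<eta> k 0 j) b"
      using dil[of b u] by simp
  qed
qed

definition cusp_cut :: "int \<Rightarrow> ('f^2^2 \<Rightarrow> complex) \<Rightarrow> 'f^2^2 \<Rightarrow> complex"
  where "cusp_cut k f A = (if A $ 1 $ 2 \<noteq> 0 \<and> A $ 1 $ 1 / A $ 1 $ 2 \<in> fideal k then f A else 0)"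

text \<open>If the first point is close enough to (0:1), the support bound keeps the second one away
  from it, and \<open>f\<close> no longer depends on the exact position of the first. The cut
  section is then a finite sum of sheared cusp cells.\<close>

lemma germ_cusp_cut:
  assumes f: "compact_section \<eta> f"
  shows "\<exists>k. compact_section \<eta> (cusp_cut k f) \<and> asymptotic \<eta> (germ (cusp_cut k f))"
proof -
  obtain M e where M: "level M f" "support_bound e f" using f by (rule compact_sectionE)
  obtain M0 where M0: "conductor_bound \<eta> M0" by (rule ex_conductor)
  have M1: "1 \<le> M" using M by (auto simp: level_def)
  define l where "l = max e 0"
  \<comment> \<open>\<open>M + l\<close> permits moving the first point to (0:1) even against a
    slope in the ideal of exponent \<open>- l\<close>; \<open>M0 + l\<close> is the condition for
    shearing a cusp cell by such a slope; \<open>e\<close> is for the support bound.\<close>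
  define k where "k = max (max (M + l) (M0 + l)) e"
  obtain R :: "'f set" where R: "reps (- l) M R" using ex_reps[of "- l" M] M1 unfolding l_def by fastforce
  have eq: "cusp_cut k f A = (\<Sum>v\<in>R. f (mat2 0 1 1 v) * cusp_cell \<eta> k v M A)" for A
  proof (cases A rule: mat2_cases)
    case (mat2 a b c d)
    show ?thesis
    proof (cases "b \<noteq> 0 \<and> a / b \<in> fideal k")
      case False
      then show ?thesis by (auto simp: mat2 cusp_cut_def cusp_cell_def)
    next
      case True
      define t where "t = a / b"
      have t: "t \<in> fideal k" using True by (simp add: t_def)
      \<comment> \<open>If the second row were also near (0:1), the determinant would be too
        divisible for the support bound.\<close>
      have fa: "f (mat2 t 1 x y) = 0" if "x = 0 \<or> y / x \<notin> fideal (- l)" for x y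
      proof (rule ccontr)
        assume *: "f (mat2 t 1 x y) \<noteq> 0"
        have d: "t * y - x \<noteq> 0" using compact_section_singular[OF f, of "mat2 t 1 x y"] * by auto
        have y: "y \<noteq> 0" using that d by (cases "x = 0") (auto simp: l_def)
        have "val (t * y - x) < e + val y"
          using support_bound_val[OF f M(2) *, of 1 y] y by simp
        moreover have "t * y - x \<in> fideal (e + val y)"
        proof (rule fideal_diff)
          show "t * y \<in> fideal (e + val y)" using t by (intro fideal_mult[of t k y "val y"]) (auto simp: k_def)
          show "x \<in> fideal (e + val y)"
            using that y by (cases "x = 0") (auto simp: fideal_iff val_divide l_def)
        qed
        ultimately show False using d by (simp add: fideal_iff)
      qed
      have fv: "f (mat2 t 1 1 z) = f (mat2 0 1 1 v)" if h: "v \<in> fideal (- l)" "z - v \<in> fideal M" for z v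
      proof -
        have "v * t \<in> fideal M" "t \<in> fideal M"
          using h t by (auto intro!: fideal_mult[of v "- l" t k] elim!: fideal_mono simp: k_def l_def)
        then show ?thesis using h fideal_diff_commute[of z v]
          by (intro level_perturb[OF M(1), of "- 1"]) auto
      qed
      show ?thesis
      proof (cases "c = 0")
        case c: True
        have "f A = 0" using compact_section_scale(2)[OF f, of b 1 t 1 c d] fa[of c d] True c by (simp add: mat2 t_def)
        then show ?thesis using c by (auto simp: mat2 cusp_cut_def cusp_cell_def)
      next
        case c: False
        have e: "f A = \<eta> b * inverse (\<eta> c) * f (mat2 t 1 1 (d / c))"
          using compact_section_scale(2)[OF f, of b c t 1 1 "d / c"] True c by (simp add: mat2 t_def)
        have "(\<Sum>v\<in>R. f (mat2 0 1 1 v) * cusp_cell \<eta> k v M A) =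
            (\<Sum>v\<in>R. if d / c - v \<in> fideal M then \<eta> b * inverse (\<eta> c) * f (mat2 0 1 1 v) else 0)"
          using True c by (intro sum.cong) (auto simp: mat2 cusp_cell_def)
        also have "\<dots> = f A" unfolding e
        proof (rule reps_sum[OF R])
          show "\<eta> b * inverse (\<eta> c) * f (mat2 t 1 1 (d / c)) = 0" if "d / c \<notin> fideal (- l)"
            using fa[of 1 "d / c"] that by simp
          show "- l \<le> M" using M1 by (simp add: l_def)
        qed (use fv reps_subset[OF R] in metis)
        finally show ?thesis using True by (simp add: mat2 cusp_cut_def)
      qed
    qed
  qed
  have kM: "M0 \<le> k + M" "M0 \<le> k + - l" using M1 by (auto simp: k_def l_def)
  have base: "compact_section \<eta> (cusp_cell \<eta> k 0 M)" using cusp_cell_section[OF character M0 kM(1)] .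
  have sh: "cusp_cell \<eta> k v M = shear (- v) (cusp_cell \<eta> k 0 M)" if "v \<in> R" for v
    using shear_cusp_cell[OF character M0 reps_subset[OF R that] kM(2)] by simp
  have summand: "compact_section \<eta> (\<lambda>A. f (mat2 0 1 1 v) * cusp_cell \<eta> k v M A)"
      "asymptotic \<eta> (germ (\<lambda>A. f (mat2 0 1 1 v) * cusp_cell \<eta> k v M A))" if v: "v \<in> R" for v
  proof -
    have s: "compact_section \<eta> (cusp_cell \<eta> k v M)" unfolding sh[OF v] by (rule shear_section[OF base])
    then show "compact_section \<eta> (\<lambda>A. f (mat2 0 1 1 v) * cusp_cell \<eta> k v M A)" by (rule compact_section_cmult)
    show "asymptotic \<eta> (germ (\<lambda>A. f (mat2 0 1 1 v) * cusp_cell \<eta> k v M A))"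
    proof (rule asymptotic_cong[OF asymptotic_cmult[OF germ_cusp_cell[OF M0 kM(1)], of "f (mat2 0 1 1 v)"]])
      fix b :: 'f assume b: "b \<noteq> 0" "m - val (- v) \<le> val b"
      have "germ (cusp_cell \<eta> k v M) b = germ (cusp_cell \<eta> k 0 M) b"
        unfolding sh[OF v] by (rule germ_shear[OF base b])
      then show "germ (\<lambda>A. f (mat2 0 1 1 v) * cusp_cell \<eta> k v M A) b = f (mat2 0 1 1 v) * germ (cusp_cell \<eta> k 0 M) b"
        using germ_cmult[OF s b(1)] by simp
    qed
  qed
  have fin: "finite R" using reps_finite[OF R] .
  have f': "cusp_cut k f = (\<lambda>A. \<Sum>v\<in>R. f (mat2 0 1 1 v) * cusp_cell \<eta> k v M A)" using eq by blast
  have "compact_section \<eta> (cusp_cut k f)" unfolding f' using summand(1) fin by (rule compact_section_sum[rotated])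
  moreover have eq': "germ (cusp_cut k f) b = (\<Sum>v\<in>R. germ (\<lambda>A. f (mat2 0 1 1 v) * cusp_cell \<eta> k v M A) b)" if "b \<noteq> 0" for b
    unfolding f' using fin summand(1) that by (rule germ_sum)
  have "asymptotic \<eta> (\<lambda>b. \<Sum>v\<in>R. germ (\<lambda>A. f (mat2 0 1 1 v) * cusp_cell \<eta> k v M A) b)"
    using summand(2) by (intro asymptotic_sum[OF fin]) blast
  then have "asymptotic \<eta> (germ (cusp_cut k f))" using eq' by (rule asymptotic_cong)
  ultimately show ?thesis by blast
qed

end

text \<open>Exchanging the rows commutes with shears and dilations, so all properties transfer with
  the inverse character.\<close>

lemma section_functional_swap:
  assumes "section_functional \<eta> lam m"
  shows "section_functional (\<lambda>s. inverse (\<eta> s)) (\<lambda>f. lam (\<lambda>A. f (mat2 0 1 1 0 ** A))) m"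
proof -
  interpret section_functional \<eta> lam m by fact
  have sw: "compact_section \<eta> (\<lambda>A. f (mat2 0 1 1 0 ** A))" if "compact_section (\<lambda>s. inverse (\<eta> s)) f" for f
    using compact_section_swap[OF that] by simp
  \<comment> \<open>After the exchange the cell sits at the slopes (c,0) rather than (0,c); hence
    the need for the general form \<open>germ_cell\<close>.\<close>
  have bx: "(\<lambda>A. dilate b (cell (\<lambda>s. inverse (\<eta> s)) 0 c j) (mat2 0 1 1 0 ** A)) = dilate b (cell \<eta> c 0 j)" for b c j
  proof
    fix A :: "'a^2^2"
    show "dilate b (cell (\<lambda>s. inverse (\<eta> s)) 0 c j) (mat2 0 1 1 0 ** A) = dilate b (cell \<eta> c 0 j) A"
      by (cases A rule: mat2_cases) (auto simp: dilate_def cell_def)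
  qed
  obtain m' where m': "\<And>z z' j. z \<noteq> z' \<Longrightarrow> val (z' - z) + m' \<le> j \<Longrightarrow> pure_asymptotic \<eta> (germ (cell \<eta> z z' j))"
    using germ_cell by blast
  show ?thesis
  proof
    show "mult_character (\<lambda>s. inverse (\<eta> s))" by (rule mult_character_inv[OF character])
    show "\<exists>m'. \<forall>c j. c \<noteq> 0 \<longrightarrow> val c + m' \<le> j \<longrightarrow> pure_asymptotic (\<lambda>s. inverse (\<eta> s))
        (\<lambda>b. lam (\<lambda>A. dilate b (cell (\<lambda>s. inverse (\<eta> s)) 0 c j) (mat2 0 1 1 0 ** A)))"
      unfolding bx using m'[of _ 0] by (auto intro!: exI[of _ m'] pure_asymptotic_inverse simp: germ_def[abs_def])
    fix f g :: "'a^2^2 \<Rightarrow> complex" and c and s :: 'a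
    assume f: "compact_section (\<lambda>s. inverse (\<eta> s)) f"
    show "lam (\<lambda>A. c * f (mat2 0 1 1 0 ** A)) = c * lam (\<lambda>A. f (mat2 0 1 1 0 ** A))"
      by (rule lam_cmult[OF sw[OF f]])
    show "lam (\<lambda>A. f (mat2 0 1 1 0 ** A) + g (mat2 0 1 1 0 ** A)) = lam (\<lambda>A. f (mat2 0 1 1 0 ** A)) + lam (\<lambda>A. g (mat2 0 1 1 0 ** A))"
      if "compact_section (\<lambda>s. inverse (\<eta> s)) g" using that by (intro lam_add sw f)
    show "lam (\<lambda>A. shear s f (mat2 0 1 1 0 ** A)) = lam (\<lambda>A. f (mat2 0 1 1 0 ** A))" if "s \<in> fideal m"
      using lam_shear[OF sw[OF f] that] by (simp add: shear_def[abs_def] matrix_mul_assoc)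
  qed
qed

context section_functional begin

text \<open>The section is split into a part with the first point near (0:1), a part with the second
  point near (0:1), treated through the exchange of rows, and a remainder with bounded
  slopes.\<close>

theorem germ_asymptotic:
  assumes f: "compact_section \<eta> f"
  shows "asymptotic \<eta> (germ f)"
proof -
  obtain k where k: "compact_section \<eta> (cusp_cut k f)" "asymptotic \<eta> (germ (cusp_cut k f))"
    using germ_cusp_cut[OF f] by blast
  define g where "g = (\<lambda>A. f A - cusp_cut k f A)"
  have g: "compact_section \<eta> g" unfolding g_def by (intro compact_section_diff f k)
  interpret sw: section_functional "\<lambda>s. inverse (\<eta> s)" "\<lambda>f. lam (\<lambda>A. f (mat2 0 1 1 0 ** A))" m
    by (rule section_functional_swap) (rule section_functional_axioms)
  have WW: "mat2 0 1 1 0 ** (mat2 0 1 1 0 ** A) = A" for A :: "'f^2^2"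
    by (cases A rule: mat2_cases) simp
  define g' where "g' = (\<lambda>A. g (mat2 0 1 1 0 ** A))"
  have g': "compact_section (\<lambda>s. inverse (\<eta> s)) g'" unfolding g'_def by (rule compact_section_swap[OF g])
  obtain k' where k': "compact_section (\<lambda>s. inverse (\<eta> s)) (sw.cusp_cut k' g')"
      "asymptotic (\<lambda>s. inverse (\<eta> s)) (sw.germ (sw.cusp_cut k' g'))"
    using sw.germ_cusp_cut[OF g'] by blast
  define g2 where "g2 = (\<lambda>A. sw.cusp_cut k' g' (mat2 0 1 1 0 ** A))"
  have g2: "compact_section \<eta> g2" unfolding g2_def using compact_section_swap[OF k'(1)] by simp
  have "sw.germ (sw.cusp_cut k' g') = germ g2"
    by (rule ext) (simp add: sw.germ_def germ_def g2_def dilate_def[abs_def] matrix_mul_assoc)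
  then have a2: "asymptotic \<eta> (germ g2)" using asymptotic_inverse[OF k'(2)] by simp
  define g3 where "g3 = (\<lambda>A. g A - g2 A)"
  have g3: "compact_section \<eta> g3" unfolding g3_def by (intro compact_section_diff g g2)
  have g2A: "g2 A = (if A $ 2 $ 2 \<noteq> 0 \<and> A $ 2 $ 1 / A $ 2 $ 2 \<in> fideal k' then g A else 0)" for A
    by (cases A rule: mat2_cases) (simp add: g2_def sw.cusp_cut_def g'_def)
  \<comment> \<open>If the inverse slope is not in the ideal of exponent \<open>i\<close>, its
    valuation is at most i - 1, so the slope has valuation at least 1 - i.\<close>
  have near: "a \<noteq> 0 \<and> b / a \<in> fideal (1 - i)" if "\<not> (b \<noteq> 0 \<and> a / b \<in> fideal i)" "a \<noteq> 0 \<or> b \<noteq> 0" for a b :: 'f and i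
    using that by (cases "a = 0"; cases "b = 0") (auto simp: fideal_iff val_divide)
  have "pure_asymptotic \<eta> (germ g3)"
  proof (rule germ_interior[OF g3])
    fix A assume A: "g3 A \<noteq> 0"
    have d: "det A \<noteq> 0" using A compact_section_singular[OF g3] by auto
    have "\<not> (A $ 2 $ 2 \<noteq> 0 \<and> A $ 2 $ 1 / A $ 2 $ 2 \<in> fideal k')" and gA: "g A \<noteq> 0"
      using A by (auto simp: g3_def g2A split: if_splits)
    moreover have "\<not> (A $ 1 $ 2 \<noteq> 0 \<and> A $ 1 $ 1 / A $ 1 $ 2 \<in> fideal k)"
      using gA by (auto simp: g_def cusp_cut_def split: if_splits)
    ultimately have "A $ 1 $ 1 \<noteq> 0 \<and> A $ 1 $ 2 / A $ 1 $ 1 \<in> fideal (1 - k)" "A $ 2 $ 1 \<noteq> 0 \<and> A $ 2 $ 2 / A $ 2 $ 1 \<in> fideal (1 - k')"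
      using d by (auto simp: det_2 intro!: near)
    then show "A $ 1 $ 1 \<noteq> 0 \<and> A $ 2 $ 1 \<noteq> 0 \<and> A $ 1 $ 2 / A $ 1 $ 1 \<in> fideal (min (1 - k) (1 - k')) \<and>
        A $ 2 $ 2 / A $ 2 $ 1 \<in> fideal (min (1 - k) (1 - k'))"
      by (auto intro: fideal_mono)
  qed
  then have a3: "asymptotic \<eta> (germ g3)" by (rule pure_asymptotic_imp)
  have "f = (\<lambda>A. cusp_cut k f A + (g2 A + g3 A))" by (auto simp: g_def g3_def)
  then have "germ f b = germ (cusp_cut k f) b + (germ g2 b + germ g3 b)" if "b \<noteq> 0" for b
    using germ_add[OF k(1) compact_section_add[OF g2 g3] that] germ_add[OF g2 g3 that] by simp
  then show ?thesis
    using asymptotic_cong[OF asymptotic_add[OF k(2) asymptotic_add[OF a2 a3]], of 0] by simp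
qed

end

section \<open>The group and its topology\<close>

lemma carrier_GL2: "carrier GL2 = {A :: 'f::field^2^2. det A \<noteq> 0}"
  by (simp add: GL2_def invertible_det_nz)

lemma mat_mult_mat2: "mat c ** mat2 a b a' b' = mat2 (c * a) (c * b) (c * a') (c * (b' :: 'f::comm_ring_1))"
  by (simp add: mat_eq_mat2)

lemma mat_commute: "mat c ** A = A ** mat c" for A :: "'f::comm_ring_1^2^2"
  by (cases A rule: mat2_cases) (simp add: mat_eq_mat2 algebra_simps)

lemma mat_mult_mat: "mat c ** mat d = (mat (c * d) :: 'f::comm_ring_1^2^2)"
  by (simp add: mat_eq_mat2)

lemma pgl_eq: "pgl A = {mat c ** A | c. c \<noteq> 0}"
  by (auto simp: pgl_def r_coset_def GL2_def scalars_def)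

lemma pgl_eq_iff: "pgl A = pgl B \<longleftrightarrow> (\<exists>c. c \<noteq> 0 \<and> B = mat c ** A)"
proof
  assume "pgl A = pgl B"
  moreover have "B \<in> pgl B" unfolding pgl_eq by (rule CollectI, rule exI[of _ 1]) simp
  ultimately show "\<exists>c. c \<noteq> 0 \<and> B = mat c ** A" by (auto simp: pgl_eq)
next
  assume "\<exists>c. c \<noteq> 0 \<and> B = mat c ** A"
  then obtain c where c: "c \<noteq> 0" "B = mat c ** A" by blast
  have 1: "mat d ** A = mat (d / c) ** B" and 2: "mat d ** B = mat (d * c) ** A" for d
    using c by (simp_all add: matrix_mul_assoc mat_mult_mat)
  show "pgl A = pgl B"
  proof (intro equalityI subsetI)
    fix X assume "X \<in> pgl A"
    then obtain d where d: "d \<noteq> 0" "X = mat d ** A" by (auto simp: pgl_eq)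
    then have "X = mat (d / c) ** B" "d / c \<noteq> 0" using c 1[of d] by auto
    then show "X \<in> pgl B" unfolding pgl_eq by blast
  next
    fix X assume "X \<in> pgl B"
    then obtain d where d: "d \<noteq> 0" "X = mat d ** B" by (auto simp: pgl_eq)
    then have "X = mat (d * c) ** A" "d * c \<noteq> 0" using c 2[of d] by auto
    then show "X \<in> pgl A" unfolding pgl_eq by blast
  qed
qed

lemma pgl_scale: "c \<noteq> 0 \<Longrightarrow> pgl (mat c ** A) = pgl A"
  by (metis pgl_eq_iff)

lemma carrier_PGL2: "carrier PGL2 = {pgl A | A :: 'f::field^2^2. det A \<noteq> 0}"
  by (auto simp: PGL2_def FactGroup_def RCOSETS_def pgl_def carrier_GL2)

lemma pgl_carrier [simp]: "det A \<noteq> 0 \<Longrightarrow> pgl A \<in> carrier PGL2"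
  by (auto simp: carrier_PGL2)

lemma pgl_mult [simp]: "pgl A \<otimes>\<^bsub>PGL2\<^esub> pgl B = pgl (A ** B)"
proof -
  have 1: "mat c ** A ** (mat d ** B) = mat (c * d) ** (A ** B)" for c d
    by (metis mat_commute mat_mult_mat matrix_mul_assoc)
  show ?thesis
  proof (intro equalityI subsetI)
    fix X assume "X \<in> pgl A \<otimes>\<^bsub>PGL2\<^esub> pgl B"
    then obtain c d where "c \<noteq> 0" "d \<noteq> 0" "X = mat c ** A ** (mat d ** B)"
      by (auto simp: PGL2_def FactGroup_def set_mult_def pgl_eq GL2_def)
    then show "X \<in> pgl (A ** B)" unfolding pgl_eq by (auto simp: 1 intro!: exI[of _ "c * d"])
  next
    fix X assume "X \<in> pgl (A ** B)"
    then obtain c where "c \<noteq> 0" "X = mat c ** A ** (mat 1 ** B)" by (auto simp: pgl_eq matrix_mul_assoc)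
    then show "X \<in> pgl A \<otimes>\<^bsub>PGL2\<^esub> pgl B"
      by (simp add: PGL2_def FactGroup_def set_mult_def pgl_eq GL2_def) (metis one_neq_zero matrix_mul_lid)
  qed
qed

lemma one_PGL2: "\<one>\<^bsub>PGL2\<^esub> = pgl (mat 1)"
  by (auto simp: PGL2_def FactGroup_def pgl_eq scalars_def)

lemma group_PGL2: "group (PGL2 :: ('f::field^2^2) set monoid)"
proof (rule groupI)
  show "\<one>\<^bsub>PGL2\<^esub> \<in> carrier (PGL2 :: ('f^2^2) set monoid)" by (simp add: one_PGL2)
  fix x y z :: "('f^2^2) set" assume x: "x \<in> carrier PGL2"
  show "\<one>\<^bsub>PGL2\<^esub> \<otimes>\<^bsub>PGL2\<^esub> x = x" using x by (auto simp: carrier_PGL2 one_PGL2)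
  show "\<exists>y\<in>carrier PGL2. y \<otimes>\<^bsub>PGL2\<^esub> x = \<one>\<^bsub>PGL2\<^esub>"
  proof -
    from x obtain A where A: "x = pgl A" "det A \<noteq> 0" by (auto simp: carrier_PGL2)
    then show ?thesis by (intro bexI[of _ "pgl (inv2 A)"]) (simp_all add: one_PGL2 inv2 det_inv2)
  qed
  assume y: "y \<in> carrier PGL2"
  show "x \<otimes>\<^bsub>PGL2\<^esub> y \<in> carrier PGL2" using x y by (auto simp: carrier_PGL2) (metis det_mul mult_eq_0_iff)
  assume z: "z \<in> carrier PGL2"
  show "x \<otimes>\<^bsub>PGL2\<^esub> y \<otimes>\<^bsub>PGL2\<^esub> z = x \<otimes>\<^bsub>PGL2\<^esub> (y \<otimes>\<^bsub>PGL2\<^esub> z)"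
    using x y z by (auto simp: carrier_PGL2 matrix_mul_assoc)
qed

lemma pgl_inv: "det A \<noteq> 0 \<Longrightarrow> inv\<^bsub>PGL2\<^esub> (pgl A) = pgl (inv2 A)"
  by (rule group.inv_equality[OF group_PGL2]) (simp_all add: one_PGL2 inv2 det_inv2)

lemma coset_fun_pgl:
  assumes "\<And>c. c \<noteq> 0 \<Longrightarrow> f (mat c ** A) = f A"
  shows "coset_fun f (pgl A) = f A"
proof -
  have "f ` pgl A = {f A}" unfolding pgl_eq using assms by (auto intro!: image_eqI[of _ _ "mat 1 ** A"] exI[of _ 1])
  then show ?thesis by (simp add: coset_fun_def)
qed

definition pdiag :: "'f::field \<Rightarrow> ('f^2^2) set"
  where "pdiag t = pgl (mat2 t 0 0 1)"

lemma pgl_diag: "a \<noteq> 0 \<Longrightarrow> d \<noteq> 0 \<Longrightarrow> pgl (mat2 a 0 0 d) = pdiag (a / d)"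
  unfolding pdiag_def pgl_eq_iff by (intro exI[of _ "inverse d"]) (simp add: mat_mult_mat2 field_simps)

lemma torus_eq: "torus = pdiag ` (- {0})"
proof -
  have "pdiag t \<in> torus" if "t \<noteq> 0" for t :: 'a
    unfolding torus_def pdiag_def using that by (intro CollectI exI[of _ t] exI[of _ 1]) simp
  then show ?thesis by (auto simp: torus_def pgl_diag)
qed

lemma pdiag_torus [simp]: "t \<noteq> 0 \<Longrightarrow> pdiag t \<in> torus"
  by (simp add: torus_eq)

lemma pdiag_inj [simp]: "pdiag t = pdiag t' \<longleftrightarrow> t = t'"
  by (auto simp: pdiag_def pgl_eq_iff mat_mult_mat2)

lemma torus_subset: "torus \<subseteq> carrier PGL2"
  by (auto simp: torus_eq pdiag_def intro!: pgl_carrier)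

lemma pdiag_mult: "pdiag t \<otimes>\<^bsub>PGL2\<^esub> pdiag t' = pdiag (t * t')"
  by (simp add: pdiag_def)

lemma torus_coset: "torus #>\<^bsub>PGL2\<^esub> pgl A = {pgl (mat2 s 0 0 s' ** A) | s s'. s \<noteq> 0 \<and> s' \<noteq> 0}"
proof (intro equalityI subsetI)
  fix X assume "X \<in> torus #>\<^bsub>PGL2\<^esub> pgl A"
  then obtain s s' where "s \<noteq> 0" "s' \<noteq> 0" "X = pgl (mat2 s 0 0 s') \<otimes>\<^bsub>PGL2\<^esub> pgl A"
    unfolding r_coset_def torus_def by blast
  then show "X \<in> {pgl (mat2 s 0 0 s' ** A) | s s'. s \<noteq> 0 \<and> s' \<noteq> 0}" unfolding pgl_mult by blast
next
  fix X assume "X \<in> {pgl (mat2 s 0 0 s' ** A) | s s'. s \<noteq> 0 \<and> s' \<noteq> 0}"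
  then obtain s s' where "s \<noteq> 0" "s' \<noteq> 0" "X = pgl (mat2 s 0 0 s') \<otimes>\<^bsub>PGL2\<^esub> pgl A" unfolding pgl_mult by blast
  then show "X \<in> torus #>\<^bsub>PGL2\<^esub> pgl A" unfolding r_coset_def torus_def by blast
qed

definition coset_of :: "'f::field^2^2 \<Rightarrow> ('f^2^2) set set"
  where "coset_of A = torus #>\<^bsub>PGL2\<^esub> pgl A"

text \<open>The scalars are absorbed: torus and scalars together act on matrices as all invertible
  diagonal matrices, that is by rescaling the two rows independently.\<close>

lemma coset_of_eq_iff: "coset_of A = coset_of B \<longleftrightarrow> (\<exists>s s'. s \<noteq> 0 \<and> s' \<noteq> 0 \<and> B = mat2 s 0 0 s' ** A)"
proof
  assume "coset_of A = coset_of B"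
  moreover have "pgl B \<in> coset_of B" unfolding coset_of_def torus_coset
    by (intro CollectI exI[of _ 1]) (simp add: mat_eq_mat2[symmetric])
  ultimately have "pgl B \<in> coset_of A" by simp
  then obtain s s' where s: "s \<noteq> 0" "s' \<noteq> 0" "pgl B = pgl (mat2 s 0 0 s' ** A)"
    by (auto simp: coset_of_def torus_coset)
  then obtain c where "c \<noteq> 0" "B = mat c ** (mat2 s 0 0 s' ** A)" by (metis pgl_eq_iff)
  then have "B = mat2 (c * s) 0 0 (c * s') ** A" by (simp add: matrix_mul_assoc mat_eq_mat2)
  then show "\<exists>s s'. s \<noteq> 0 \<and> s' \<noteq> 0 \<and> B = mat2 s 0 0 s' ** A" using s \<open>c \<noteq> 0\<close> by (metis mult_eq_0_iff)
next
  assume "\<exists>s s'. s \<noteq> 0 \<and> s' \<noteq> 0 \<and> B = mat2 s 0 0 s' ** A"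
  then obtain s s' where s: "s \<noteq> 0" "s' \<noteq> 0" and B: "B = mat2 s 0 0 s' ** A" by blast
  have 1: "mat2 t 0 0 t' ** B = mat2 (t * s) 0 0 (t' * s') ** A" for t t' by (simp add: B matrix_mul_assoc)
  have 2: "mat2 t 0 0 t' ** A = mat2 (t / s) 0 0 (t' / s') ** B" for t t' using s by (simp add: B matrix_mul_assoc)
  show "coset_of A = coset_of B" unfolding coset_of_def torus_coset
  proof (intro equalityI subsetI)
    fix X assume "X \<in> {pgl (mat2 s 0 0 s' ** A) | s s'. s \<noteq> 0 \<and> s' \<noteq> 0}"
    then obtain t t' where t: "t \<noteq> 0" "t' \<noteq> 0" "X = pgl (mat2 t 0 0 t' ** A)" by blast
    then have "X = pgl (mat2 (t / s) 0 0 (t' / s') ** B)" "t / s \<noteq> 0" "t' / s' \<noteq> 0" using s 2[of t t'] by auto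
    then show "X \<in> {pgl (mat2 s 0 0 s' ** B) | s s'. s \<noteq> 0 \<and> s' \<noteq> 0}" by blast
  next
    fix X assume "X \<in> {pgl (mat2 s 0 0 s' ** B) | s s'. s \<noteq> 0 \<and> s' \<noteq> 0}"
    then obtain t t' where t: "t \<noteq> 0" "t' \<noteq> 0" "X = pgl (mat2 t 0 0 t' ** B)" by blast
    then have "X = pgl (mat2 (t * s) 0 0 (t' * s') ** A)" "t * s \<noteq> 0" "t' * s' \<noteq> 0" using s 1[of t t'] by auto
    then show "X \<in> {pgl (mat2 s 0 0 s' ** A) | s s'. s \<noteq> 0 \<and> s' \<noteq> 0}" by blast
  qed
qed

lemma coset_fun_coset_of:
  assumes "\<And>s s'. s \<noteq> 0 \<Longrightarrow> s' \<noteq> 0 \<Longrightarrow> f (pgl (mat2 s 0 0 s' ** A)) = f (pgl A)"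
  shows "coset_fun f (coset_of A) = f (pgl A)"
proof -
  have "pgl A \<in> coset_of A" unfolding coset_of_def torus_coset
    by (intro CollectI exI[of _ 1]) (simp add: mat_eq_mat2[symmetric])
  then have "f ` coset_of A = {f (pgl A)}" using assms by (auto simp: coset_of_def torus_coset)
  then show ?thesis by (simp add: coset_fun_def)
qed

section \<open>Open and compact sets in GL(2) and PGL(2)\<close>

lemma det_perturb:
  fixes A B :: "'f::nonarch_local_field^2^2"
  assumes A: "\<And>m n. A $ m $ n \<in> fideal i" and B: "\<And>m n. B $ m $ n - A $ m $ n \<in> fideal J" "i \<le> J"
  shows "det B - det A \<in> fideal (i + J)"
proof -
  have B': "B $ m $ n \<in> fideal i" for m n
    using fideal_add[of "B $ m $ n - A $ m $ n" i "A $ m $ n"] A B(1)[of m n] fideal_mono[OF B(1) B(2)] by simp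
  have 1: "(B $ m $ n - A $ m $ n) * B $ m' $ n' \<in> fideal (i + J)" for m n m' n'
    by (rule fideal_mult[OF B(1) B']) simp
  have 2: "A $ m' $ n' * (B $ m $ n - A $ m $ n) \<in> fideal (i + J)" for m n m' n'
    by (rule fideal_mult[OF A B(1)]) simp
  have "det B - det A = ((B $ 1 $ 1 - A $ 1 $ 1) * B $ 2 $ 2 + A $ 1 $ 1 * (B $ 2 $ 2 - A $ 2 $ 2))
      - ((B $ 1 $ 2 - A $ 1 $ 2) * B $ 2 $ 1 + A $ 1 $ 2 * (B $ 2 $ 1 - A $ 2 $ 1))"
    by (simp add: det_2 algebra_simps)
  also have "\<dots> \<in> fideal (i + J)"
    by (intro fideal_diff fideal_add 1 2)
  finally show ?thesis .
qed

lemma open_GL2: "open {A :: 'f::nonarch_local_field^2^2. det A \<noteq> 0}"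
  unfolding open_mat_iff
proof (intro ballI)
  fix A :: "'f^2^2" assume A: "A \<in> {A. det A \<noteq> 0}"
  obtain i where i: "i \<le> 0" "\<And>m n. A $ m $ n \<in> fideal i" using mat_entries_bounded[of 0 A] by blast
  define J where "J = max 1 (val (det A) + 1 - i)"
  have "det B \<noteq> 0" if B: "\<forall>m n. B $ m $ n - A $ m $ n \<in> fideal J" for B
  proof -
    have "det B - det A \<in> fideal (i + J)" using i B by (intro det_perturb) (auto simp: J_def)
    then have "det B - det A \<in> fideal (val (det A) + 1)" by (rule fideal_mono) (simp add: J_def)
    then show ?thesis using val_eqI[of "det A" "det B"] A by auto
  qed
  then show "\<exists>J\<ge>1. \<forall>B. (\<forall>m n. B $ m $ n - A $ m $ n \<in> fideal J) \<longrightarrow> B \<in> {A. det A \<noteq> 0}"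
    by (intro exI[of _ J]) (auto simp: J_def)
qed

lemma topspace_PGL2 [simp]: "topspace PGL2_topology = carrier PGL2"
  by (auto simp: PGL2_topology_def carrier_GL2 carrier_PGL2)

text \<open>Invertible matrices form an open set, so openness in the quotient is plain openness of
  the set of representing matrices.\<close>

lemma openin_PGL2:
  fixes U :: "('f::nonarch_local_field^2^2) set set"
  shows "openin PGL2_topology U \<longleftrightarrow> U \<subseteq> carrier PGL2 \<and> open {A. det A \<noteq> 0 \<and> pgl A \<in> U}"
proof -
  have "openin (top_of_set {A. det A \<noteq> 0}) {A. det A \<noteq> 0 \<and> pgl A \<in> U} \<longleftrightarrow> open {A. det A \<noteq> 0 \<and> pgl A \<in> U}"
    using openin_open_eq[OF open_GL2, of "{A. det A \<noteq> 0 \<and> pgl A \<in> U}"] by auto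
  moreover have "pgl ` {A :: 'f^2^2. det A \<noteq> 0} = carrier PGL2" by (auto simp: carrier_PGL2)
  ultimately show ?thesis unfolding PGL2_topology_def openin_quotient_topology carrier_GL2 by simp
qed

lemma mult_fideal:
  fixes h B :: "'f::nonarch_local_field^2^2"
  assumes "\<And>m n. h $ m $ n \<in> fideal i" "\<And>m n. B $ m $ n \<in> fideal J"
  shows "(h ** B) $ m $ n \<in> fideal (i + J)" "(B ** h) $ m $ n \<in> fideal (i + J)"
proof -
  have "h $ m $ l * B $ l $ n \<in> fideal (i + J)" "B $ m $ l * h $ l $ n \<in> fideal (i + J)" for l
    using fideal_mult[OF assms(1,2), of "i + J"] fideal_mult[OF assms(2,1), of "i + J"] by (simp_all add: add.commute)
  then show "(h ** B) $ m $ n \<in> fideal (i + J)" "(B ** h) $ m $ n \<in> fideal (i + J)"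
    by (simp_all add: matrix_matrix_mult_def sum_2 fideal_add)
qed

lemma open_mult_vimage:
  fixes h :: "'f::nonarch_local_field^2^2"
  assumes "open S"
  shows "open {A. h ** A \<in> S}" "open {A. A ** h \<in> S}"
proof -
  obtain i where i: "i \<le> 0" "\<And>m n. h $ m $ n \<in> fideal i" using mat_entries_bounded[of 0 h] by blast
  have *: "\<exists>J\<ge>1. \<forall>B. (\<forall>m n. B $ m $ n - A $ m $ n \<in> fideal J) \<longrightarrow> f B \<in> S"
    if A: "f A \<in> S" and f: "\<And>B J. (\<forall>m n. B $ m $ n - A $ m $ n \<in> fideal J) \<Longrightarrow> \<forall>m n. f B $ m $ n - f A $ m $ n \<in> fideal (i + J)"
    for A and f :: "'f^2^2 \<Rightarrow> 'f^2^2"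
  proof -
    obtain J where J: "J \<ge> 1" "\<And>B. (\<forall>m n. B $ m $ n - f A $ m $ n \<in> fideal J) \<Longrightarrow> B \<in> S"
      using assms A unfolding open_mat_iff by blast
    have "f B \<in> S" if "\<forall>m n. B $ m $ n - A $ m $ n \<in> fideal (J - i)" for B
      using f[OF that] J(2) by simp
    then show ?thesis using J i by (intro exI[of _ "J - i"]) auto
  qed
  have 1: "(h ** B) $ m $ n - (h ** A) $ m $ n = (h ** (B - A)) $ m $ n"
    "(B ** h) $ m $ n - (A ** h) $ m $ n = ((B - A) ** h) $ m $ n" for A B m n
    by (simp_all add: matrix_matrix_mult_def sum_2 algebra_simps)
  show "open {A. h ** A \<in> S}" unfolding open_mat_iff
    using *[of "(**) h"] mult_fideal(1)[OF i(2), of "_ - _"] by (auto simp: 1)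
  show "open {A. A ** h \<in> S}" unfolding open_mat_iff
    using *[of "\<lambda>A. A ** h"] mult_fideal(2)[OF i(2), of "_ - _"] by (auto simp: 1)
qed

text \<open>The projection is open: the saturation of \<open>S\<close> is a union of its scalar
  multiples.\<close>

lemma openin_pgl_image:
  assumes "open S" "S \<subseteq> {A :: 'f::nonarch_local_field^2^2. det A \<noteq> 0}"
  shows "openin PGL2_topology (pgl ` S)"
proof -
  have "{A. det A \<noteq> 0 \<and> pgl A \<in> pgl ` S} = (\<Union>c\<in>- {0}. {A. mat c ** A \<in> S})"
  proof (intro equalityI subsetI)
    fix A assume "A \<in> {A. det A \<noteq> 0 \<and> pgl A \<in> pgl ` S}"
    then obtain B where "B \<in> S" "pgl A = pgl B" by auto
    then show "A \<in> (\<Union>c\<in>- {0}. {A. mat c ** A \<in> S})" by (auto simp: pgl_eq_iff)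
  next
    fix A assume "A \<in> (\<Union>c\<in>- {0}. {A. mat c ** A \<in> S})"
    then obtain c where c: "c \<noteq> 0" "mat c ** A \<in> S" by auto
    then have "det (mat c ** A) \<noteq> 0" using assms by auto
    then have "det A \<noteq> 0" by (auto simp: det_mul)
    moreover have "pgl A \<in> pgl ` S" using c(2) pgl_scale[OF c(1), of A] by (metis imageI)
    ultimately show "A \<in> {A. det A \<noteq> 0 \<and> pgl A \<in> pgl ` S}" by simp
  qed
  then show ?thesis using assms open_mult_vimage(1)[OF assms(1)] by (auto simp: openin_PGL2)
qed

lemma openin_mult_image:
  assumes "openin PGL2_topology U" "det h \<noteq> 0"
  shows "openin PGL2_topology ((\<lambda>u. pgl h \<otimes>\<^bsub>PGL2\<^esub> u) ` U)"
proof -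
  let ?S = "{A. det A \<noteq> 0 \<and> pgl A \<in> U}"
  have U: "U = pgl ` ?S" using assms(1) by (auto simp: openin_PGL2 carrier_PGL2)
  have S: "open ?S" using assms(1) by (simp add: openin_PGL2)
  have id: "inv2 h ** (h ** A) = A" "h ** (inv2 h ** A) = A" for A
    using inv2[OF assms(2)] by (simp_all add: matrix_mul_assoc)
  have "(\<lambda>A. h ** A) ` ?S = {A. inv2 h ** A \<in> ?S}"
    by (auto simp: id intro: image_eqI[where f = "(**) h", OF id(2)[symmetric]])
  then have "openin PGL2_topology (pgl ` ((\<lambda>A. h ** A) ` ?S))"
    using open_mult_vimage(1)[OF S] assms(2) by (intro openin_pgl_image) (auto simp: det_mul)
  moreover have "(\<lambda>u. pgl h \<otimes>\<^bsub>PGL2\<^esub> u) ` U = pgl ` ((\<lambda>A. h ** A) ` ?S)" by (subst U) (simp add: image_image)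
  ultimately show "openin PGL2_topology ((\<lambda>u. pgl h \<otimes>\<^bsub>PGL2\<^esub> u) ` U)" by simp
qed

lemma continuous_map_pgl: "continuous_map (top_of_set {A. det A \<noteq> 0}) PGL2_topology pgl"
  using quotient_imp_continuous_map[OF quotient_map_quotient_topology]
  by (metis PGL2_topology_def carrier_GL2)

lemma continuous_on_mat2: "continuous_on UNIV (\<lambda>(a, b, c, d). mat2 a b c (d :: 'f::nonarch_local_field))"
proof (simp add: continuous_on_open_vimage[OF open_UNIV], intro allI impI)
  fix S :: "('f^2^2) set" assume S: "open S"
  show "open ((\<lambda>(a, b, c, d). mat2 a b c d) -` S)"
  proof (subst open_subopen, intro ballI)
    fix x assume "x \<in> (\<lambda>(a, b, c, d). mat2 a b c d) -` S"
    then obtain a b c d where x: "x = (a, b, c, d)" "mat2 a b c d \<in> S" by (cases x) auto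
    obtain J where J: "\<And>B. (\<forall>i j. B $ i $ j - mat2 a b c d $ i $ j \<in> fideal J) \<Longrightarrow> B \<in> S"
      using S x unfolding open_mat_iff by metis
    let ?C = "\<lambda>a. {y. y - a \<in> fideal J}"
    have "?C a \<times> ?C b \<times> ?C c \<times> ?C d \<subseteq> (\<lambda>(a, b, c, d). mat2 a b c d) -` S"
      using J by (auto simp: forall_2)
    then show "\<exists>T. open T \<and> x \<in> T \<and> T \<subseteq> (\<lambda>(a, b, c, d). mat2 a b c d) -` S"
      using x open_fideal_coset by (intro exI[of _ "?C a \<times> ?C b \<times> ?C c \<times> ?C d"]) (auto intro!: open_Times)
  qed
qed

text \<open>A compact open set of matrices whose row scalings represent all pairs of points that are
  not closer than \<open>e\<close> allows. It is the source of finiteness for levels and for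
  integrals.\<close>

definition prim_mats :: "int \<Rightarrow> ('f::nonarch_local_field^2^2) set"
  where "prim_mats e = {A. prim_rows A \<and> det A \<notin> fideal e}"

lemma prim_rows_integral: "prim_rows A \<Longrightarrow> A $ i $ j \<in> fideal 0"
  using exhaust_2[of i] exhaust_2[of j] by (auto simp: prim_rows_def prim_def)

lemma compact_prim_mats: "compact (prim_mats e :: ('f::nonarch_local_field^2^2) set)"
proof -
  let ?P = "fideal 0 \<times> fideal 0 \<times> fideal 0 \<times> fideal 0 :: ('f \<times> 'f \<times> 'f \<times> 'f) set"
  let ?m = "\<lambda>(a, b, c, d). mat2 a b c (d :: 'f)"
  have "compact ?P" by (intro compact_Times compact_fideal)
  then have 1: "compact (?m ` ?P)"
    by (intro compact_continuous_image continuous_on_subset[OF continuous_on_mat2]) auto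
  have 2: "closed (prim_mats e :: ('f^2^2) set)" unfolding closed_def open_mat_iff
  proof (intro ballI)
    fix A :: "'f^2^2" assume A: "A \<in> - prim_mats e"
    obtain i where i: "i \<le> 0" "\<And>m n. A $ m $ n \<in> fideal i" using mat_entries_bounded[of 0 A] by blast
    define J where "J = max 1 (e - i)"
    have "B \<notin> prim_mats e" if B: "\<forall>m n. B $ m $ n - A $ m $ n \<in> fideal J" for B
    proof
      assume B': "B \<in> prim_mats e"
      have "det B - det A \<in> fideal (i + J)" using i B by (intro det_perturb) (auto simp: J_def)
      then have "det B - det A \<in> fideal e" by (rule fideal_mono) (simp add: J_def)
      then have "det A \<notin> fideal e" using B' fideal_add[of "det B - det A" e "det A"] by (auto simp: prim_mats_def)
      moreover have "prim_rows A" unfolding prim_rows_def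
        using B' B prim_pert[of "B $ 1 $ 1" "B $ 1 $ 2" "A $ 1 $ 1" J "A $ 1 $ 2"]
          prim_pert[of "B $ 2 $ 1" "B $ 2 $ 2" "A $ 2 $ 1" J "A $ 2 $ 2"]
        by (auto simp: prim_mats_def prim_rows_def J_def fideal_diff_commute)
      ultimately show False using A by (simp add: prim_mats_def)
    qed
    then show "\<exists>J\<ge>1. \<forall>B. (\<forall>m n. B $ m $ n - A $ m $ n \<in> fideal J) \<longrightarrow> B \<in> - prim_mats e"
      by (intro exI[of _ J]) (auto simp: J_def)
  qed
  have "prim_mats e \<subseteq> ?m ` ?P"
  proof
    fix A :: "'f^2^2" assume "A \<in> prim_mats e"
    then have "(A $ 1 $ 1, A $ 1 $ 2, A $ 2 $ 1, A $ 2 $ 2) \<in> ?P" by (auto simp: prim_mats_def prim_rows_integral)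
    then show "A \<in> ?m ` ?P" by (rule image_eqI[rotated]) (simp add: mat2_eta)
  qed
  then have "prim_mats e = ?m ` ?P \<inter> prim_mats e" by blast
  then show ?thesis using compact_Int_closed[OF 1 2] by simp
qed

section \<open>Schwartz functions as sections\<close>

definition lift_fun :: "(('f::field^2^2) set \<Rightarrow> complex) \<Rightarrow> 'f^2^2 \<Rightarrow> complex"
  where "lift_fun \<phi> A = (if det A \<noteq> 0 then \<phi> (pgl A) else 0)"

lemma open_prim_mats: "open (prim_mats e :: ('f::nonarch_local_field^2^2) set)"
  unfolding open_mat_iff
proof (intro ballI)
  fix A :: "'f^2^2" assume A: "A \<in> prim_mats e"
  define J where "J = max 1 e"
  have "B \<in> prim_mats e" if B: "\<forall>m n. B $ m $ n - A $ m $ n \<in> fideal J" for B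
  proof -
    have "det B - det A \<in> fideal (0 + J)"
      using A B by (intro det_perturb) (auto simp: J_def prim_mats_def prim_rows_integral)
    then have "det B - det A \<in> fideal e" by (rule fideal_mono) (simp add: J_def)
    then have "det B \<notin> fideal e" using A fideal_diff[of "det B" e "det B - det A"] by (auto simp: prim_mats_def)
    moreover have "prim_rows B" unfolding prim_rows_def
      using A B prim_pert[of "A $ 1 $ 1" "A $ 1 $ 2" "B $ 1 $ 1" J "B $ 1 $ 2"]
        prim_pert[of "A $ 2 $ 1" "A $ 2 $ 2" "B $ 2 $ 1" J "B $ 2 $ 2"]
      by (auto simp: prim_mats_def prim_rows_def J_def)
    ultimately show ?thesis by (simp add: prim_mats_def)
  qed
  then show "\<exists>J\<ge>1. \<forall>B. (\<forall>m n. B $ m $ n - A $ m $ n \<in> fideal J) \<longrightarrow> B \<in> prim_mats e"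
    by (intro exI[of _ J]) (auto simp: J_def)
qed

lemma open_nondegenerate:
  "open {A :: 'f::nonarch_local_field^2^2. \<exists>s s' B. s \<noteq> 0 \<and> s' \<noteq> 0 \<and> A = mat2 s 0 0 s' ** B \<and> B \<in> prim_mats e}"
proof -
  have id: "A = mat2 s 0 0 s' ** B \<longleftrightarrow> mat2 (inverse s) 0 0 (inverse s') ** A = B" if "s \<noteq> 0" "s' \<noteq> 0" for s s' and A B :: "'f^2^2"
    using that by (cases A rule: mat2_cases; cases B rule: mat2_cases) (auto simp: field_simps)
  have "{A :: 'f^2^2. \<exists>s s' B. s \<noteq> 0 \<and> s' \<noteq> 0 \<and> A = mat2 s 0 0 s' ** B \<and> B \<in> prim_mats e} =
    (\<Union>s\<in>- {0}. \<Union>s'\<in>- {0}. {A. mat2 (inverse s) 0 0 (inverse s') ** A \<in> prim_mats e})"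
  proof (intro equalityI subsetI)
    fix A :: "'f^2^2"
    assume "A \<in> {A. \<exists>s s' B. s \<noteq> 0 \<and> s' \<noteq> 0 \<and> A = mat2 s 0 0 s' ** B \<and> B \<in> prim_mats e}"
    then obtain s s' B where s: "s \<noteq> 0" "s' \<noteq> 0" "A = mat2 s 0 0 s' ** B" "B \<in> prim_mats e" by blast
    then have "mat2 (inverse s) 0 0 (inverse s') ** A \<in> prim_mats e" using id[OF s(1,2), of A B] by simp
    then show "A \<in> (\<Union>s\<in>- {0}. \<Union>s'\<in>- {0}. {A. mat2 (inverse s) 0 0 (inverse s') ** A \<in> prim_mats e})" using s(1,2) by blast
  next
    fix A :: "'f^2^2"
    assume "A \<in> (\<Union>s\<in>- {0}. \<Union>s'\<in>- {0}. {A. mat2 (inverse s) 0 0 (inverse s') ** A \<in> prim_mats e})"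
    then obtain s s' where s: "s \<noteq> 0" "s' \<noteq> 0" "mat2 (inverse s) 0 0 (inverse s') ** A \<in> prim_mats e" by blast
    have "A = mat2 s 0 0 s' ** (mat2 (inverse s) 0 0 (inverse s') ** A)" using id[OF s(1,2), of A] by simp
    then show "A \<in> {A. \<exists>s s' B. s \<noteq> 0 \<and> s' \<noteq> 0 \<and> A = mat2 s 0 0 s' ** B \<and> B \<in> prim_mats e}" using s by blast
  qed
  then show ?thesis using open_mult_vimage(1)[OF open_prim_mats] by (simp only:) (intro open_UN ballI)
qed

lemma torus_character_eq:
  assumes "mult_character c" "a \<noteq> 0" "d \<noteq> 0"
  shows "torus_character c (pgl (mat2 a 0 0 d)) = c a * inverse (c d)"
  unfolding torus_character_def using assms
  by (subst coset_fun_pgl) (auto simp: mat_mult_mat2 mult_character_mult mult_character_nz field_simps)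

text \<open>Compactness is used twice: the compact set in the definition meets only boundedly close
  pairs, which gives the support bound, and compactness of \<open>prim_mats e\<close> makes the
  local constancy uniform, which gives a level.\<close>

theorem schwartz_compact_section:
  fixes \<phi> :: "('f::nonarch_local_field^2^2) set \<Rightarrow> complex"
  assumes c: "mult_character c" and \<phi>: "\<phi> \<in> schwartz_space (torus_character c)"
  shows "compact_section c (lift_fun \<phi>)"
proof -
  obtain C where lc: "locally_constant PGL2_topology \<phi>"
    and C: "compactin PGL2_topology C" "{g \<in> carrier PGL2. \<phi> g \<noteq> 0} \<subseteq> torus <#>\<^bsub>PGL2\<^esub> C"
    and eq: "\<And>t g. t \<in> torus \<Longrightarrow> g \<in> carrier PGL2 \<Longrightarrow> \<phi> (t \<otimes>\<^bsub>PGL2\<^esub> g) = torus_character c t * \<phi> g"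
    using \<phi> unfolding schwartz_space_def by blast
  have hom: "lift_fun \<phi> (mat2 s 0 0 s' ** A) = c s * inverse (c s') * lift_fun \<phi> A" if "s \<noteq> 0" "s' \<noteq> 0" for s s' A
  proof (cases "det A = 0")
    case False
    have "pgl (mat2 s 0 0 s') \<in> torus" using that by (auto simp: torus_def)
    from eq[OF this pgl_carrier[OF False]] show ?thesis
      using False that by (simp add: lift_fun_def det_mul torus_character_eq[OF c])
  qed (simp add: lift_fun_def det_mul)
  \<comment> \<open>The saturation of \<open>prim_mats e\<close> under row scalings. These sets are
    open, increase with \<open>e\<close> and exhaust the group, so a compact set lies in one of
    them.\<close>
  define Nd where "Nd e = {A :: 'f^2^2. \<exists>s s' B. s \<noteq> 0 \<and> s' \<noteq> 0 \<and> A = mat2 s 0 0 s' ** B \<and> B \<in> prim_mats e}" for e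
  have Nd_mono: "Nd e \<subseteq> Nd e'" if "e \<le> e'" for e e' unfolding Nd_def prim_mats_def using that fideal_mono by blast
  have Nd_sub: "Nd e \<subseteq> {A. det A \<noteq> 0}" for e by (auto simp: Nd_def prim_mats_def det_mul)
  have Nd_torus: "mat2 s 0 0 s' ** A \<in> Nd e" if "A \<in> Nd e" "s \<noteq> 0" "s' \<noteq> 0" for s s' A e
  proof -
    from that obtain r r' B where B: "r \<noteq> 0" "r' \<noteq> 0" "A = mat2 r 0 0 r' ** B" "B \<in> prim_mats e" by (auto simp: Nd_def)
    then have "mat2 s 0 0 s' ** A = mat2 (s * r) 0 0 (s' * r') ** B" by (simp add: matrix_mul_assoc)
    then show ?thesis unfolding Nd_def using B that by (metis (mono_tags, lifting) mem_Collect_eq mult_eq_0_iff)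
  qed
  have "\<exists>e. C \<subseteq> pgl ` Nd e"
  proof -
    have op: "openin PGL2_topology (pgl ` Nd e)" for e
      using openin_pgl_image[OF _ Nd_sub] open_nondegenerate by (auto simp: Nd_def)
    have cov: "C \<subseteq> (\<Union>e. pgl ` Nd e)"
    proof
      fix g assume "g \<in> C"
      then have "g \<in> carrier PGL2" using compactin_subset_topspace[OF C(1)] by auto
      then obtain A where A: "g = pgl A" "det A \<noteq> 0" by (auto simp: carrier_PGL2)
      obtain s s' B where B: "s \<noteq> 0" "s' \<noteq> 0" "A = mat2 s 0 0 s' ** B" "prim_rows B" "det A = s * s' * det B"
        using prim_rows_ex[OF A(2)] by metis
      have "det B \<noteq> 0" using A B by auto
      then have "B \<in> prim_mats (val (det B) + 1)" using B by (auto simp: prim_mats_def fideal_iff)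
      then have "A \<in> Nd (val (det B) + 1)" unfolding Nd_def using B by blast
      then show "g \<in> (\<Union>e. pgl ` Nd e)" using A by blast
    qed
    have "\<exists>\<F>. finite \<F> \<and> \<F> \<subseteq> range (\<lambda>e. pgl ` Nd e) \<and> C \<subseteq> \<Union>\<F>"
      using C(1) op cov unfolding compactin_def by (metis (no_types, lifting) imageE)
    then obtain E where E: "finite E" "C \<subseteq> (\<Union>e\<in>E. pgl ` Nd e)" by (metis finite_subset_image)
    have "C \<subseteq> pgl ` Nd (Max E)"
    proof
      fix g assume "g \<in> C"
      then obtain e where e: "e \<in> E" "g \<in> pgl ` Nd e" using E by auto
      then have "e \<le> Max E" using E by simp
      then show "g \<in> pgl ` Nd (Max E)" using Nd_mono e by blast
    qed
    then show ?thesis by blast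
  qed
  then obtain e where e: "C \<subseteq> pgl ` Nd e" by blast
  have supp: "A \<in> Nd e" if "lift_fun \<phi> A \<noteq> 0" for A
  proof -
    have A: "det A \<noteq> 0" "\<phi> (pgl A) \<noteq> 0" using that by (auto simp: lift_fun_def split: if_splits)
    then have "pgl A \<in> torus <#>\<^bsub>PGL2\<^esub> C" using C(2) by auto
    then obtain s s' B where B: "s \<noteq> 0" "s' \<noteq> 0" "B \<in> Nd e" "pgl A = pgl (mat2 s 0 0 s' ** B)"
      using e by (auto simp: set_mult_def torus_def)
    then obtain d where "d \<noteq> 0" "A = mat d ** (mat2 s 0 0 s' ** B)" by (metis pgl_eq_iff)
    then have "A = mat2 (d * s) 0 0 (d * s') ** B" "d * s \<noteq> 0" "d * s' \<noteq> 0"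
      using B by (simp_all add: matrix_mul_assoc mat_eq_mat2)
    then show ?thesis using Nd_torus[OF B(3)] by auto
  qed
  \<comment> \<open>Two primitive representatives of the same point differ by a unit, so the
    valuation of the determinant depends only on the pair of points.\<close>
  have unit: "prim_mats e = Nd e \<inter> {A. prim_rows A}"
  proof -
    have "det A \<notin> fideal e" if A: "A \<in> Nd e" "prim_rows A" for A
    proof -
      from A(1) obtain s s' B where B: "s \<noteq> 0" "s' \<noteq> 0" "A = mat2 s 0 0 s' ** B" "B \<in> prim_mats e" by (auto simp: Nd_def)
      have u: "val s = 0" if "prim (s * a) (s * b)" "prim a b" "s \<noteq> 0" for s a b :: 'f
      proof -
        have *: "s * y \<in> fideal i \<longleftrightarrow> y \<in> fideal (i - val s)" for y i using that by (simp add: fideal_mult_iff)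
        show ?thesis using that(1,2) fideal_mono[of a 0 "1 - val s"] fideal_mono[of b 0 "1 - val s"]
          fideal_mono[of a "- val s" 1] fideal_mono[of b "- val s" 1] unfolding prim_def * by (cases "val s \<ge> 1"; cases "val s \<le> -1") auto
      qed
      obtain a b c d where B': "B = mat2 a b c d" by (cases B rule: mat2_cases)
      have "val s = 0" "val s' = 0" using u[of s a b] u[of s' c d] A(2) B by (auto simp: B' prim_mats_def)
      then show ?thesis using B by (auto simp: det_mul prim_mats_def fideal_mult_iff mult.assoc)
    qed
    moreover have "A \<in> Nd e" if "A \<in> prim_mats e" for A
      unfolding Nd_def using that
      by (intro CollectI, intro exI[of _ "1::'f"], intro exI[of _ A]) (simp add: mat_eq_mat2[symmetric])
    ultimately show ?thesis by (auto simp: prim_mats_def)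
  qed
  have loc: "\<exists>J\<ge>1. \<forall>B. (\<forall>i j. B $ i $ j - A $ i $ j \<in> fideal J) \<longrightarrow> lift_fun \<phi> B = lift_fun \<phi> A" if A: "det A \<noteq> 0" for A
  proof -
    obtain U where U: "openin PGL2_topology U" "pgl A \<in> U" "\<And>y. y \<in> U \<Longrightarrow> \<phi> y = \<phi> (pgl A)"
      using lc A unfolding locally_constant_def by (metis pgl_carrier topspace_PGL2)
    have "open {A. det A \<noteq> 0 \<and> pgl A \<in> U}" using U by (simp add: openin_PGL2)
    then obtain J where J: "J \<ge> 1" "\<And>B. (\<forall>i j. B $ i $ j - A $ i $ j \<in> fideal J) \<Longrightarrow> det B \<noteq> 0 \<and> pgl B \<in> U"
      unfolding open_mat_iff using A U by blast
    have "lift_fun \<phi> B = lift_fun \<phi> A" if "\<forall>i j. B $ i $ j - A $ i $ j \<in> fideal J" for B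
      using J(2)[OF that] U(3)[of "pgl B"] A by (simp add: lift_fun_def)
    then show ?thesis using J(1) by blast
  qed
  \<comment> \<open>A radius of constancy is chosen at each matrix; the largest one needed for a
    finite cover of \<open>prim_mats e\<close> becomes the level.\<close>
  obtain jj where jj: "\<And>A. det A \<noteq> 0 \<Longrightarrow> jj A \<ge> 1 \<and> (\<forall>B. (\<forall>i j. B $ i $ j - A $ i $ j \<in> fideal (jj A)) \<longrightarrow> lift_fun \<phi> B = lift_fun \<phi> A)"
    using loc by metis
  define V where "V A = {B. \<forall>i j. B $ i $ j - A $ i $ j \<in> fideal (jj A)}" for A :: "'f^2^2"
  have V_open: "open (V A)" if "det A \<noteq> 0" for A
    unfolding open_mat_iff
  proof (intro ballI exI[of _ "jj A"] conjI allI impI)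
    show "1 \<le> jj A" using jj[OF that] by simp
    fix B B' assume "B \<in> V A" "\<forall>i j. B' $ i $ j - B $ i $ j \<in> fideal (jj A)"
    then show "B' \<in> V A" unfolding V_def using fideal_diff_trans by blast
  qed
  have "prim_mats e \<subseteq> (\<Union>A\<in>prim_mats e. V A)" by (auto simp: V_def)
  then obtain D where D: "finite D" "D \<subseteq> prim_mats e" "prim_mats e \<subseteq> (\<Union>A\<in>D. V A)"
    using compactE_image[OF compact_prim_mats, of "prim_mats e" V e] V_open
    by (metis (mono_tags, lifting) fideal_0 mem_Collect_eq prim_mats_def)
  define M where "M = Max (insert 1 (jj ` D))"
  have M: "1 \<le> M" "\<And>A. A \<in> D \<Longrightarrow> jj A \<le> M" using D(1) by (auto simp: M_def)
  have nearby: "lift_fun \<phi> B = lift_fun \<phi> A" if A: "A \<in> prim_mats e" and B: "\<And>i j. B $ i $ j - A $ i $ j \<in> fideal M" for A B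
  proof -
    obtain A0 where A0: "A0 \<in> D" "A \<in> V A0" using A D(3) by auto
    have "det A0 \<noteq> 0" using A0 D(2) by (auto simp: prim_mats_def)
    note j = jj[OF this]
    have "\<forall>i k. A $ i $ k - A0 $ i $ k \<in> fideal (jj A0)" using A0(2) by (simp add: V_def)
    moreover from this have "\<forall>i k. B $ i $ k - A0 $ i $ k \<in> fideal (jj A0)"
      using fideal_diff_trans[OF fideal_mono[OF B M(2)[OF A0(1)]]] by blast
    ultimately show ?thesis using j by metis
  qed
  have "level M (lift_fun \<phi>)"
  proof (rule levelI[OF M(1)])
    fix A k :: "'f^2^2" assume A: "lift_fun \<phi> A \<noteq> 0" and k: "k \<in> cong_subgroup M"
    from supp[OF A] obtain s s' B where B: "s \<noteq> 0" "s' \<noteq> 0" "A = mat2 s 0 0 s' ** B" "B \<in> prim_mats e" by (auto simp: Nd_def)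
    have "prim_rows B" using B by (simp add: prim_mats_def)
    then have "lift_fun \<phi> (B ** k) = lift_fun \<phi> B"
      using M k by (intro nearby[OF B(4)] prim_rows_cong_subgroup) auto
    then show "lift_fun \<phi> (A ** k) = lift_fun \<phi> A"
      using B hom by (simp flip: matrix_mul_assoc)
  qed
  moreover have "support_bound e (lift_fun \<phi>)"
    unfolding support_bound_def using supp unit by (auto simp: prim_mats_def)
  moreover have "\<forall>A. det A = 0 \<longrightarrow> lift_fun \<phi> A = 0" by (simp add: lift_fun_def)
  ultimately show ?thesis using hom unfolding compact_section_def equiv_section_def by blast
qed

section \<open>Integration over the torus\<close>

lemma compact_fideal_coset: "compact {t::'f::nonarch_local_field. t - a \<in> fideal j}"
proof -
  have "closed {t. t - a \<in> fideal j}" unfolding closed_def open_nonarch_iff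
  proof (intro ballI)
    fix t assume t: "t \<in> - {t. t - a \<in> fideal j}"
    have "s \<notin> {t. t - a \<in> fideal j}" if "s - t \<in> fideal (max 1 j)" for s
      using that t fideal_mono[of "s - t" "max 1 j" j] fideal_diff_trans[of t s j a] fideal_diff_commute[of s t] by auto
    then show "\<exists>J\<ge>1. \<forall>s. s - t \<in> fideal J \<longrightarrow> s \<in> - {t. t - a \<in> fideal j}"
      by (intro exI[of _ "max 1 j"]) auto
  qed
  moreover have "{t. t - a \<in> fideal j} \<subseteq> fideal (min j (val a))"
  proof
    fix t assume "t \<in> {t. t - a \<in> fideal j}"
    then have "t - a \<in> fideal (min j (val a))" "a \<in> fideal (min j (val a))" by (auto elim: fideal_mono intro: fideal_mono[OF fideal_self])
    from fideal_add[OF this] show "t \<in> fideal (min j (val a))" by simp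
  qed
  ultimately show ?thesis
    using compact_Int_closed[OF compact_fideal[of "min j (val a)"], of "{t. t - a \<in> fideal j}"] by (simp add: Int_absorb1)
qed

abbreviation torus_topology :: "('f::nonarch_local_field^2^2) set topology"
  where "torus_topology \<equiv> subtopology PGL2_topology torus"

text \<open>The torus with its subspace topology is the multiplicative group of the field, in the
  coordinate t. Afterwards measures on the torus can be handled on discs in the field.\<close>

lemma openin_torus_iff:
  fixes V :: "('f::nonarch_local_field^2^2) set set"
  shows "openin torus_topology V \<longleftrightarrow> V \<subseteq> torus \<and> open {t. t \<noteq> 0 \<and> pdiag t \<in> V}"
proof
  assume "openin torus_topology V"
  then obtain U where U: "openin PGL2_topology U" "V = U \<inter> torus" by (auto simp: openin_subtopology)
  have S: "open {A. det A \<noteq> 0 \<and> pgl A \<in> U}" using U by (simp add: openin_PGL2)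
  have "open {t. t \<noteq> 0 \<and> pdiag t \<in> V}" unfolding open_nonarch_iff
  proof (intro ballI)
    fix t assume t: "t \<in> {t. t \<noteq> 0 \<and> pdiag t \<in> V}"
    then have "mat2 t 0 0 1 \<in> {A. det A \<noteq> 0 \<and> pgl A \<in> U}" using U by (auto simp: pdiag_def)
    then obtain J where J: "J \<ge> 1" "\<And>B. (\<forall>i j. B $ i $ j - mat2 t 0 0 1 $ i $ j \<in> fideal J) \<Longrightarrow> det B \<noteq> 0 \<and> pgl B \<in> U"
      using S unfolding open_mat_iff by blast
    have "t' \<noteq> 0 \<and> pdiag t' \<in> V" if "t' - t \<in> fideal J" for t'
      using J(2)[of "mat2 t' 0 0 1"] that U(2) by (auto simp: pdiag_def forall_2 simp flip: pdiag_def)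
    then show "\<exists>J\<ge>1. \<forall>y. y - t \<in> fideal J \<longrightarrow> y \<in> {t. t \<noteq> 0 \<and> pdiag t \<in> V}" using J(1) by auto
  qed
  then show "V \<subseteq> torus \<and> open {t. t \<noteq> 0 \<and> pdiag t \<in> V}" using U by auto
next
  assume V: "V \<subseteq> torus \<and> open {t. t \<noteq> 0 \<and> pdiag t \<in> V}"
  define W where "W = {t. t \<noteq> 0 \<and> pdiag t \<in> V}"
  \<comment> \<open>The quotient of the diagonal entries is invariant under scalars and restricts to
    the coordinate on the torus; it extends \<open>W\<close> to an open set of matrices.\<close>
  define S where "S = {A :: 'f^2^2. det A \<noteq> 0 \<and> A $ 2 $ 2 \<noteq> 0 \<and> A $ 1 $ 1 / A $ 2 $ 2 \<in> W}"
  have "open S"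
  proof -
    have "open {A :: 'f^2^2. A $ 2 $ 2 \<noteq> 0 \<and> A $ 1 $ 1 / A $ 2 $ 2 \<in> W}" unfolding open_mat_iff
    proof (intro ballI)
      fix A :: "'f^2^2" assume A: "A \<in> {A. A $ 2 $ 2 \<noteq> 0 \<and> A $ 1 $ 1 / A $ 2 $ 2 \<in> W}"
      define a where "a = A $ 1 $ 1"
      define d where "d = A $ 2 $ 2"
      have d: "d \<noteq> 0" "a / d \<in> W" using A by (auto simp: a_def d_def)
      obtain J where J: "J \<ge> 1" "\<And>y. y - a / d \<in> fideal J \<Longrightarrow> y \<in> W"
        using V d unfolding W_def[symmetric] open_nonarch_iff by blast
      define J' where "J' = max (max 1 (val d + 1)) (max (J + val d) (J + 2 * val d - val a))"
      have "d' \<noteq> 0 \<and> a' / d' \<in> W" if h: "a' - a \<in> fideal J'" "d' - d \<in> fideal J'" for a' d'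
      proof -
        have d': "d' \<noteq> 0" "val d' = val d"
          using val_eqI[of d d'] d fideal_mono[OF h(2), of "val d + 1"] by (auto simp: J'_def)
        have "a' / d' - a / d = ((a' - a) * d - a * (d' - d)) / (d * d')" using d d' by (simp add: field_simps)
        moreover have "(a' - a) * d - a * (d' - d) \<in> fideal (J + 2 * val d)"
        proof (rule fideal_diff)
          show "(a' - a) * d \<in> fideal (J + 2 * val d)"
            by (rule fideal_mult[OF h(1) fideal_self]) (simp add: J'_def)
          show "a * (d' - d) \<in> fideal (J + 2 * val d)"
            by (rule fideal_mult[OF fideal_self h(2)]) (simp add: J'_def)
        qed
        ultimately have "a' / d' - a / d \<in> fideal J" using d d' by (simp add: fideal_divide_iff val_mult)
        then show ?thesis using J d' by blast
      qed
      then show "\<exists>J\<ge>1. \<forall>B. (\<forall>i j. B $ i $ j - A $ i $ j \<in> fideal J) \<longrightarrow> B \<in> {A. A $ 2 $ 2 \<noteq> 0 \<and> A $ 1 $ 1 / A $ 2 $ 2 \<in> W}"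
        by (intro exI[of _ J']) (auto simp: J'_def a_def d_def)
    qed
    from open_Int[OF open_GL2 this] show ?thesis by (simp add: S_def Collect_conj_eq[symmetric])
  qed
  then have "openin PGL2_topology (pgl ` S)" by (rule openin_pgl_image) (auto simp: S_def)
  moreover have "V = pgl ` S \<inter> torus"
  proof (intro equalityI subsetI)
    fix g assume g: "g \<in> V"
    then obtain t where t: "t \<noteq> 0" "g = pdiag t" using V by (auto simp: torus_eq)
    then have "mat2 t 0 0 1 \<in> S" using g by (auto simp: S_def W_def)
    then show "g \<in> pgl ` S \<inter> torus" using t by (auto simp: pdiag_def simp flip: pdiag_def)
        (auto simp: pdiag_def)
  next
    fix g assume "g \<in> pgl ` S \<inter> torus"
    then obtain A t where A: "A \<in> S" "g = pgl A" "g = pdiag t" "t \<noteq> 0" by (auto simp: torus_eq)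
    then obtain c where "c \<noteq> 0" "A = mat c ** mat2 t 0 0 1" by (metis pdiag_def pgl_eq_iff)
    then have "A $ 1 $ 1 / A $ 2 $ 2 = t" by (simp add: mat_mult_mat2)
    then show "g \<in> V" using A by (auto simp: S_def W_def)
  qed
  ultimately show "openin torus_topology V" by (auto simp: openin_subtopology)
qed

definition torus_ball :: "'f::nonarch_local_field \<Rightarrow> int \<Rightarrow> ('f^2^2) set set"
  where "torus_ball t0 J = pdiag ` {t. t - t0 \<in> fideal J}"

definition tcoord :: "('f::field^2^2) set \<Rightarrow> 'f"
  where "tcoord = inv_into (- {0}) pdiag"

lemma tcoord_pdiag [simp]: "t \<noteq> 0 \<Longrightarrow> tcoord (pdiag t) = t"
  unfolding tcoord_def by (rule inv_into_f_f) (auto simp: inj_on_def)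

lemma torus_ballE:
  assumes "t0 \<noteq> 0" "val t0 < J" "t - t0 \<in> fideal J"
  shows "t \<noteq> 0" "val t = val t0"
  using val_eqI[of t0 t] assms fideal_mono[of "t - t0" J "val t0 + 1"] by auto

lemma pdiag_torus_ball: "pdiag t \<in> torus_ball t0 J \<longleftrightarrow> t - t0 \<in> fideal J"
  by (auto simp: torus_ball_def)

lemma openin_torus_ball:
  assumes "t0 \<noteq> 0" "val t0 < J"
  shows "openin torus_topology (torus_ball t0 J)"
proof -
  have "{t. t \<noteq> 0 \<and> pdiag t \<in> torus_ball t0 J} = {t. t - t0 \<in> fideal J}"
    using torus_ballE[OF assms] by (auto simp: pdiag_torus_ball)
  then show ?thesis unfolding openin_torus_iff using torus_ballE[OF assms] open_fideal_coset
    by (auto simp: torus_ball_def)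
qed

lemma compactin_torus_ball:
  assumes "t0 \<noteq> 0" "val t0 < J"
  shows "compactin torus_topology (torus_ball t0 J)"
proof -
  let ?T = "{t. t - t0 \<in> fideal J}"
  let ?f = "\<lambda>t :: 'a. mat2 t 0 0 1"
  have "continuous_on ?T (\<lambda>t. (\<lambda>(a, b, c, d). mat2 a b c d) (t, 0, 0, 1))"
    by (rule continuous_on_compose2[OF continuous_on_mat2]) (auto intro!: continuous_intros)
  then have c: "compact (?f ` ?T)" using compact_fideal_coset compact_continuous_image by auto
  have "?f ` ?T \<subseteq> {A. det A \<noteq> 0}" using torus_ballE[OF assms] by auto
  with c have "compactin (top_of_set {A. det A \<noteq> 0}) (?f ` ?T)" by (simp add: compactin_subtopology)
  then have "compactin PGL2_topology (pgl ` ?f ` ?T)" by (rule image_compactin[OF _ continuous_map_pgl])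
  moreover have "pgl ` ?f ` ?T = torus_ball t0 J" by (simp add: torus_ball_def pdiag_def image_image)
  moreover have "torus_ball t0 J \<subseteq> torus" using torus_ballE[OF assms] by (auto simp: torus_ball_def)
  ultimately show ?thesis by (simp add: compactin_subtopology)
qed

locale torus_haar =
  fixes MT :: "('f::nonarch_local_field^2^2) set measure"
  assumes haar: "haar_torus MT"
begin

lemma space_MT: "space MT = torus"
  using haar torus_subset unfolding haar_measure_def borel_measure_on_def by auto

lemma sets_MT: "sets MT = sigma_sets torus {U. openin torus_topology U}"
  using haar torus_subset[where 'a='f] unfolding haar_measure_def borel_measure_on_def by (auto simp: Int_absorb1)

lemma openin_sets_MT: "openin torus_topology U \<Longrightarrow> U \<in> sets MT"
  by (simp add: sets_MT sigma_sets.Basic)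

lemma emeasure_translate:
  assumes "t \<noteq> 0" "X \<in> sets MT"
  shows "emeasure MT ((\<lambda>h. pdiag t \<otimes>\<^bsub>PGL2\<^esub> h) ` X) = emeasure MT X"
proof -
  have "pdiag t <#\<^bsub>PGL2\<lparr>carrier := torus\<rparr>\<^esub> X = (\<lambda>h. pdiag t \<otimes>\<^bsub>PGL2\<^esub> h) ` X" by (auto simp: l_coset_def)
  moreover have "pdiag t \<in> carrier (PGL2\<lparr>carrier := torus\<rparr>)" using assms by simp
  ultimately show ?thesis using haar assms unfolding haar_measure_def by metis
qed

lemma torus_ball_sets: "t0 \<noteq> 0 \<Longrightarrow> val t0 < J \<Longrightarrow> torus_ball t0 J \<in> sets MT"
  by (intro openin_sets_MT openin_torus_ball)

lemma emeasure_torus_ball_finite: "t0 \<noteq> 0 \<Longrightarrow> val t0 < J \<Longrightarrow> emeasure MT (torus_ball t0 J) < \<infinity>"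
proof -
  assume "t0 \<noteq> 0" "val t0 < J"
  then have "compactin torus_topology (torus_ball t0 J)" by (rule compactin_torus_ball)
  moreover have "\<forall>K. compactin torus_topology K \<longrightarrow> emeasure MT K < \<infinity>" using haar by (simp add: haar_measure_def)
  ultimately show ?thesis by blast
qed

lemma emeasure_torus_ball_pos: "t0 \<noteq> 0 \<Longrightarrow> val t0 < J \<Longrightarrow> 0 < emeasure MT (torus_ball t0 J)"
proof -
  assume t0: "t0 \<noteq> 0" "val t0 < J"
  have "pdiag t0 \<in> torus_ball t0 J" by (simp add: pdiag_torus_ball)
  then have "torus_ball t0 J \<noteq> {}" by blast
  moreover have "\<forall>U. openin torus_topology U \<longrightarrow> U \<noteq> {} \<longrightarrow> 0 < emeasure MT U" using haar by (simp add: haar_measure_def)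
  ultimately show ?thesis using openin_torus_ball[OF t0] by blast
qed

lemma emeasure_torus_ball:
  assumes "t0 \<noteq> 0" "val t0 < J"
  shows "emeasure MT (torus_ball t0 J) = emeasure MT (torus_ball 1 (J - val t0))"
proof -
  have "(\<lambda>h. pdiag t0 \<otimes>\<^bsub>PGL2\<^esub> h) ` torus_ball 1 (J - val t0) = torus_ball t0 J"
  proof -
    have *: "t0 * u - t0 \<in> fideal J \<longleftrightarrow> u - 1 \<in> fideal (J - val t0)" for u
      using fideal_mult_iff[OF assms(1), of "u - 1" J] by (simp add: algebra_simps)
    have "(\<lambda>u. t0 * u) ` {u. u - 1 \<in> fideal (J - val t0)} = {t. t - t0 \<in> fideal J}"
    proof (intro equalityI subsetI)
      fix t assume "t \<in> {t. t - t0 \<in> fideal J}"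
      then have "t = t0 * (t / t0)" "t / t0 - 1 \<in> fideal (J - val t0)" using assms *[of "t / t0"] by auto
      then show "t \<in> (\<lambda>u. t0 * u) ` {u. u - 1 \<in> fideal (J - val t0)}" by blast
    qed (use * in auto)
    then have "pdiag ` (\<lambda>u. t0 * u) ` {u. u - 1 \<in> fideal (J - val t0)} = torus_ball t0 J"
      by (simp only: torus_ball_def)
    then show ?thesis by (simp add: torus_ball_def image_image pdiag_mult)
  qed
  then show ?thesis using emeasure_translate[OF assms(1) torus_ball_sets[of 1 "J - val t0"]] assms by simp
qed

text \<open>The principal units of level \<open>J\<close> are the disjoint union of q multiplicative
  translates of those of level \<open>J + 1\<close>.\<close>

lemma emeasure_torus_ball_split:
  assumes "1 \<le> J"
  shows "emeasure MT (torus_ball 1 J) = of_nat (residue_card TYPE('f)) * emeasure MT (torus_ball 1 (J + 1))"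
proof -
  obtain R :: "'f set" where R: "reps J (J + 1) R" "card R = residue_card TYPE('f)" using ex_reps_1 by blast
  have u: "1 + s \<noteq> 0 \<and> val (1 + s) = 0" if "s \<in> R" for s
    using one_unit[of "1 + s" J] reps_subset[OF R(1) that] assms by auto
  have "torus_ball 1 J = (\<Union>s\<in>R. torus_ball (1 + s) (J + 1))"
  proof (intro equalityI subsetI)
    fix g :: "('f^2^2) set" assume "g \<in> torus_ball 1 J"
    then obtain t where t: "g = pdiag t" "t - 1 \<in> fideal J" by (auto simp: torus_ball_def)
    from repsE[OF R(1) t(2)] obtain s where "s \<in> R" "t - 1 - s \<in> fideal (J + 1)" by metis
    then show "g \<in> (\<Union>s\<in>R. torus_ball (1 + s) (J + 1))" using t by (auto simp: pdiag_torus_ball diff_diff_eq)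
  next
    fix g :: "('f^2^2) set" assume "g \<in> (\<Union>s\<in>R. torus_ball (1 + s) (J + 1))"
    then obtain s t where t: "s \<in> R" "g = pdiag t" "t - (1 + s) \<in> fideal (J + 1)" by (auto simp: torus_ball_def)
    have "t - (1 + s) \<in> fideal J" using fideal_mono[OF t(3)] by simp
    from fideal_add[OF this reps_subset[OF R(1) t(1)]] have "t - 1 \<in> fideal J" by simp
    then show "g \<in> torus_ball 1 J" using t by (auto simp: pdiag_torus_ball)
  qed
  moreover have "disjoint_family_on (\<lambda>s. torus_ball (1 + s) (J + 1)) R"
  proof -
    have "s = s'" if "s \<in> R" "s' \<in> R" "t - (1 + s) \<in> fideal (J + 1)" "t - (1 + s') \<in> fideal (J + 1)" for s s' t
    proof -
      have "s - s' \<in> fideal (J + 1)" using fideal_diff[OF that(4,3)] by simp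
      then show ?thesis using repsE[OF R(1) reps_subset[OF R(1) that(1)]] that(1,2)
        by (metis cancel_comm_monoid_add_class.diff_cancel fideal_0)
    qed
    then show ?thesis unfolding disjoint_family_on_def torus_ball_def by (auto simp: image_iff)
  qed
  ultimately have "emeasure MT (torus_ball 1 J) = (\<Sum>s\<in>R. emeasure MT (torus_ball (1 + s) (J + 1)))"
    using u assms reps_finite[OF R(1)] torus_ball_sets[of "1 + _" "J + 1"]
    by (simp add: sum_emeasure[symmetric] image_subset_iff)
  also have "\<dots> = (\<Sum>s\<in>R. emeasure MT (torus_ball 1 (J + 1)))"
  proof (rule sum.cong[OF refl])
    fix s assume "s \<in> R"
    then show "emeasure MT (torus_ball (1 + s) (J + 1)) = emeasure MT (torus_ball 1 (J + 1))"
      using emeasure_torus_ball[of "1 + s" "J + 1"] u[of s] assms by simp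
  qed
  finally show ?thesis using R(2) by simp
qed

text \<open>The Haar measure is \<open>tvol\<close> times dt/|t|, where the additive measure dt
  gives the integers volume 1.\<close>

definition tvol :: real where "tvol = measure MT (torus_ball 1 1) * rq TYPE('f)"

lemma measure_torus_ball:
  assumes "t0 \<noteq> 0" "val t0 < J"
  shows "measure MT (torus_ball t0 J) = tvol * rq TYPE('f) powi (val t0 - J)"
proof -
  have q: "rq TYPE('f) \<noteq> 0" using rq_gt_1[where 'f='f] by linarith
  have 1: "measure MT (torus_ball 1 i) = tvol * rq TYPE('f) powi (- i)" if "1 \<le> i" for i
    using that
  proof (induction i rule: int_ge_induct)
    case base
    show ?case using q by (simp add: tvol_def power_int_minus)
  next
    case (step i)
    have "measure MT (torus_ball 1 i) = rq TYPE('f) * measure MT (torus_ball 1 (i + 1))"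
      using emeasure_torus_ball_split[OF step.hyps] by (simp add: measure_def enn2real_mult)
    moreover have "rq TYPE('f) powi (- i) = rq TYPE('f) * rq TYPE('f) powi (- (i + 1))"
      using power_int_add_1[of "rq TYPE('f)" "- (i + 1)"] q by simp
    ultimately show ?case using step.IH q by simp
  qed
  show ?thesis using 1[of "J - val t0"] emeasure_torus_ball[OF assms] assms by (simp add: measure_def)
qed

lemma tvol_pos: "0 < tvol"
  using emeasure_torus_ball_pos[of 1 1] emeasure_torus_ball_finite[of 1 1] rq_gt_1[where 'f='f]
  by (simp add: tvol_def measure_def enn2real_positive_iff)

text \<open>The substitution t = t0 + c s. On the support t has the valuation of \<open>t0\<close>,
  so dt/|t| becomes |c| ds up to a factor independent of \<open>c\<close>. Every |b| in the
  asymptotics comes from here.\<close>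

lemma integral_step:
  fixes h :: "'f \<Rightarrow> complex"
  assumes R: "reps l l' R" "l \<le> l'" and out: "\<And>s. s \<notin> fideal l \<Longrightarrow> h s = 0"
    and per: "\<And>s s'. s - s' \<in> fideal l' \<Longrightarrow> h s = h s'"
    and t0: "t0 \<noteq> 0" and c: "c \<noteq> 0" "val t0 < val c + l"
  shows "has_bochner_integral MT (\<lambda>g. h ((tcoord g - t0) / c))
    (of_real (abs_val c) * (of_real (tvol * rq TYPE('f) powi (val t0 - l')) * (\<Sum>s\<in>R. h s)))"
proof -
  have s: "t0 + c * s \<noteq> 0" "val (t0 + c * s) = val t0" if "s \<in> R" for s
  proof -
    have "c * s \<in> fideal (val t0 + 1)" using reps_subset[OF R(1) that] c by (intro fideal_mult[of c "val c" s l]) auto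
    then show "t0 + c * s \<noteq> 0" "val (t0 + c * s) = val t0" using val_add_eq t0 by auto
  qed
  define B where "B s = torus_ball (t0 + c * s) (val c + l')" for s
  have "has_bochner_integral MT (\<lambda>g. \<Sum>s\<in>R. indicator (B s) g *\<^sub>R h s) (\<Sum>s\<in>R. measure MT (B s) *\<^sub>R h s)"
    using s c R(2) torus_ball_sets emeasure_torus_ball_finite unfolding B_def
    by (intro has_bochner_integral_sum has_bochner_integral_indicator) (simp_all add: infinity_ennreal_def)
  moreover have "(\<Sum>s\<in>R. measure MT (B s) *\<^sub>R h s) =
      of_real (abs_val c) * (of_real (tvol * rq TYPE('f) powi (val t0 - l')) * (\<Sum>s\<in>R. h s))"
  proof -
    have "measure MT (B s) = abs_val c * (tvol * rq TYPE('f) powi (val t0 - l'))" if "s \<in> R" for s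
    proof -
      have "rq TYPE('f) powi (val t0 - (val c + l')) = rq TYPE('f) powi (- val c) * rq TYPE('f) powi (val t0 - l')"
        using rq_gt_1[where 'f='f] by (subst power_int_add[symmetric]) (auto simp: algebra_simps)
      then show ?thesis using s[OF that] c R(2) by (simp add: B_def measure_torus_ball abs_val_eq)
    qed
    then show ?thesis by (simp add: scaleR_conv_of_real sum_distrib_left mult.assoc)
  qed
  moreover have "(\<Sum>s\<in>R. indicator (B s) g *\<^sub>R h s) = h ((tcoord g - t0) / c)" if g: "g \<in> space MT" for g
  proof -
    obtain t where t: "t \<noteq> 0" "g = pdiag t" using g by (auto simp: space_MT torus_eq)
    have e: "t - (t0 + c * s) \<in> fideal (val c + l') \<longleftrightarrow> (t - t0) / c - s \<in> fideal l'" for s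
    proof -
      have "(t - t0) / c - s = (t - (t0 + c * s)) / c" using c by (simp add: field_simps)
      then show ?thesis using c by (simp add: fideal_divide_iff add.commute)
    qed
    have "(\<Sum>s\<in>R. indicator (B s) g *\<^sub>R h s) = (\<Sum>s\<in>R. if (t - t0) / c - s \<in> fideal l' then h s else 0)"
      using t by (intro sum.cong) (auto simp: B_def pdiag_torus_ball e)
    also have "\<dots> = h ((t - t0) / c)" using out per by (intro reps_sum[OF R(1) _ R(2)]) metis+
    finally show ?thesis using t by simp
  qed
  ultimately show ?thesis by (simp cong: has_bochner_integral_cong)
qed

text \<open>Local constancy on the multiplicative group only; the bound \<open>val t < J\<close>
  keeps the disc around t away from 0.\<close>

definition loc_const :: "('f \<Rightarrow> complex) \<Rightarrow> bool"
  where "loc_const h \<longleftrightarrow> (\<forall>t. t \<noteq> 0 \<longrightarrow> (\<exists>J. val t < J \<and> (\<forall>t'. t' - t \<in> fideal J \<longrightarrow> h t' = h t)))"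

lemma loc_const_measurable:
  assumes "loc_const h"
  shows "(\<lambda>g. h (tcoord g)) \<in> borel_measurable MT"
proof (rule borel_measurableI)
  fix S :: "complex set"
  let ?V = "(\<lambda>g. h (tcoord g)) -` S \<inter> space MT"
  have "open {t. t \<noteq> 0 \<and> pdiag t \<in> ?V}" unfolding open_nonarch_iff
  proof (intro ballI)
    fix t assume t: "t \<in> {t. t \<noteq> 0 \<and> pdiag t \<in> ?V}"
    then obtain J where J: "val t < J" "\<And>t'. t' - t \<in> fideal J \<Longrightarrow> h t' = h t" using assms by (auto simp: loc_const_def)
    have "t' \<in> {t. t \<noteq> 0 \<and> pdiag t \<in> ?V}" if h: "t' - t \<in> fideal (max 1 J)" for t'
    proof -
      have J': "t' - t \<in> fideal J" using fideal_mono[OF h] by simp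
      then have "t' \<noteq> 0" using torus_ballE[of t J t'] t J by auto
      then show ?thesis using t J(2)[OF J'] by (auto simp: space_MT)
    qed
    then show "\<exists>J\<ge>1. \<forall>y. y - t \<in> fideal J \<longrightarrow> y \<in> {t. t \<noteq> 0 \<and> pdiag t \<in> ?V}"
      by (intro exI[of _ "max 1 J"] conjI allI impI) (assumption | simp)+
  qed
  then show "?V \<in> sets MT" by (intro openin_sets_MT) (simp add: openin_torus_iff space_MT)
qed

lemma distr_translate:
  assumes "u \<noteq> 0"
  shows "distr MT MT (\<lambda>h. pdiag u \<otimes>\<^bsub>PGL2\<^esub> h) = MT" "(\<lambda>h. pdiag u \<otimes>\<^bsub>PGL2\<^esub> h) \<in> measurable MT MT"
proof -
  let ?T = "\<lambda>h. pdiag u \<otimes>\<^bsub>PGL2\<^esub> h"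
  have mem: "?T h \<in> torus" if "h \<in> torus" for h using that assms by (auto simp: torus_eq pdiag_mult)
  have pre: "?T -` X \<inter> torus = (\<lambda>h. pdiag (inverse u) \<otimes>\<^bsub>PGL2\<^esub> h) ` X" if X: "X \<subseteq> torus" for X
  proof (intro equalityI subsetI)
    fix g assume g: "g \<in> ?T -` X \<inter> torus"
    then obtain t where t: "t \<noteq> 0" "g = pdiag t" by (auto simp: torus_eq)
    then have "g = pdiag (inverse u) \<otimes>\<^bsub>PGL2\<^esub> ?T g" using assms by (simp add: pdiag_mult)
    then show "g \<in> (\<lambda>h. pdiag (inverse u) \<otimes>\<^bsub>PGL2\<^esub> h) ` X" using g by blast
  next
    fix g assume "g \<in> (\<lambda>h. pdiag (inverse u) \<otimes>\<^bsub>PGL2\<^esub> h) ` X"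
    then obtain y where y: "y \<in> X" "g = pdiag (inverse u) \<otimes>\<^bsub>PGL2\<^esub> y" by blast
    then obtain t where "t \<noteq> 0" "y = pdiag t" using X by (auto simp: torus_eq)
    with y have t: "t \<noteq> 0" "pdiag t \<in> X" "g = pdiag (inverse u * t)" by (auto simp: pdiag_mult)
    have "pdiag u \<otimes>\<^bsub>PGL2\<^esub> g = pdiag t" unfolding t(3) pdiag_mult using assms by (simp flip: mult.assoc)
    then show "g \<in> ?T -` X \<inter> torus" using assms t by simp
  qed
  show m: "?T \<in> measurable MT MT"
  proof (rule measurable_sigma_sets[OF sets_MT])
    show "{U. openin torus_topology U} \<subseteq> Pow torus" by (auto dest!: openin_subset)
    show "?T \<in> space MT \<rightarrow> torus" using mem by (simp add: space_MT)
    fix V :: "('f^2^2) set set" assume V: "V \<in> {U. openin torus_topology U}"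
    let ?W = "{t. t \<noteq> 0 \<and> pdiag t \<in> V}"
    have "open {t. t \<noteq> 0 \<and> pdiag t \<in> ?T -` V \<inter> torus}" unfolding open_nonarch_iff
    proof (intro ballI)
      fix t assume t: "t \<in> {t. t \<noteq> 0 \<and> pdiag t \<in> ?T -` V \<inter> torus}"
      then have "u * t \<in> ?W" using assms by (auto simp: pdiag_mult)
      moreover have "open ?W" using V by (simp add: openin_torus_iff)
      ultimately obtain J where J: "J \<ge> 1" "\<And>y. y - u * t \<in> fideal J \<Longrightarrow> y \<in> ?W" unfolding open_nonarch_iff by blast
      have "t' \<in> {t. t \<noteq> 0 \<and> pdiag t \<in> ?T -` V \<inter> torus}" if h: "t' - t \<in> fideal (max 1 (J - val u))" for t'
      proof -
        have "t' - t \<in> fideal (J - val u)" using fideal_mono[OF h] by simp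
        then have "u * t' - u * t \<in> fideal J" using assms fideal_mult_iff[of u "t' - t" J] by (simp add: algebra_simps)
        then have "u * t' \<in> ?W" using J by blast
        then show ?thesis by (auto simp: pdiag_mult)
      qed
      then show "\<exists>J\<ge>1. \<forall>y. y - t \<in> fideal J \<longrightarrow> y \<in> {t. t \<noteq> 0 \<and> pdiag t \<in> ?T -` V \<inter> torus}"
        by (intro exI[of _ "max 1 (J - val u)"]) auto
    qed
    then show "?T -` V \<inter> space MT \<in> sets MT" by (intro openin_sets_MT) (simp add: openin_torus_iff space_MT)
  qed
  show "distr MT MT ?T = MT"
  proof (rule measure_eqI)
    fix X assume X: "X \<in> sets (distr MT MT ?T)"
    then have X': "X \<in> sets MT" "X \<subseteq> torus" using sets.sets_into_space[of X MT] by (auto simp: space_MT)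
    then show "emeasure (distr MT MT ?T) X = emeasure MT X"
      using emeasure_distr[OF m X'(1)] pre[OF X'(2)] emeasure_translate[of "inverse u" X] assms by (simp add: space_MT)
  qed simp
qed

lemma integral_translate:
  assumes "loc_const h" "u \<noteq> 0"
  shows "(\<integral>g. h (u * tcoord g) \<partial>MT) = (\<integral>g. h (tcoord g) \<partial>MT)"
proof -
  have "(\<integral>g. h (tcoord g) \<partial>MT) = (\<integral>g. h (tcoord g) \<partial>distr MT MT (\<lambda>g. pdiag u \<otimes>\<^bsub>PGL2\<^esub> g))"
    using distr_translate[OF assms(2)] by simp
  also have "\<dots> = (\<integral>g. h (tcoord (pdiag u \<otimes>\<^bsub>PGL2\<^esub> g)) \<partial>MT)"
    by (rule integral_distr[OF distr_translate(2)[OF assms(2)] loc_const_measurable[OF assms(1)]])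
  also have "\<dots> = (\<integral>g. h (u * tcoord g) \<partial>MT)"
  proof (rule Bochner_Integration.integral_cong[OF refl])
    fix g assume "g \<in> space MT"
    then obtain t where "t \<noteq> 0" "g = pdiag t" by (auto simp: space_MT torus_eq)
    then show "h (tcoord (pdiag u \<otimes>\<^bsub>PGL2\<^esub> g)) = h (u * tcoord g)" using assms by (simp add: pdiag_mult)
  qed
  finally show ?thesis by simp
qed

end

section \<open>The orbital integral\<close>

text \<open>The matrix of t^-1 \<gamma>(x) t for the torus element with coordinate t. Its
  determinant is x - 1 for every nonzero t.\<close>

definition conj_gamma :: "'f::field \<Rightarrow> 'f \<Rightarrow> 'f^2^2"
  where "conj_gamma x t = mat2 (- 1) (x / t) (- t) 1"

text \<open>Moving a diagonal matrix to the left only rescales t, which invariance of the Haar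
  measure then absorbs. Hence the orbital integral is equivariant.\<close>

lemma conj_gamma_diag:
  assumes "s \<noteq> 0" "s' \<noteq> 0"
  shows "conj_gamma x t ** (mat2 s 0 0 s' ** A) = mat2 s 0 0 s' ** (conj_gamma x (s / s' * t) ** A)"
  unfolding matrix_mul_assoc conj_gamma_def using assms by (simp add: field_simps)

context torus_haar begin

definition orb :: "'f \<Rightarrow> ('f^2^2 \<Rightarrow> complex) \<Rightarrow> 'f^2^2 \<Rightarrow> complex"
  where "orb x F A = (\<integral>g. F (conj_gamma x (tcoord g) ** A) \<partial>MT)"

lemma orb_loc_const:
  assumes F: "compact_section \<theta> F" and x: "x \<noteq> 1"
  shows "loc_const (\<lambda>t. F (conj_gamma x t ** A))"
proof (cases "det A = 0")
  case True
  then show ?thesis using compact_section_singular[OF F] by (simp add: loc_const_def det_mul) (meson gt_ex)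
next
  case False
  obtain M0 where M0: "level M0 F" using F by (rule compact_sectionE)
  obtain M where M: "level M (\<lambda>B. F (B ** A))" using level_right[OF M0 False] by blast
  show ?thesis unfolding loc_const_def
  proof (intro allI impI)
    fix t :: 'f assume t: "t \<noteq> 0"
    define N where "N = M + val (x - 1)"
    define J where "J = max (max (val t + 1) N) (max (N + val t - val x) (N + 2 * val t - val x))"
    have "F (conj_gamma x t' ** A) = F (conj_gamma x t ** A)" if h: "t' - t \<in> fideal J" for t'
    proof -
      have t': "t' \<noteq> 0" "val t' = val t" using torus_ballE[OF t _ h] by (auto simp: J_def)
      have 1: "t' - t \<in> fideal N" using fideal_mono[OF h] by (simp add: J_def)
      have xt: "x * (t' - t) \<in> fideal (N + val t)" "x * (t' - t) \<in> fideal (N + 2 * val t)"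
        by (rule fideal_mult[OF fideal_self h]; simp add: J_def)+
      have 2: "x / t * (t' - t) \<in> fideal N"
        using xt(1) t by (simp add: fideal_divide_iff times_divide_eq_left)
      have "x * (t - t') = - (x * (t' - t))" by (simp add: algebra_simps)
      then have 6: "x * (t - t') / t \<in> fideal N" using 2 by (simp add: times_divide_eq_left)
      have e: "x / t' - x / t = - (x * (t' - t)) / (t * t')" "t * (x / t' - x / t) = - (x * (t' - t)) / t'"
        using t t' by (simp_all add: field_simps)
      have 3: "x / t' - x / t \<in> fideal N" unfolding e using xt(2) t t' by (simp add: fideal_divide_iff val_mult)
      have 4: "t * (x / t' - x / t) \<in> fideal N" unfolding e using xt(1) t t' by (simp add: fideal_divide_iff)
      have 5: "x / t * (- t' - - t) = - (x / t * (t' - t))" by (simp add: ring_distribs del: times_divide_eq_left)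
      show ?thesis unfolding conj_gamma_def
        by (rule level_perturb[OF M, of "x - 1"])
          (use x t 1 2 3 4 6 in \<open>simp_all add: N_def[symmetric] 5 fideal_diff_commute[of t t']\<close>)
    qed
    moreover have "val t < J" by (simp add: J_def)
    ultimately show "\<exists>J. val t < J \<and> (\<forall>t'. t' - t \<in> fideal J \<longrightarrow> F (conj_gamma x t' ** A) = F (conj_gamma x t ** A))"
      by blast
  qed
qed

lemma orb_equiv_section:
  assumes F: "compact_section \<theta> F" and x: "x \<noteq> 1"
  shows "equiv_section \<theta> (orb x F)"
proof -
  obtain M where M: "level M F" using F by (rule compact_sectionE)
  have "orb x F (mat2 s 0 0 s' ** A) = \<theta> s * inverse (\<theta> s') * orb x F A" if s: "s \<noteq> 0" "s' \<noteq> 0" for s s' A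
  proof -
    have "orb x F (mat2 s 0 0 s' ** A) = (\<integral>g. \<theta> s * inverse (\<theta> s') * F (conj_gamma x (s / s' * tcoord g) ** A) \<partial>MT)"
      unfolding orb_def conj_gamma_diag[OF s] compact_section_scale(1)[OF F s] ..
    also have "\<dots> = \<theta> s * inverse (\<theta> s') * (\<integral>g. F (conj_gamma x (s / s' * tcoord g) ** A) \<partial>MT)"
      by (rule integral_mult_right_zero)
    also have "(\<integral>g. F (conj_gamma x (s / s' * tcoord g) ** A) \<partial>MT) = orb x F A"
      unfolding orb_def using s by (intro integral_translate[OF orb_loc_const[OF F x]]) auto
    finally show ?thesis .
  qed
  moreover have "orb x F A = 0" if "det A = 0" for A
    using that compact_section_singular[OF F] by (simp add: orb_def det_mul)
  moreover have "level M (orb x F)" using M by (simp add: level_def orb_def matrix_mul_assoc)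
  ultimately show ?thesis unfolding equiv_section_def by blast
qed

lemma orb_level: "level M F \<Longrightarrow> level M (orb x F)"
  by (simp add: level_def orb_def matrix_mul_assoc)

text \<open>For small \<open>c\<close> the integrand is supported near \<open>t = 1\<close> and near \<open>t = x\<close>, and there it only
  depends on \<open>(t - 1) / c\<close> and \<open>(t - x) / c\<close>.\<close>

theorem orb_asymptotic:
  assumes F: "compact_section \<theta> F" and \<theta>: "mult_character \<theta>" and x: "x \<noteq> 0" "x \<noteq> 1"
  shows "\<exists>\<alpha> \<beta> n. \<forall>c. c \<noteq> 0 \<longrightarrow> n \<le> val c \<longrightarrow>
    orb x F (mat2 1 0 1 c) = of_real (abs_val c) * (\<alpha> * inverse (\<theta> c) + \<beta> * \<theta> c)"
proof -
  obtain M e where M: "level M F" "support_bound e F" using F by (rule compact_sectionE)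
  obtain M0 where M0: "1 \<le> M0" "\<And>u. u - 1 \<in> fideal M0 \<Longrightarrow> \<theta> u = 1" using mult_character_conductor[OF \<theta>] by metis
  note nz = mult_character_nz[OF \<theta>]
  define d where "d = val (x - 1)"
  have xd: "x - 1 \<noteq> 0" "val (1 - x) = d" using x val_minus[of "x - 1"] by (auto simp: d_def)
  \<comment> \<open>Chosen so that \<open>h1\<close> and \<open>h2\<close> vanish off this ideal,
    and so that the support bound excludes every t outside the discs of parameter ideal
    \<open>fideal l\<close> around 1 and x.\<close>
  define l where "l = min (min (d - e) (- e)) (min (val x - e) (min 0 (val x)))"
  define l' where "l' = max (max M (M + val x)) 0"
  have ll': "l \<le> l'" by (auto simp: l_def l'_def)
  \<comment> \<open>Up to \<theta>(t)^-1 the rows are (x - t, x c) and (1 - t, c). At t = 1 + c s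
    the second row is c (-s, 1) and the first tends to (x - 1, 0); at t = x + c s the first is c
    (-s, x) and the second tends to (1 - x, 0). \<open>h1\<close> and \<open>h2\<close> are the
    limiting values.\<close>
  define h1 where "h1 s = F (mat2 (x - 1) 0 (- s) 1)" for s
  define h2 where "h2 s = inverse (\<theta> x) * F (mat2 (- s) x (1 - x) 0)" for s
  have out1: "h1 s = 0" if "s \<notin> fideal l" for s
  proof (rule ccontr)
    assume *: "h1 s \<noteq> 0"
    have s: "s \<noteq> 0" using that by auto
    have "val (x - 1) < e + val (x - 1) + val (- s)"
      using support_bound_val[OF F M(2), of "mat2 (x - 1) 0 (- s) 1" "x - 1" "- s"] * s xd by (simp add: h1_def)
    then show False using that s by (simp add: fideal_iff l_def)
  qed
  have out2: "h2 s = 0" if "s \<notin> fideal l" for s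
  proof (rule ccontr)
    assume *: "h2 s \<noteq> 0"
    have s: "s \<noteq> 0" using that by auto
    have "val (- (x * (1 - x))) < e + val (- s) + val (1 - x)"
      using support_bound_val[OF F M(2), of "mat2 (- s) x (1 - x) 0" "- s" "1 - x"] * s xd by (simp add: h2_def)
    then show False using that s x xd by (simp add: fideal_iff l_def val_mult)
  qed
  have per1: "h1 s = h1 s'" if "s - s' \<in> fideal l'" for s s'
  proof -
    have "s - s' \<in> fideal M" using fideal_mono[OF that] by (simp add: l'_def)
    then have "(x - 1) * (- s - - s') \<in> fideal (M + val (x - 1))"
      by (intro fideal_mult[OF fideal_self]) (auto simp: fideal_diff_commute)
    then show ?thesis unfolding h1_def using xd by (intro level_perturb[OF M(1), of "x - 1"]) auto
  qed
  have per2: "h2 s = h2 s'" if "s - s' \<in> fideal l'" for s s'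
  proof -
    have "s - s' \<in> fideal (M + val x)" using fideal_mono[OF that] by (simp add: l'_def)
    then have "(1 - x) * (- s - - s') \<in> fideal (M + val (x * (1 - x)))"
      using x xd by (intro fideal_mult[OF fideal_self, of _ "M + val x"]) (auto simp: fideal_diff_commute val_mult)
    then have "F (mat2 (- s) x (1 - x) 0) = F (mat2 (- s') x (1 - x) 0)"
      using x by (intro level_perturb[OF M(1), of "- (x * (1 - x))"]) auto
    then show ?thesis by (simp add: h2_def)
  qed
  \<comment> \<open>Small enough for the discs around 1 and x to be disjoint, for \<theta> to be
    constant on each, and for the errors in passing to \<open>h1\<close> and \<open>h2\<close> to be
    below the level of \<open>F\<close>.\<close>
  define n where "n = Max {1 - l, val x + 1 - l, d + 1 - l, M0 - l, M0 + val x - l,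
    M + d - l, M + d - val x, M + d - 2 * l, M + d - val x - l, M + d + val x - l, M + d + val x, M + d + val x - 2 * l, M + d}"
  have n: "1 - l \<le> n" "val x + 1 - l \<le> n" "d + 1 - l \<le> n" "M0 - l \<le> n" "M0 + val x - l \<le> n"
    "M + d - l \<le> n" "M + d - val x \<le> n" "M + d - 2 * l \<le> n" "M + d - val x - l \<le> n" "M + d + val x - l \<le> n"
    "M + d + val x \<le> n" "M + d + val x - 2 * l \<le> n" "M + d \<le> n"
    unfolding n_def by (rule Max_ge; simp)+
  have key: "F (conj_gamma x t ** mat2 1 0 1 c) =
      inverse (\<theta> c) * h1 ((t - 1) / c) + \<theta> c * h2 ((t - x) / c)" if c: "c \<noteq> 0" "n \<le> val c" and t: "t \<noteq> 0" for c t
  proof -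
    have row: "F (conj_gamma x t ** mat2 1 0 1 c) = inverse (\<theta> t) * F (mat2 (x - t) (x * c) (1 - t) c)"
    proof -
      have "F (conj_gamma x t ** mat2 1 0 1 c) = F (mat2 (inverse t * (x - t)) (inverse t * (x * c)) (1 * (1 - t)) (1 * c))"
        using t by (simp add: conj_gamma_def field_simps)
      also have "\<dots> = inverse (\<theta> t) * F (mat2 (x - t) (x * c) (1 - t) c)"
        using compact_section_scale(2)[OF F, of "inverse t" 1] t
        by (simp add: mult_character_inverse[OF \<theta>] mult_character_1[OF \<theta>])
      finally show ?thesis .
    qed
    have not_both: "\<not> ((t - 1) / c \<in> fideal l \<and> (t - x) / c \<in> fideal l)"
    proof
      assume "(t - 1) / c \<in> fideal l \<and> (t - x) / c \<in> fideal l"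
      then have "t - 1 \<in> fideal (l + val c)" "t - x \<in> fideal (l + val c)" using c by (simp_all add: fideal_divide_iff)
      from fideal_diff[OF this] have "x - 1 \<in> fideal (l + val c)" by simp
      then show False using xd c n by (simp add: fideal_iff d_def)
    qed
    consider "(t - 1) / c \<in> fideal l" | "(t - x) / c \<in> fideal l" | "(t - 1) / c \<notin> fideal l" "(t - x) / c \<notin> fideal l" by blast
    then show ?thesis
    proof cases
      case 1
      define s where "s = (t - 1) / c"
      have s: "s \<in> fideal l" "t = 1 + c * s" using 1 c by (auto simp: s_def)
      have cs: "c * s \<in> fideal (val c + l)" using s by (intro fideal_mult[OF fideal_self]) auto
      have "\<theta> t = 1" using fideal_mono[OF cs, of M0] c n s by (intro M0) auto
      moreover have "F (mat2 (x - t) (x * c) (1 - t) c) = inverse (\<theta> c) * F (mat2 (x - 1 - c * s) (x * c) (- s) 1)"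
        using compact_section_scale(2)[OF F, of 1 c "x - t" "x * c" "- s" 1] c
        by (simp add: s(2) mult_character_1[OF \<theta>] algebra_simps)
      moreover have "F (mat2 (x - 1 - c * s) (x * c) (- s) 1) = h1 s" unfolding h1_def
      proof (rule level_perturb[OF M(1), of "x - 1"])
        have xc: "x * c \<in> fideal (val x + val c)" by (rule fideal_mult[OF fideal_self fideal_self]) simp
        have "s * (c * s) \<in> fideal (l + (val c + l))" "s * (x * c) \<in> fideal (l + (val x + val c))"
          using fideal_mult[OF s(1) cs] fideal_mult[OF s(1) xc] by auto
        then have "c * s \<in> fideal (M + d)" "x * c \<in> fideal (M + d)" "s * (c * s) \<in> fideal (M + d)" "s * (x * c) \<in> fideal (M + d)"
          using cs xc c n by (auto elim!: fideal_mono)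
        then show "1 * (x - 1 - c * s - (x - 1)) - 0 * (- s - - s) \<in> fideal (M + val (x - 1))"
          "1 * (x * c - 0) - 0 * (1 - 1) \<in> fideal (M + val (x - 1))"
          "(x - 1) * (- s - - s) - - s * (x - 1 - c * s - (x - 1)) \<in> fideal (M + val (x - 1))"
          "(x - 1) * (1 - 1) - - s * (x * c - 0) \<in> fideal (M + val (x - 1))"
          by (simp_all add: d_def[symmetric])
      qed (use xd in auto)
      moreover have "h2 ((t - x) / c) = 0" using out2 not_both 1 by blast
      ultimately show ?thesis unfolding row by (simp add: s_def)
    next
      case 2
      define s where "s = (t - x) / c"
      have s: "s \<in> fideal l" "t = x + c * s" using 2 c by (auto simp: s_def)
      have cs: "c * s \<in> fideal (val c + l)" using s by (intro fideal_mult[OF fideal_self]) auto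
      have "t / x - 1 \<in> fideal M0"
        using fideal_mono[OF cs, of "M0 + val x"] c n s by (intro one_unit_divide[OF x(1)]) auto
      then have "\<theta> (t / x) = 1" by (rule M0)
      then have "\<theta> t = \<theta> x" using mult_character_mult[OF \<theta>, of "t / x" x] t x by simp
      moreover have "F (mat2 (x - t) (x * c) (1 - t) c) = \<theta> c * F (mat2 (- s) x (1 - x - c * s) c)"
        using compact_section_scale(2)[OF F, of c 1 "- s" x "1 - t" c] c
        by (simp add: s(2) mult_character_1[OF \<theta>] algebra_simps)
      moreover have "F (mat2 (- s) x (1 - x - c * s) c) = F (mat2 (- s) x (1 - x) 0)"
      proof (rule level_perturb[OF M(1), of "- (x * (1 - x))"])
        have v: "val (- (x * (1 - x))) = val x + d" using x xd by (simp add: val_mult)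
        have "x * (c * s) \<in> fideal (val x + (val c + l))" "s * (c * s) \<in> fideal (l + (val c + l))"
          using fideal_mult[OF fideal_self cs] fideal_mult[OF s(1) cs] by auto
        moreover have "x * c \<in> fideal (val x + val c)" "s * c \<in> fideal (l + val c)"
          using fideal_mult[OF fideal_self fideal_self] fideal_mult[OF s(1) fideal_self] by auto
        ultimately have "x * (c * s) \<in> fideal (M + (val x + d))" "s * (c * s) \<in> fideal (M + (val x + d))"
          "x * c \<in> fideal (M + (val x + d))" "s * c \<in> fideal (M + (val x + d))"
          using c n by (auto elim!: fideal_mono)
        then show "0 * (- s - - s) - x * (1 - x - c * s - (1 - x)) \<in> fideal (M + val (- (x * (1 - x))))"
          "0 * (x - x) - x * (c - 0) \<in> fideal (M + val (- (x * (1 - x))))"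
          "- s * (1 - x - c * s - (1 - x)) - (1 - x) * (- s - - s) \<in> fideal (M + val (- (x * (1 - x))))"
          "- s * (c - 0) - (1 - x) * (x - x) \<in> fideal (M + val (- (x * (1 - x))))"
          unfolding v by simp_all
      qed (use x in auto)
      moreover have "h1 ((t - 1) / c) = 0" using out1 not_both 2 by blast
      ultimately show ?thesis unfolding row by (simp add: s_def h2_def)
    next
      case 3
      have "F (mat2 (x - t) (x * c) (1 - t) c) = 0"
      proof (rule ccontr)
        assume *: "F (mat2 (x - t) (x * c) (1 - t) c) \<noteq> 0"
        have n1: "t - 1 \<noteq> 0" "t - x \<noteq> 0" using 3 by auto
        have v: "val (1 - t) < l + val c" "val (x - t) < l + val c"
          using 3 c n1 val_minus[of "t - 1"] val_minus[of "t - x"] by (auto simp: fideal_divide_iff fideal_iff)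
        have "det (mat2 (x - t) (x * c) (1 - t) c) = c * t * (x - 1)" by (simp add: algebra_simps)
        then have i: "val c + val t + d < e + val (x - t) + val (1 - t)"
          using support_bound_val[OF F M(2) *, of "x - t" "1 - t"] n1 c t xd by (simp add: val_mult d_def)
        \<comment> \<open>As 1 and x differ by valuation \<open>d\<close>, t cannot be closer than
          that to both. For the factor with valuation at most \<open>d\<close>, \<open>b\<close> or
          \<open>b'\<close> bounds its quotient with t; inequality \<open>i\<close> then pushes t
          into the disc around the other point, contrary to \<open>v\<close>.\<close>
        have a: "val (1 - t) \<le> d \<or> val (x - t) \<le> d"
        proof (rule ccontr)
          assume "\<not> ?thesis"
          then have "x - t \<in> fideal (d + 1)" "1 - t \<in> fideal (d + 1)" using n1 by (auto simp: fideal_iff)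
          from fideal_diff[OF this] have "x - 1 \<in> fideal (d + 1)" by simp
          then show False using xd by (simp add: fideal_iff d_def)
        qed
        have b: "val t - val (1 - t) \<ge> min 0 (- d)" if "val (1 - t) \<le> d"
        proof (cases "val t < 0")
          case True
          then have "val (1 - t) = val t" using val_add_eq(2)[of "- t" 1] t by simp
          then show ?thesis by simp
        qed (use that in auto)
        have b': "val t - val (x - t) \<ge> min 0 (val x - d)" if "val (x - t) \<le> d"
        proof (cases "val t < val x")
          case True
          then have "val (x - t) = val t" using val_add_eq(2)[of "- t" x] t x by (simp add: fideal_iff)
          then show ?thesis by simp
        qed (use that in auto)
        show False using a b b' i v by (auto simp: l_def)
      qed
      then show ?thesis unfolding row using out1[OF 3(1)] out2[OF 3(2)] by simp
    qed
  qed
  obtain R :: "'f set" where R: "reps l l' R" using ex_reps[OF ll'] by blast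
  define K where "K t0 h = of_real (tvol * rq TYPE('f) powi (val t0 - l')) * (\<Sum>s\<in>R. h s)" for t0 :: 'f and h :: "'f \<Rightarrow> complex"
  have "orb x F (mat2 1 0 1 c) = of_real (abs_val c) * (K 1 h1 * inverse (\<theta> c) + K x h2 * \<theta> c)"
    if c: "c \<noteq> 0" "n \<le> val c" for c
  proof -
    have "has_bochner_integral MT (\<lambda>g. h1 ((tcoord g - 1) / c)) (of_real (abs_val c) * K 1 h1)"
      unfolding K_def using c n out1 per1 by (intro integral_step[OF R ll']) auto
    moreover have "has_bochner_integral MT (\<lambda>g. h2 ((tcoord g - x) / c)) (of_real (abs_val c) * K x h2)"
      unfolding K_def using c n out2 per2 x by (intro integral_step[OF R ll']) auto
    ultimately have "has_bochner_integral MT (\<lambda>g. inverse (\<theta> c) * h1 ((tcoord g - 1) / c) + \<theta> c * h2 ((tcoord g - x) / c))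
        (inverse (\<theta> c) * (of_real (abs_val c) * K 1 h1) + \<theta> c * (of_real (abs_val c) * K x h2))"
      by (intro has_bochner_integral_add has_bochner_integral_mult_right)
    then have "(\<integral>g. inverse (\<theta> c) * h1 ((tcoord g - 1) / c) + \<theta> c * h2 ((tcoord g - x) / c) \<partial>MT) =
        inverse (\<theta> c) * (of_real (abs_val c) * K 1 h1) + \<theta> c * (of_real (abs_val c) * K x h2)"
      by (rule has_bochner_integral_integral_eq)
    moreover have "orb x F (mat2 1 0 1 c) = (\<integral>g. inverse (\<theta> c) * h1 ((tcoord g - 1) / c) + \<theta> c * h2 ((tcoord g - x) / c) \<partial>MT)"
      unfolding orb_def
    proof (rule Bochner_Integration.integral_cong[OF refl])
      fix g assume "g \<in> space MT"
      then obtain t where "t \<noteq> 0" "g = pdiag t" by (auto simp: space_MT torus_eq)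
      then show "F (conj_gamma x (tcoord g) ** mat2 1 0 1 c) =
          inverse (\<theta> c) * h1 ((tcoord g - 1) / c) + \<theta> c * h2 ((tcoord g - x) / c)" using key[OF c] by simp
    qed
    ultimately show ?thesis by (simp add: algebra_simps)
  qed
  then show ?thesis by blast
qed

end

section \<open>The quotient measure\<close>

lemma coset_of_scale: "s \<noteq> 0 \<Longrightarrow> s' \<noteq> 0 \<Longrightarrow> coset_of (mat2 s 0 0 s' ** A) = coset_of A"
  using coset_of_eq_iff[of A "mat2 s 0 0 s' ** A"] by blast

lemma coset_of_pgl: "pgl A = pgl B \<Longrightarrow> coset_of A = coset_of B"
  by (simp add: coset_of_def)

lemma torusE: assumes "h \<in> torus" obtains t where "t \<noteq> 0" "h = pdiag t"
  using assms unfolding torus_eq by blast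

lemma open_diag_vimage:
  assumes "open (S :: ('f::nonarch_local_field^2^2) set)"
  shows "open {t. mat2 t 0 0 1 \<in> S}"
  unfolding open_nonarch_iff
proof (intro ballI)
  fix t assume "t \<in> {t. mat2 t 0 0 1 \<in> S}"
  then obtain J where J: "J \<ge> 1" "\<And>B. (\<forall>i j. B $ i $ j - mat2 t 0 0 1 $ i $ j \<in> fideal J) \<Longrightarrow> B \<in> S"
    using assms unfolding open_mat_iff by blast
  have "mat2 t' 0 0 1 \<in> S" if "t' - t \<in> fideal J" for t'
    using J(2)[of "mat2 t' 0 0 1"] that by (auto simp: forall_2)
  then show "\<exists>J\<ge>1. \<forall>y. y - t \<in> fideal J \<longrightarrow> y \<in> {t. mat2 t 0 0 1 \<in> S}" using J(1) by auto
qed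

text \<open>A congruence neighbourhood of the identity whose upper right entry has a level of its
  own. A dilated cell corresponds to one with a different \<open>J\<close> but the same
  \<open>a\<close>, so only the dependence of volumes on \<open>J\<close> matters.\<close>

definition iwahori :: "int \<Rightarrow> int \<Rightarrow> ('f::nonarch_local_field^2^2) set"
  where "iwahori a J = {A. A $ 1 $ 1 - 1 \<in> fideal a \<and> A $ 1 $ 2 \<in> fideal J \<and>
    A $ 2 $ 1 \<in> fideal a \<and> A $ 2 $ 2 - 1 \<in> fideal a}"

lemma cong_subgroup_iwahori: "cong_subgroup M = iwahori M M"
  by (simp add: cong_subgroup_def iwahori_def)

lemma open_iwahori: "open (iwahori a J)"
  unfolding open_mat_iff
proof (intro ballI exI[of _ "max 1 (max a J)"] conjI allI impI)
  fix A B :: "'a^2^2"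
  assume A: "A \<in> iwahori a J" and B: "\<forall>i j. B $ i $ j - A $ i $ j \<in> fideal (max 1 (max a J))"
  have B': "B $ i $ j - A $ i $ j \<in> fideal a" "B $ i $ j - A $ i $ j \<in> fideal J" for i j
    using fideal_mono[OF B[rule_format, of i j], of a] fideal_mono[OF B[rule_format, of i j], of J] by simp_all
  show "B \<in> iwahori a J"
    using A B' fideal_diff_trans[OF B'(1)] fideal_add[OF B'(2)[of 1 2], of "A $ 1 $ 2"]
      fideal_add[OF B'(1)[of 2 1], of "A $ 2 $ 1"] by (simp add: iwahori_def)
qed simp

lemma iwahori_prim_mats:
  assumes "1 \<le> a" "0 \<le> J" "A \<in> iwahori a J"
  shows "A \<in> prim_mats 1"
proof -
  obtain p q r s where A: "A = mat2 p q r s" by (cases A rule: mat2_cases)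
  have h: "p - 1 \<in> fideal a" "q \<in> fideal J" "r \<in> fideal a" "s - 1 \<in> fideal a" using assms by (auto simp: A iwahori_def)
  note u = one_unit[OF h(1) assms(1)] one_unit[OF h(4) assms(1)]
  have q: "q \<in> fideal 0" "r \<in> fideal 1" "r \<in> fideal 0" using h assms fideal_mono[of q J 0] fideal_mono[of r a] by auto
  have "q * r \<in> fideal 1" using fideal_mult[OF q(1,2), of 1] by simp
  then have "p * s - q * r \<noteq> 0" "val (p * s - q * r) = 0"
    using val_eqI[of "p * s" "p * s - q * r"] u by (auto simp: val_mult)
  then show ?thesis using q u by (auto simp: A prim_mats_def prim_def fideal_iff)
qed

lemma iwahori_det: "1 \<le> a \<Longrightarrow> 0 \<le> J \<Longrightarrow> A \<in> iwahori a J \<Longrightarrow> det A \<noteq> 0"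
  using iwahori_prim_mats[of a J A] by (auto simp: prim_mats_def)

lemma pgl_iwahori_iff:
  assumes a: "1 \<le> a"
  shows "pgl B \<in> pgl ` iwahori a J \<longleftrightarrow> B $ 1 $ 1 \<noteq> 0 \<and> B $ 1 $ 2 / B $ 1 $ 1 \<in> fideal J \<and>
    B $ 2 $ 1 / B $ 1 $ 1 \<in> fideal a \<and> B $ 2 $ 2 / B $ 1 $ 1 - 1 \<in> fideal a"
proof (cases B rule: mat2_cases)
  case (mat2 p q r s)
  show ?thesis
  proof
    assume "pgl B \<in> pgl ` iwahori a J"
    then obtain A where A: "A \<in> iwahori a J" "pgl A = pgl B" by auto
    then obtain c where c: "c \<noteq> 0" "B = mat c ** A" by (metis pgl_eq_iff)
    obtain p' q' r' s' where A': "A = mat2 p' q' r' s'" by (cases A rule: mat2_cases)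
    have h: "p' - 1 \<in> fideal a" "q' \<in> fideal J" "r' \<in> fideal a" "s' - 1 \<in> fideal a" using A by (auto simp: A' iwahori_def)
    note u = one_unit[OF h(1) a]
    have "s' / p' - 1 = ((s' - 1) - (p' - 1)) / p'" using u by (simp add: field_simps)
    then have "s' / p' - 1 \<in> fideal a" using fideal_diff[OF h(4,1)] u by (simp add: fideal_divide_iff)
    then show "B $ 1 $ 1 \<noteq> 0 \<and> B $ 1 $ 2 / B $ 1 $ 1 \<in> fideal J \<and> B $ 2 $ 1 / B $ 1 $ 1 \<in> fideal a \<and> B $ 2 $ 2 / B $ 1 $ 1 - 1 \<in> fideal a"
      using h u c by (simp add: A' mat_mult_mat2 fideal_divide_iff)
  next
    assume h: "B $ 1 $ 1 \<noteq> 0 \<and> B $ 1 $ 2 / B $ 1 $ 1 \<in> fideal J \<and> B $ 2 $ 1 / B $ 1 $ 1 \<in> fideal a \<and> B $ 2 $ 2 / B $ 1 $ 1 - 1 \<in> fideal a"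
    have "mat (inverse p) ** B \<in> iwahori a J" using h by (simp add: mat2 mat_mult_mat2 iwahori_def divide_inverse mult.commute)
    moreover have "pgl (mat (inverse p) ** B) = pgl B" using h by (intro pgl_scale) (simp add: mat2)
    ultimately show "pgl B \<in> pgl ` iwahori a J" by (metis imageI)
  qed
qed

section \<open>Cosets of congruence subgroups and right translation by integral matrices\<close>

definition kcoset :: "'f::nonarch_local_field^2^2 \<Rightarrow> int \<Rightarrow> ('f^2^2) set"
  where "kcoset A M = (\<lambda>k. A ** k) ` cong_subgroup M"

lemma left_image_eq: "det A \<noteq> 0 \<Longrightarrow> (\<lambda>k. A ** k) ` S = {B. inv2 A ** B \<in> S}"
  for A :: "'f::field^2^2" and S :: "('f^2^2) set"
proof -
  assume A: "det A \<noteq> 0"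
  have id: "inv2 A ** (A ** B) = B" "A ** (inv2 A ** B) = B" for B using inv2[OF A] by (simp_all add: matrix_mul_assoc)
  show ?thesis
  proof (intro equalityI subsetI)
    fix B assume "B \<in> {B. inv2 A ** B \<in> S}"
    then show "B \<in> (\<lambda>k. A ** k) ` S" using id(2)[of B] by (metis imageI mem_Collect_eq)
  qed (auto simp: id)
qed

lemma open_left_image: "det A \<noteq> 0 \<Longrightarrow> open S \<Longrightarrow> open ((\<lambda>k. A ** k) ` S)"
  for A :: "'f::nonarch_local_field^2^2" and S :: "('f^2^2) set"
  using open_mult_vimage(1)[of S "inv2 A"] left_image_eq[of A S] by simp

lemma kcoset_mult:
  assumes "B \<in> kcoset A M" "k \<in> cong_subgroup M" "1 \<le> M"
  shows "B ** k \<in> kcoset A M"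
proof -
  obtain l where "l \<in> cong_subgroup M" "B = A ** l" using assms(1) by (auto simp: kcoset_def)
  then have "B ** k = A ** (l ** k)" "l ** k \<in> cong_subgroup M"
    using assms cong_subgroup_mult by (auto simp: matrix_mul_assoc)
  then show ?thesis unfolding kcoset_def by blast
qed

lemma kcoset_self: "A \<in> kcoset A M"
  unfolding kcoset_def by (rule image_eqI[of _ _ "mat 1"]) auto

lemma kcoset_eq:
  assumes "B \<in> kcoset A M" "1 \<le> M"
  shows "kcoset B M = kcoset A M"
proof -
  obtain k where k: "k \<in> cong_subgroup M" "B = A ** k" using assms by (auto simp: kcoset_def)
  have "A = B ** inv2 k" using inv2(1)[OF cong_subgroup_det(2)[OF k(1) assms(2)]] k by (simp flip: matrix_mul_assoc)
  then have "A \<in> kcoset B M" using cong_subgroup_inv[OF k(1) assms(2)] by (auto simp: kcoset_def)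
  have *: "kcoset C M \<subseteq> kcoset D M" if "C \<in> kcoset D M" for C D
    using kcoset_mult[OF that _ assms(2)] by (auto simp: kcoset_def[of C])
  show ?thesis using *[OF assms(1)] *[OF \<open>A \<in> kcoset B M\<close>] by blast
qed

lemma coset_of_left: "coset_of A = coset_of B \<Longrightarrow> coset_of (A ** k) = coset_of (B ** k)"
  unfolding coset_of_eq_iff by (auto simp: matrix_mul_assoc)

lemma double_coset_eq:
  assumes "coset_of B \<in> coset_of ` kcoset A M" "1 \<le> M"
  shows "coset_of ` kcoset B M = coset_of ` kcoset A M"
proof -
  obtain C where C: "C \<in> kcoset A M" "coset_of B = coset_of C" using assms by auto
  have "coset_of ` kcoset B M = coset_of ` kcoset C M"
    unfolding kcoset_def image_image using coset_of_left[OF C(2)] by simp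
  then show ?thesis using kcoset_eq[OF C(1) assms(2)] by simp
qed

text \<open>Membership in GL(2) of the integers. Such matrices normalise every congruence subgroup,
  which is why right translation by them permutes its cosets.\<close>

definition integral_mat :: "'f::nonarch_local_field^2^2 \<Rightarrow> bool"
  where "integral_mat k \<longleftrightarrow> det k \<noteq> 0 \<and> (\<forall>i j. k $ i $ j \<in> fideal 0) \<and> (\<forall>i j. inv2 k $ i $ j \<in> fideal 0)"

lemma kcoset_right:
  assumes k: "integral_mat k"
  shows "(\<lambda>B. B ** k) ` kcoset A M = kcoset (A ** k) M"
proof -
  have k0: "det k \<noteq> 0" "\<And>i j. k $ i $ j \<in> fideal 0" "\<And>i j. inv2 k $ i $ j \<in> fideal 0" using k by (auto simp: integral_mat_def)
  have 1: "inv2 k ** l ** k \<in> cong_subgroup M" if "l \<in> cong_subgroup M" for l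
    using cong_subgroup_conj[OF k0(3) k0(2) inv2(2)[OF k0(1)] that, of M] by simp
  have 2: "k ** l ** inv2 k \<in> cong_subgroup M" if "l \<in> cong_subgroup M" for l
    using cong_subgroup_conj[OF k0(2) k0(3) inv2(1)[OF k0(1)] that, of M] by simp
  have e1: "A ** l ** k = A ** k ** (inv2 k ** l ** k)" for l
    using inv2(1)[OF k0(1)] by (metis matrix_mul_assoc matrix_mul_rid)
  have e2: "A ** k ** l = A ** (k ** l ** inv2 k) ** k" for l
    using inv2(2)[OF k0(1)] by (metis matrix_mul_assoc matrix_mul_rid)
  show ?thesis
  proof (intro equalityI subsetI)
    fix B assume "B \<in> (\<lambda>B. B ** k) ` kcoset A M"
    then obtain l where "l \<in> cong_subgroup M" "B = A ** l ** k" by (auto simp: kcoset_def)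
    then show "B \<in> kcoset (A ** k) M" using e1[of l] 1[of l] unfolding kcoset_def by blast
  next
    fix B assume "B \<in> kcoset (A ** k) M"
    then obtain l where l: "l \<in> cong_subgroup M" "B = A ** k ** l" by (auto simp: kcoset_def)
    have "A ** (k ** l ** inv2 k) \<in> kcoset A M" using 2[OF l(1)] by (auto simp: kcoset_def)
    then show "B \<in> (\<lambda>B. B ** k) ` kcoset A M" using l(2) e2[of l] by blast
  qed
qed

locale quotient_haar = torus_haar MT for MT :: "('f::nonarch_local_field^2^2) set measure" +
  fixes MG :: "('f^2^2) set measure" and N :: "('f^2^2) set set measure"
  assumes haar_G: "haar_PGL2 MG" and quotient: "quotient_measure PGL2 PGL2_topology torus MG MT N"
begin

lemma openin_sets_MG: "openin PGL2_topology U \<Longrightarrow> U \<in> sets MG"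
  using haar_G by (auto simp: haar_measure_def borel_measure_on_def intro: sigma_sets.Basic)

lemma emeasure_MG_translate:
  assumes "det h \<noteq> 0" "X \<in> sets MG"
  shows "emeasure MG ((\<lambda>u. pgl h \<otimes>\<^bsub>PGL2\<^esub> u) ` X) = emeasure MG X"
proof -
  have "pgl h <#\<^bsub>PGL2\<^esub> X = (\<lambda>u. pgl h \<otimes>\<^bsub>PGL2\<^esub> u) ` X" by (auto simp: l_coset_def)
  moreover have "\<forall>g\<in>carrier PGL2. \<forall>X\<in>sets MG. emeasure MG (g <#\<^bsub>PGL2\<^esub> X) = emeasure MG X"
    using haar_G by (simp add: haar_measure_def)
  ultimately show ?thesis using assms by (metis pgl_carrier)
qed

lemma emeasure_MG_left:
  assumes "det h \<noteq> 0" "open S" "S \<subseteq> {A. det A \<noteq> 0}"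
  shows "emeasure MG (pgl ` (\<lambda>k. h ** k) ` S) = emeasure MG (pgl ` S)"
  using emeasure_MG_translate[OF assms(1) openin_sets_MG[OF openin_pgl_image[OF assms(2,3)]]]
  by (simp add: image_image)

lemma emeasure_MG_iwahori_finite:
  assumes "1 \<le> a" "0 \<le> J"
  shows "emeasure MG (pgl ` iwahori a J) < \<infinity>"
proof -
  have sub: "prim_mats 1 \<subseteq> {A :: 'f^2^2. det A \<noteq> 0}" by (auto simp: prim_mats_def)
  then have "compactin (top_of_set {A :: 'f^2^2. det A \<noteq> 0}) (prim_mats 1)"
    using compact_prim_mats by (simp add: compactin_subtopology)
  then have "compactin PGL2_topology (pgl ` (prim_mats 1 :: ('f^2^2) set))" by (rule image_compactin[OF _ continuous_map_pgl])
  moreover have "\<forall>K. compactin PGL2_topology K \<longrightarrow> emeasure MG K < \<infinity>" using haar_G by (simp add: haar_measure_def)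
  ultimately have "emeasure MG (pgl ` (prim_mats 1 :: ('f^2^2) set)) < \<infinity>" by blast
  moreover have "emeasure MG (pgl ` iwahori a J) \<le> emeasure MG (pgl ` (prim_mats 1 :: ('f^2^2) set))"
    using iwahori_prim_mats[OF assms] openin_sets_MG[OF openin_pgl_image[OF open_prim_mats sub]]
    by (intro emeasure_mono image_mono subsetI) auto
  ultimately show ?thesis by (rule le_less_trans[rotated])
qed

text \<open>Left translation by upper unipotent matrices with entry \<open>s\<close> shifts the
  normalised upper right entry by \<open>s\<close> modulo the ideal of exponent
  \<open>J + 1\<close>. The q representatives \<open>s\<close> therefore give a partition into
  translates, and left invariance suffices.\<close>

lemma emeasure_iwahori_split:
  assumes a: "1 \<le> a" and J: "0 \<le> J"
  shows "emeasure MG (pgl ` iwahori a J) = of_nat (residue_card TYPE('f)) * emeasure MG (pgl ` iwahori a (J + 1))"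
proof -
  obtain R :: "'f set" where R: "reps J (J + 1) R" "card R = residue_card TYPE('f)" using ex_reps_1 by blast
  define X where "X = pgl ` (iwahori a (J + 1) :: ('f^2^2) set)"
  have X: "openin PGL2_topology X" unfolding X_def
    using iwahori_det[of a "J + 1"] a J by (intro openin_pgl_image open_iwahori) auto
  define T where "T s = (\<lambda>u. pgl (mat2 1 s 0 1) \<otimes>\<^bsub>PGL2\<^esub> u) ` X" for s :: 'f
  have T_open: "openin PGL2_topology (T s)" for s
    unfolding T_def by (rule openin_mult_image[OF X]) simp
  have T_meas: "emeasure MG (T s) = emeasure MG X" for s
    unfolding T_def by (rule emeasure_MG_translate[OF _ openin_sets_MG[OF X]]) simp
  have T_iff: "pgl B \<in> T s \<longleftrightarrow> pgl B \<in> pgl ` iwahori a J \<and> B $ 1 $ 2 / B $ 1 $ 1 - s \<in> fideal (J + 1)"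
    if s: "s \<in> fideal J" for B s
  proof -
    \<comment> \<open>After division by the upper left entry the matrix has the entries 1,
      \<open>z\<close>, \<open>t\<close>, \<open>d\<close>; \<open>w\<close> is the entry of the
      unipotent. \<open>1 \<le> a\<close> makes the errors fall into the next ideal.\<close>
    have calc: "1 + w * t \<noteq> 0 \<and> t / (1 + w * t) \<in> fideal a \<and> d / (1 + w * t) - 1 \<in> fideal a \<and>
        (z + w * d) / (1 + w * t) - (z + w) \<in> fideal (J + 1)"
      if h: "z \<in> fideal J" "t \<in> fideal a" "d - 1 \<in> fideal a" "w \<in> fideal J" for z t d w :: 'f
    proof -
      have wt: "w * t \<in> fideal (J + a)" using fideal_mult[OF h(4,2)] by simp
      have wt': "w * t \<in> fideal a" "w * t \<in> fideal (J + 1)" using fideal_mono[OF wt] a J by auto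
      have u: "1 + w * t \<noteq> 0" "val (1 + w * t) = 0" using one_unit[of "1 + w * t" a] wt' a by auto
      have "d / (1 + w * t) - 1 = (d - 1 - w * t) / (1 + w * t)" using u by (simp add: field_simps)
      moreover have "(z + w * d) / (1 + w * t) - (z + w) = (w * (d - 1) - (z + w) * (w * t)) / (1 + w * t)"
        using u by (simp add: field_simps)
      moreover have "w * (d - 1) \<in> fideal (J + 1)" using fideal_mult[OF h(4,3), of "J + 1"] a by simp
      moreover have "(z + w) * (w * t) \<in> fideal (J + 1)"
        using fideal_mult[OF fideal_add[OF h(1,4)] wt'(2), of "J + 1"] J by simp
      ultimately show ?thesis using u h wt' by (simp add: fideal_divide_iff fideal_diff)
    qed
    have calc': "pgl (mat2 1 w 0 1 ** C) \<in> pgl ` iwahori a J \<and>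
        (mat2 1 w 0 1 ** C) $ 1 $ 2 / (mat2 1 w 0 1 ** C) $ 1 $ 1 - (C $ 1 $ 2 / C $ 1 $ 1 + w) \<in> fideal (J + 1)"
      if C: "pgl C \<in> pgl ` iwahori a J" and w: "w \<in> fideal J" for C :: "'f^2^2" and w
    proof -
      obtain p q r v where C': "C = mat2 p q r v" by (cases C rule: mat2_cases)
      have h: "p \<noteq> 0" "q / p \<in> fideal J" "r / p \<in> fideal a" "v / p - 1 \<in> fideal a"
        using C unfolding pgl_iwahori_iff[OF a] by (auto simp: C')
      note c = calc[OF h(2-) w]
      have e: "p + w * r = p * (1 + w * (r / p))" "q + w * v = p * (q / p + w * (v / p))" using h(1) by (simp_all add: field_simps)
      have 1: "(q + w * v) / (p + w * r) = (q / p + w * (v / p)) / (1 + w * (r / p))"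
        "r / (p + w * r) = (r / p) / (1 + w * (r / p))" "v / (p + w * r) = (v / p) / (1 + w * (r / p))"
        unfolding e using h(1) by simp_all
      have 2: "(q / p + w * (v / p)) / (1 + w * (r / p)) \<in> fideal J"
      proof -
        have "(q / p + w * (v / p)) / (1 + w * (r / p)) - (q / p + w) \<in> fideal J"
          by (rule fideal_mono[of _ "J + 1"]) (use c in blast, simp)
        from fideal_add[OF this fideal_add[OF h(2) w]] show ?thesis by simp
      qed
      have 3: "p + w * r \<noteq> 0" unfolding e using h(1) c by simp
      show ?thesis unfolding pgl_iwahori_iff[OF a] using c 2 3 by (simp add: C' 1)
    qed
    have mono: "pgl C \<in> pgl ` iwahori a J" if "pgl C \<in> X" for C
      using that unfolding X_def pgl_iwahori_iff[OF a] by (auto intro: fideal_mono)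
    have Xiff: "pgl C \<in> X \<longleftrightarrow> pgl C \<in> pgl ` iwahori a J \<and> C $ 1 $ 2 / C $ 1 $ 1 \<in> fideal (J + 1)" for C
      unfolding X_def pgl_iwahori_iff[OF a] by (auto intro: fideal_mono)
    have id: "mat2 1 s 0 1 ** (mat2 1 (- s) 0 1 ** C) = C" "mat2 1 (- s) 0 1 ** (mat2 1 s 0 1 ** C) = C" for C :: "'f^2^2"
      by (simp_all add: matrix_mul_assoc flip: mat_eq_mat2)
    have Tm: "pgl B \<in> T s \<longleftrightarrow> pgl (mat2 1 (- s) 0 1 ** B) \<in> X"
    proof
      assume "pgl B \<in> T s"
      then obtain C where "C \<in> iwahori a (J + 1)" "pgl B = pgl (mat2 1 s 0 1) \<otimes>\<^bsub>PGL2\<^esub> pgl C"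
        unfolding T_def X_def by blast
      then have C: "pgl C \<in> X" "pgl B = pgl (mat2 1 s 0 1 ** C)" by (simp_all add: X_def)
      then obtain c where "c \<noteq> 0" "B = mat c ** (mat2 1 s 0 1 ** C)" by (metis pgl_eq_iff)
      then have "mat2 1 (- s) 0 1 ** B = mat c ** C" using id(2)[of C] by (metis mat_commute matrix_mul_assoc)
      then show "pgl (mat2 1 (- s) 0 1 ** B) \<in> X" using C \<open>c \<noteq> 0\<close> by (simp add: pgl_scale)
    next
      assume "pgl (mat2 1 (- s) 0 1 ** B) \<in> X"
      then have "pgl (mat2 1 s 0 1) \<otimes>\<^bsub>PGL2\<^esub> pgl (mat2 1 (- s) 0 1 ** B) \<in> T s" unfolding T_def by blast
      then show "pgl B \<in> T s" by (simp add: id)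
    qed
    define C where "C = mat2 1 (- s) 0 1 ** B"
    have B: "B = mat2 1 s 0 1 ** C" by (simp add: C_def id)
    have s': "- s \<in> fideal J" using s by simp
    have eqv: "pgl C \<in> pgl ` iwahori a J \<longleftrightarrow> pgl B \<in> pgl ` iwahori a J"
    proof
      assume "pgl C \<in> pgl ` iwahori a J"
      from conjunct1[OF calc'[OF this s]] show "pgl B \<in> pgl ` iwahori a J" unfolding B[symmetric] .
    next
      assume "pgl B \<in> pgl ` iwahori a J"
      from conjunct1[OF calc'[OF this s']] show "pgl C \<in> pgl ` iwahori a J" unfolding C_def[symmetric] .
    qed
    have "C $ 1 $ 2 / C $ 1 $ 1 - (B $ 1 $ 2 / B $ 1 $ 1 - s) \<in> fideal (J + 1)" if "pgl B \<in> pgl ` iwahori a J"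
      using conjunct2[OF calc'[OF that s']] unfolding C_def[symmetric] by simp
    then have "C $ 1 $ 2 / C $ 1 $ 1 \<in> fideal (J + 1) \<longleftrightarrow> B $ 1 $ 2 / B $ 1 $ 1 - s \<in> fideal (J + 1)"
      if "pgl B \<in> pgl ` iwahori a J"
      using that fideal_add[of "C $ 1 $ 2 / C $ 1 $ 1 - (B $ 1 $ 2 / B $ 1 $ 1 - s)" "J + 1" "B $ 1 $ 2 / B $ 1 $ 1 - s"]
        fideal_diff[of "C $ 1 $ 2 / C $ 1 $ 1" "J + 1" "C $ 1 $ 2 / C $ 1 $ 1 - (B $ 1 $ 2 / B $ 1 $ 1 - s)"] by auto
    then show ?thesis unfolding Tm C_def[symmetric] Xiff using eqv by blast
  qed
  have "pgl ` iwahori a J = (\<Union>s\<in>R. T s)"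
  proof (intro equalityI subsetI)
    fix g assume g: "g \<in> pgl ` (iwahori a J :: ('f^2^2) set)"
    then obtain B where B: "g = pgl B" "pgl B \<in> pgl ` iwahori a J" by auto
    then have "B $ 1 $ 2 / B $ 1 $ 1 \<in> fideal J" unfolding pgl_iwahori_iff[OF a] by simp
    from repsE[OF R(1) this] obtain s where "s \<in> R" "s \<in> fideal J" "B $ 1 $ 2 / B $ 1 $ 1 - s \<in> fideal (J + 1)" by metis
    then show "g \<in> (\<Union>s\<in>R. T s)" using B T_iff by auto
  next
    fix g assume "g \<in> (\<Union>s\<in>R. T s)"
    then obtain s where s: "s \<in> R" "g \<in> T s" by auto
    then obtain B where "g = pgl B" using openin_subset[OF T_open[of s]] by (auto simp: carrier_PGL2)
    then show "g \<in> pgl ` iwahori a J" using s T_iff[OF reps_subset[OF R(1) s(1)]] by simp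
  qed
  moreover have "disjoint_family_on T R" unfolding disjoint_family_on_def
  proof (intro ballI impI)
    fix s s' assume ss: "s \<in> R" "s' \<in> R" "s \<noteq> s'"
    show "T s \<inter> T s' = {}"
    proof (rule ccontr)
      assume "T s \<inter> T s' \<noteq> {}"
      then obtain g where g: "g \<in> T s" "g \<in> T s'" by blast
      then obtain B where B: "g = pgl B" using openin_subset[OF T_open[of s]] by (auto simp: carrier_PGL2)
      have "B $ 1 $ 2 / B $ 1 $ 1 \<in> fideal J"
        using g B T_iff[OF reps_subset[OF R(1) ss(1)], of B] unfolding pgl_iwahori_iff[OF a] by simp
      moreover have "B $ 1 $ 2 / B $ 1 $ 1 - s \<in> fideal (J + 1)" "B $ 1 $ 2 / B $ 1 $ 1 - s' \<in> fideal (J + 1)"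
        using g B T_iff[OF reps_subset[OF R(1) ss(1)], of B] T_iff[OF reps_subset[OF R(1) ss(2)], of B] by auto
      ultimately show False using repsE[OF R(1)] ss by metis
    qed
  qed
  ultimately have "emeasure MG (pgl ` iwahori a J) = (\<Sum>s\<in>R. emeasure MG (T s))"
    using reps_finite[OF R(1)] openin_sets_MG[OF T_open] by (simp add: sum_emeasure[symmetric] image_subset_iff)
  then show ?thesis using R(2) by (simp add: T_meas X_def)
qed

lemma measure_iwahori:
  assumes a: "1 \<le> a" and J: "0 \<le> J"
  shows "measure MG (pgl ` iwahori a J) = measure MG (pgl ` iwahori a 0) * rq TYPE('f) powi (- J)"
  using J
proof (induction J rule: int_ge_induct)
  case (step J)
  have q: "rq TYPE('f) \<noteq> 0" using rq_gt_1[where 'f='f] by linarith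
  have "measure MG (pgl ` iwahori a J) = rq TYPE('f) * measure MG (pgl ` iwahori a (J + 1))"
    using emeasure_iwahori_split[OF a step.hyps] by (simp add: measure_def enn2real_mult)
  moreover have "rq TYPE('f) powi (- J) = rq TYPE('f) * rq TYPE('f) powi (- (J + 1))"
    using power_int_add_1[of "rq TYPE('f)" "- (J + 1)"] q by simp
  ultimately show ?case using step.IH q by simp
qed simp

lemma space_N: "space N = coset_of ` {A. det A \<noteq> 0}"
  using quotient unfolding quotient_measure_def borel_measure_on_def
  by (auto simp: coset_of_def carrier_PGL2)

lemma coset_of_sets_N:
  assumes "open S" "S \<subseteq> {A. det A \<noteq> 0}"
  shows "coset_of ` S \<in> sets N"
proof -
  let ?q = "\<lambda>g. torus #>\<^bsub>PGL2\<^esub> g"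
  have "{g \<in> topspace PGL2_topology. ?q g \<in> coset_of ` S} = (\<Union>t\<in>- {0}. \<Union>t'\<in>- {0}. (\<lambda>u. pgl (mat2 t 0 0 t') \<otimes>\<^bsub>PGL2\<^esub> u) ` pgl ` S)"
  proof (intro equalityI subsetI)
    fix g assume "g \<in> {g \<in> topspace PGL2_topology. ?q g \<in> coset_of ` S}"
    then obtain A B where "g = pgl B" "A \<in> S" "coset_of A = coset_of B" by (auto simp: carrier_PGL2 coset_of_def)
    then obtain t t' where "t \<noteq> 0" "t' \<noteq> 0" "g = pgl (mat2 t 0 0 t') \<otimes>\<^bsub>PGL2\<^esub> pgl A" "A \<in> S" by (auto simp: coset_of_eq_iff)
    then show "g \<in> (\<Union>t\<in>- {0}. \<Union>t'\<in>- {0}. (\<lambda>u. pgl (mat2 t 0 0 t') \<otimes>\<^bsub>PGL2\<^esub> u) ` pgl ` S)" by blast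
  next
    fix g assume "g \<in> (\<Union>t\<in>- {0}. \<Union>t'\<in>- {0}. (\<lambda>u. pgl (mat2 t 0 0 t') \<otimes>\<^bsub>PGL2\<^esub> u) ` pgl ` S)"
    then obtain t t' A where t: "t \<noteq> 0" "t' \<noteq> 0" "g = pgl (mat2 t 0 0 t') \<otimes>\<^bsub>PGL2\<^esub> pgl A" "A \<in> S" by blast
    then have t: "t \<noteq> 0" "t' \<noteq> 0" "g = pgl (mat2 t 0 0 t' ** A)" "A \<in> S" by auto
    have "det (mat2 t 0 0 t' ** A) \<noteq> 0" using t assms by (auto simp: det_mul)
    moreover have "?q g = coset_of A" using t coset_of_scale[OF t(1,2), of A] by (simp add: coset_of_def)
    ultimately show "g \<in> {g \<in> topspace PGL2_topology. ?q g \<in> coset_of ` S}" using t by simp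
  qed
  moreover have "openin PGL2_topology (\<Union>t\<in>- {0}. \<Union>t'\<in>- {0}. (\<lambda>u. pgl (mat2 t 0 0 t') \<otimes>\<^bsub>PGL2\<^esub> u) ` pgl ` S)"
    by (intro openin_clauses(3) ballI openin_Union) (auto intro!: openin_mult_image[OF openin_pgl_image[OF assms]])
  moreover have "coset_of ` S \<subseteq> ?q ` topspace PGL2_topology" using assms by (auto simp: coset_of_def carrier_PGL2)
  ultimately have "openin (quotient_topology PGL2_topology ?q) (coset_of ` S)" by (simp add: openin_quotient_topology)
  then show ?thesis using quotient by (auto simp: quotient_measure_def borel_measure_on_def intro: sigma_sets.Basic)
qed

lemma openin_torus_hits:
  assumes S: "open S" "S \<subseteq> {A. det A \<noteq> 0}"
  shows "openin torus_topology {h \<in> torus. h \<otimes>\<^bsub>PGL2\<^esub> pgl B \<in> pgl ` S}"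
proof (cases "det B = 0")
  case True
  have "\<not> h \<otimes>\<^bsub>PGL2\<^esub> pgl B \<in> pgl ` S" if h: "h \<in> torus" for h
  proof
    assume "h \<otimes>\<^bsub>PGL2\<^esub> pgl B \<in> pgl ` S"
    moreover obtain t where "t \<noteq> 0" "h = pdiag t" using torusE[OF h] .
    ultimately obtain A where "A \<in> S" "pgl (mat2 t 0 0 1 ** B) = pgl A" by (auto simp: pdiag_def)
    then obtain c where "c \<noteq> 0" "A = mat c ** (mat2 t 0 0 1 ** B)" "A \<in> S" by (metis pgl_eq_iff)
    then show False using S True by (auto simp: det_mul)
  qed
  then have *: "{h \<in> torus. h \<otimes>\<^bsub>PGL2\<^esub> pgl B \<in> pgl ` S} = {}" by blast
  show ?thesis unfolding * by (rule openin_empty)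
next
  case False
  have op: "open {A. det A \<noteq> 0 \<and> pgl A \<in> pgl ` S}" using openin_pgl_image[OF S] by (simp add: openin_PGL2)
  have "{t. t \<noteq> 0 \<and> pdiag t \<in> {h \<in> torus. h \<otimes>\<^bsub>PGL2\<^esub> pgl B \<in> pgl ` S}} =
      {t. mat2 t 0 0 1 \<in> {C. C ** B \<in> {A. det A \<noteq> 0 \<and> pgl A \<in> pgl ` S}}}"
    using False by (auto simp: pdiag_def det_mul simp flip: pdiag_def) (auto simp: pdiag_def)
  then show ?thesis unfolding openin_torus_iff using open_diag_vimage[OF open_mult_vimage(2)[OF op]] by auto
qed

text \<open>The defining identity of the quotient measure, applied to an indicator function. The
  inner integral is the volume of the torus elements that keep a point of \<open>S\<close> in the
  image of \<open>S\<close>; if it is constant on \<open>S\<close>, the volume of the coset set is a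
  quotient of two volumes.\<close>

lemma emeasure_quotient:
  assumes S: "open S" "S \<subseteq> {A. det A \<noteq> 0}"
    and m: "\<And>A. A \<in> S \<Longrightarrow> emeasure MT {h \<in> torus. h \<otimes>\<^bsub>PGL2\<^esub> pgl A \<in> pgl ` S} = m"
  shows "m * emeasure N (coset_of ` S) = emeasure MG (pgl ` S)"
proof -
  let ?X = "pgl ` S"
  define H where "H g = {h \<in> torus. h \<otimes>\<^bsub>PGL2\<^esub> g \<in> ?X}" for g
  define G where "G g = (\<integral>\<^sup>+ h. indicator ?X (h \<otimes>\<^bsub>PGL2\<^esub> g) \<partial>MT)" for g
  have H_sets: "H (pgl B) \<in> sets MT" for B unfolding H_def by (rule openin_sets_MT[OF openin_torus_hits[OF S]])
  have G: "G (pgl B) = emeasure MT (H (pgl B))" for B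
  proof -
    have "G (pgl B) = (\<integral>\<^sup>+ h. indicator (H (pgl B)) h \<partial>MT)" unfolding G_def
      by (rule nn_integral_cong) (auto simp: H_def space_MT indicator_def)
    then show ?thesis using H_sets by simp
  qed
  \<comment> \<open>\<open>coset_fun\<close> returns the common value of a function on a coset, so
    constancy of the inner integral must come first; it is invariance of the torus measure.\<close>
  have Ginv: "G (pgl (mat2 s 0 0 s' ** B)) = G (pgl B)" if s: "s \<noteq> 0" "s' \<noteq> 0" for s s' B
  proof -
    have e: "pdiag t \<otimes>\<^bsub>PGL2\<^esub> pgl (mat2 s 0 0 s' ** B) = pdiag (s / s' * t) \<otimes>\<^bsub>PGL2\<^esub> pgl B" for t
    proof -
      have "pdiag t \<otimes>\<^bsub>PGL2\<^esub> pgl (mat2 s 0 0 s' ** B) = pgl (mat2 t 0 0 1 ** mat2 s 0 0 s') \<otimes>\<^bsub>PGL2\<^esub> pgl B"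
        by (simp only: pdiag_def pgl_mult matrix_mul_assoc)
      also have "pgl (mat2 t 0 0 1 ** mat2 s 0 0 s') = pdiag (s / s' * t)"
      proof (cases "t = 0")
        case False
        then show ?thesis using s pgl_diag[of "t * s" s'] by (simp add: field_simps)
      next
        case True
        have "mat2 0 0 0 s' = mat s' ** mat2 0 0 0 1" by (simp add: mat_mult_mat2)
        then show ?thesis using True pgl_scale[OF s(2), of "mat2 0 0 0 1"] by (simp add: pdiag_def)
      qed
      finally show ?thesis .
    qed
    have "H (pgl B) = (\<lambda>h. pdiag (s / s') \<otimes>\<^bsub>PGL2\<^esub> h) ` H (pgl (mat2 s 0 0 s' ** B))"
    proof (intro equalityI subsetI)
      fix h assume h: "h \<in> H (pgl B)"
      then obtain t where t: "t \<noteq> 0" "h = pdiag t" using torusE unfolding H_def by blast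
      have "s / s' * (s' / s * t) = t" using s by simp
      then have "pdiag (s' / s * t) \<in> H (pgl (mat2 s 0 0 s' ** B))" "h = pdiag (s / s') \<otimes>\<^bsub>PGL2\<^esub> pdiag (s' / s * t)"
        using h t s e[of "s' / s * t"] by (auto simp: H_def pdiag_mult)
      then show "h \<in> (\<lambda>h. pdiag (s / s') \<otimes>\<^bsub>PGL2\<^esub> h) ` H (pgl (mat2 s 0 0 s' ** B))" by blast
    next
      fix h assume "h \<in> (\<lambda>h. pdiag (s / s') \<otimes>\<^bsub>PGL2\<^esub> h) ` H (pgl (mat2 s 0 0 s' ** B))"
      then obtain h' where h': "h = pdiag (s / s') \<otimes>\<^bsub>PGL2\<^esub> h'" "h' \<in> torus" "h' \<otimes>\<^bsub>PGL2\<^esub> pgl (mat2 s 0 0 s' ** B) \<in> ?X"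
        unfolding H_def by blast
      moreover obtain t where "t \<noteq> 0" "h' = pdiag t" using torusE[OF h'(2)] .
      ultimately have "t \<noteq> 0" "h = pdiag (s / s' * t)" "pdiag t \<otimes>\<^bsub>PGL2\<^esub> pgl (mat2 s 0 0 s' ** B) \<in> ?X"
        by (auto simp: pdiag_mult)
      then show "h \<in> H (pgl B)" using s e[of t] by (auto simp: H_def)
    qed
    then show ?thesis using emeasure_translate[OF _ H_sets, of "s / s'" "mat2 s 0 0 s' ** B"] s by (simp add: G)
  qed
  have val: "coset_fun G (coset_of B) = m * indicator (coset_of ` S) (coset_of B)" for B
  proof -
    have 1: "coset_fun G (coset_of B) = G (pgl B)" by (rule coset_fun_coset_of) (rule Ginv)
    show ?thesis
    proof (cases "coset_of B \<in> coset_of ` S")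
      case True
      then obtain A where "A \<in> S" "coset_of A = coset_of B" by auto
      then obtain s s' where A: "A \<in> S" "s \<noteq> 0" "s' \<noteq> 0" "B = mat2 s 0 0 s' ** A" by (auto simp: coset_of_eq_iff)
      have "G (pgl B) = m" using Ginv[OF A(2,3)] m[OF A(1)] A(4) by (simp add: G H_def)
      then show ?thesis using 1 True by simp
    next
      case False
      have "H (pgl B) = {}"
      proof (rule ccontr)
        assume "H (pgl B) \<noteq> {}"
        then obtain h where h: "h \<in> torus" "h \<otimes>\<^bsub>PGL2\<^esub> pgl B \<in> ?X" unfolding H_def by blast
        moreover obtain t where "t \<noteq> 0" "h = pdiag t" using torusE[OF h(1)] .
        ultimately obtain A where t: "t \<noteq> 0" "A \<in> S" "pgl (mat2 t 0 0 1 ** B) = pgl A" by (auto simp: pdiag_def)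
        have "coset_of B = coset_of A" using coset_of_pgl[OF t(3)] coset_of_scale[OF t(1), of 1 B] by simp
        then show False using False t by blast
      qed
      then show ?thesis using 1 False by (simp add: G)
    qed
  qed
  have X: "?X \<in> sets MG" by (rule openin_sets_MG[OF openin_pgl_image[OF S]])
  have "(\<integral>\<^sup>+ g. indicator ?X g \<partial>MG) = (\<integral>\<^sup>+ Y. coset_fun (\<lambda>y. \<integral>\<^sup>+ h. indicator ?X (h \<otimes>\<^bsub>PGL2\<^esub> y) \<partial>MT) Y \<partial>N)"
  proof -
    have "\<forall>f \<in> borel_measurable MG. (\<integral>\<^sup>+ g. f g \<partial>MG) =
        (\<integral>\<^sup>+ Y. coset_fun (\<lambda>y. \<integral>\<^sup>+ h. f (h \<otimes>\<^bsub>PGL2\<^esub> y) \<partial>MT) Y \<partial>N)"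
      using quotient by (simp add: quotient_measure_def)
    then show ?thesis using borel_measurable_indicator[OF X] by (rule bspec)
  qed
  also have "\<dots> = (\<integral>\<^sup>+ Y. m * indicator (coset_of ` S) Y \<partial>N)"
    unfolding G_def[symmetric] by (rule nn_integral_cong) (auto simp: space_N val)
  also have "\<dots> = m * emeasure N (coset_of ` S)" using coset_of_sets_N[OF S] by (rule nn_integral_cmult_indicator)
  finally show ?thesis using X by simp
qed

end

section \<open>Double cosets and their stabilisers in the torus\<close>

lemma open_cong_subgroup: "open (cong_subgroup M)"
  by (simp add: cong_subgroup_iwahori open_iwahori)

lemma open_kcoset: "det A \<noteq> 0 \<Longrightarrow> open (kcoset A M)"
  unfolding kcoset_def by (rule open_left_image[OF _ open_cong_subgroup])

lemma kcoset_nonsingular: "det A \<noteq> 0 \<Longrightarrow> 1 \<le> M \<Longrightarrow> kcoset A M \<subseteq> {A. det A \<noteq> 0}"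
proof
  fix B assume "det A \<noteq> 0" "1 \<le> M" "B \<in> kcoset A M"
  moreover from this obtain k where "k \<in> cong_subgroup M" "B = A ** k" by (auto simp: kcoset_def)
  ultimately show "B \<in> {A. det A \<noteq> 0}" using cong_subgroup_det(2)[of k M] by (simp add: det_mul)
qed

lemma pgl_right_cancel:
  fixes C E :: "'f::field^2^2"
  assumes "det k \<noteq> 0"
  shows "pgl (C ** k) = pgl (E ** k) \<longleftrightarrow> pgl C = pgl E"
proof
  assume "pgl C = pgl E"
  then show "pgl (C ** k) = pgl (E ** k)" unfolding pgl_eq_iff by (metis matrix_mul_assoc)
next
  have id: "B ** k ** inv2 k = B" for B :: "'f^2^2" using inv2(1)[OF assms] by (simp flip: matrix_mul_assoc)
  assume "pgl (C ** k) = pgl (E ** k)"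
  then obtain c where c: "c \<noteq> 0" "E ** k = mat c ** (C ** k)" by (auto simp: pgl_eq_iff)
  have "E = mat c ** C ** k ** inv2 k" by (metis c(2) id matrix_mul_assoc)
  then have "E = mat c ** C" by (simp only: id)
  then show "pgl C = pgl E" unfolding pgl_eq_iff using c(1) by blast
qed

lemma pgl_kcoset_mult:
  assumes "k \<in> cong_subgroup M" "1 \<le> M"
  shows "pgl (C ** k) \<in> pgl ` kcoset A M \<longleftrightarrow> pgl C \<in> pgl ` kcoset A M"
proof -
  note d = cong_subgroup_det(2)[OF assms]
  have id: "B ** inv2 k ** k = B" for B using inv2(2)[OF d] by (simp flip: matrix_mul_assoc)
  show ?thesis
  proof
    assume "pgl C \<in> pgl ` kcoset A M"
    then obtain E where E: "E \<in> kcoset A M" "pgl C = pgl E" by auto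
    then have "pgl (C ** k) = pgl (E ** k)" by (simp add: pgl_right_cancel[OF d])
    then show "pgl (C ** k) \<in> pgl ` kcoset A M" using kcoset_mult[OF E(1) assms] by blast
  next
    assume "pgl (C ** k) \<in> pgl ` kcoset A M"
    then obtain E where "E \<in> kcoset A M" "pgl (C ** k) = pgl E" by auto
    then have E: "E \<in> kcoset A M" "pgl (C ** k) = pgl (E ** inv2 k ** k)" by (simp_all add: id)
    then have "pgl C = pgl (E ** inv2 k)" using pgl_right_cancel[OF d] by blast
    then show "pgl C \<in> pgl ` kcoset A M" using kcoset_mult[OF E(1) cong_subgroup_inv[OF assms] assms(2)] by blast
  qed
qed

text \<open>The intersection, in PGL(2), of the torus with \<open>A K_M A^-1\<close>: the
  denominator in the volume of a double coset.\<close>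

definition torus_hits :: "'f::nonarch_local_field^2^2 \<Rightarrow> int \<Rightarrow> ('f^2^2) set set"
  where "torus_hits A M = {h \<in> torus. h \<otimes>\<^bsub>PGL2\<^esub> pgl A \<in> pgl ` kcoset A M}"

lemma torus_hits_eq:
  assumes "B \<in> kcoset A M" "1 \<le> M"
  shows "{h \<in> torus. h \<otimes>\<^bsub>PGL2\<^esub> pgl B \<in> pgl ` kcoset A M} = torus_hits A M"
proof -
  obtain k where k: "k \<in> cong_subgroup M" "B = A ** k" using assms by (auto simp: kcoset_def)
  have "h \<otimes>\<^bsub>PGL2\<^esub> pgl B \<in> pgl ` kcoset A M \<longleftrightarrow> h \<otimes>\<^bsub>PGL2\<^esub> pgl A \<in> pgl ` kcoset A M" if h: "h \<in> torus" for h
  proof -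
    obtain t where "h = pdiag t" using torusE[OF h] .
    then show ?thesis using pgl_kcoset_mult[OF k(1) assms(2), of "mat2 t 0 0 1 ** A" A]
      by (simp add: pdiag_def k(2) matrix_mul_assoc)
  qed
  then show ?thesis unfolding torus_hits_def by blast
qed

lemma torus_hits_right:
  assumes k: "integral_mat k"
  shows "torus_hits (A ** k) M = torus_hits A M"
proof -
  have d: "det k \<noteq> 0" using k by (simp add: integral_mat_def)
  have "h \<otimes>\<^bsub>PGL2\<^esub> pgl (A ** k) \<in> pgl ` kcoset (A ** k) M \<longleftrightarrow> h \<otimes>\<^bsub>PGL2\<^esub> pgl A \<in> pgl ` kcoset A M" if h: "h \<in> torus" for h
  proof -
    obtain t where t: "h = pdiag t" using torusE[OF h] .
    define C where "C = mat2 t 0 0 1 ** A"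
    have "pgl (C ** k) \<in> pgl ` kcoset (A ** k) M \<longleftrightarrow> (\<exists>E\<in>kcoset A M. pgl (C ** k) = pgl (E ** k))"
      unfolding kcoset_right[OF k, symmetric] by auto
    also have "\<dots> \<longleftrightarrow> pgl C \<in> pgl ` kcoset A M" unfolding pgl_right_cancel[OF d] by auto
    finally show ?thesis by (simp add: t pdiag_def C_def matrix_mul_assoc)
  qed
  then show ?thesis unfolding torus_hits_def by blast
qed

text \<open>The denominators of \<open>A^-1\<close> cost less than \<open>e\<close>, so
  \<open>A K_M A^-1\<close> lies in the congruence subgroup of level 1; a diagonal class in it has a
  principal unit as coordinate. Its torus volume is therefore finite.\<close>

lemma torus_hits_subset:
  assumes A: "A \<in> prim_mats e" and M: "e \<le> M"
  shows "torus_hits A M \<subseteq> torus_ball 1 1"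
proof
  fix h assume h: "h \<in> torus_hits A M"
  then have "h \<in> torus" by (simp add: torus_hits_def)
  then obtain t where t: "t \<noteq> 0" "h = pdiag t" by (rule torusE)
  have d: "det A \<noteq> 0" "val (det A) < e" using A by (auto simp: prim_mats_def fideal_def)
  have "pgl (mat2 t 0 0 1 ** A) \<in> pgl ` kcoset A M" using h t by (simp add: torus_hits_def pdiag_def)
  then obtain k where k: "k \<in> cong_subgroup M" "pgl (mat2 t 0 0 1 ** A) = pgl (A ** k)" by (auto simp: kcoset_def)
  then obtain c where c: "c \<noteq> 0" "A ** k = mat c ** (mat2 t 0 0 1 ** A)" by (metis pgl_eq_iff)
  have "A ** k ** inv2 A = mat c ** mat2 t 0 0 1"
    unfolding c(2) using inv2(1)[OF d(1)] by (simp flip: matrix_mul_assoc)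
  moreover have "A ** k ** inv2 A \<in> cong_subgroup 1"
  proof (rule cong_subgroup_conj[OF _ _ inv2(1)[OF d(1)] k(1)])
    show "A $ m $ n \<in> fideal 0" for m n using A by (simp add: prim_mats_def prim_rows_integral)
    then show "inv2 A $ m $ n \<in> fideal (- val (det A))" for m n
      using d exhaust_2[of m] exhaust_2[of n] by (auto simp: inv2_def fideal_divide_iff)
    show "1 \<le> M + 0 + - val (det A)" using M d by simp
  qed
  ultimately have "c * t - 1 \<in> fideal 1" "c - 1 \<in> fideal 1" by (auto simp: mat_mult_mat2)
  then have "inverse c * (c * t) - 1 \<in> fideal 1"
    by (intro one_unit_mult[where u = "inverse c" and w = "c * t"] one_unit_inverse) auto
  moreover have "inverse c * (c * t) = t" using c by simp
  ultimately show "h \<in> torus_ball 1 1" using t by (simp add: pdiag_torus_ball)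
qed

text \<open>Support and level reduce a function on the coset space to finitely many double cosets,
  by compactness of \<open>prim_mats e\<close>.\<close>

lemma section_decomposition:
  assumes F: "compact_section (\<lambda>_. 1) F"
  obtains M e D where "1 \<le> M" "e \<le> M" "finite D" "D \<subseteq> prim_mats e"
    "\<forall>B. det B \<noteq> 0 \<longrightarrow> (\<Sum>A\<in>D. if coset_of B \<in> coset_of ` kcoset A M then F A else 0) = F B"
proof -
  obtain M0 e where M0: "level M0 F" "support_bound e F" using F by (rule compact_sectionE)
  define M where "M = max M0 (max 1 e)"
  have M: "1 \<le> M" "e \<le> M" by (auto simp: M_def)
  have lev: "level M F" using level_mono[OF M0(1), of M] by (simp add: M_def)
  have inv: "F B = F A" if B: "coset_of B \<in> coset_of ` kcoset A M" for A B
  proof -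
    obtain E where "E \<in> kcoset A M" "coset_of E = coset_of B" using B by auto
    then obtain k s s' where "k \<in> cong_subgroup M" "s \<noteq> 0" "s' \<noteq> 0" "B = mat2 s 0 0 s' ** (A ** k)"
      by (auto simp: kcoset_def coset_of_eq_iff)
    then show ?thesis using compact_section_scale(1)[OF F, of s s' "A ** k"] levelD[OF lev, of k A] by simp
  qed
  have nz: "det A \<noteq> 0" if "A \<in> prim_mats e" for A :: "'a^2^2" using that by (auto simp: prim_mats_def)
  have cov: "prim_mats e \<subseteq> (\<Union>A\<in>prim_mats e. kcoset (A :: 'a^2^2) M)" using kcoset_self by blast
  obtain D where D: "finite D" "D \<subseteq> prim_mats e" "prim_mats e \<subseteq> (\<Union>A\<in>D. kcoset (A :: 'a^2^2) M)"
    by (rule compactE_image[OF compact_prim_mats open_kcoset[OF nz] cov])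
  \<comment> \<open>One representative is kept for each double coset; distinct double cosets are
    disjoint, so each point is counted once.\<close>
  obtain D' where D': "D' \<subseteq> D" "inj_on (\<lambda>A. coset_of ` kcoset A M) D'"
      "(\<lambda>A. coset_of ` kcoset A M) ` D = (\<lambda>A. coset_of ` kcoset A M) ` D'"
    using subset_image_inj[of "(\<lambda>A. coset_of ` kcoset A M) ` D" "\<lambda>A. coset_of ` kcoset A M" D] by auto
  have fin: "finite D'" by (rule finite_subset[OF D'(1) D(1)])
  show thesis
  proof (rule that[OF M fin])
    show "D' \<subseteq> prim_mats e" by (rule order_trans[OF D'(1) D(2)])
    show "\<forall>B. det B \<noteq> 0 \<longrightarrow> (\<Sum>A\<in>D'. if coset_of B \<in> coset_of ` kcoset A M then F A else 0) = F B"
    proof (intro allI impI)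
      fix B :: "'a^2^2" assume B: "det B \<noteq> 0"
      have uniq: "A = A'" if "A \<in> D'" "A' \<in> D'" "coset_of B \<in> coset_of ` kcoset A M" "coset_of B \<in> coset_of ` kcoset A' M" for A A'
        using double_coset_eq[OF that(3) M(1)] double_coset_eq[OF that(4) M(1)] D'(2) that(1,2) by (metis inj_onD)
      show "(\<Sum>A\<in>D'. if coset_of B \<in> coset_of ` kcoset A M then F A else 0) = F B"
      proof (cases "F B = 0")
        case True
        then have "(if coset_of B \<in> coset_of ` kcoset A M then F A else 0) = 0" for A
          using inv[of B A] by presburger
        then show ?thesis using True by (simp only: sum.neutral_const)
      next
        case False
        obtain s s' C where C: "s \<noteq> 0" "s' \<noteq> 0" "B = mat2 s 0 0 s' ** C" "prim_rows C" using prim_rows_ex[OF B] by metis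
        have "F C \<noteq> 0" using False C compact_section_scale(1)[OF F, of s s' C] by simp
        then have "C \<in> prim_mats e" using M0(2) C by (simp add: prim_mats_def support_bound_def)
        then obtain A where A: "A \<in> D" "C \<in> kcoset A M" using D by auto
        have "coset_of B = coset_of C" using C coset_of_scale by simp
        then have "coset_of B \<in> coset_of ` kcoset A M" using A by auto
        moreover have "coset_of ` kcoset A M \<in> (\<lambda>A. coset_of ` kcoset A M) ` D'"
          unfolding D'(3)[symmetric] using A(1) by (rule imageI)
        then obtain A' where A': "A' \<in> D'" "coset_of ` kcoset A M = coset_of ` kcoset A' M" by (rule imageE)
        ultimately have B': "coset_of B \<in> coset_of ` kcoset A' M" by simp
        have "(\<Sum>A\<in>D'. if coset_of B \<in> coset_of ` kcoset A M then F A else 0) = (\<Sum>A\<in>D'. if A = A' then F A' else 0)"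
        proof (rule sum.cong[OF refl])
          fix A assume A: "A \<in> D'"
          have "coset_of B \<in> coset_of ` kcoset A M \<longleftrightarrow> A = A'"
          proof
            assume "A = A'"
            then show "coset_of B \<in> coset_of ` kcoset A M" using B' by (simp only:)
          qed (rule uniq[OF A A'(1) _ B'])
          then show "(if coset_of B \<in> coset_of ` kcoset A M then F A else 0) = (if A = A' then F A' else 0)"
            by (simp only:) simp
        qed
        also have "\<dots> = F B" using fin A' inv[OF B'] by simp
        finally show ?thesis .
      qed
    qed
  qed
qed

lemma integral_mat_1: "integral_mat (mat 1 :: 'f::nonarch_local_field^2^2)"
proof -
  have "inv2 (mat 1 :: 'f^2^2) = mat 1" by (simp add: mat_eq_mat2 inv2_def)
  moreover have "(mat 1 :: 'f^2^2) $ i $ j \<in> fideal 0" for i j by (simp add: mat_def)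
  ultimately show ?thesis by (simp add: integral_mat_def)
qed

context quotient_haar begin

lemma emeasure_torus_hits:
  assumes A: "A \<in> prim_mats e" and M: "e \<le> M" "1 \<le> M"
  shows "0 < emeasure MT (torus_hits A M)" "emeasure MT (torus_hits A M) < \<infinity>"
proof -
  have d: "det A \<noteq> 0" using A by (auto simp: prim_mats_def)
  have op: "openin torus_topology (torus_hits A M)"
    unfolding torus_hits_def by (rule openin_torus_hits[OF open_kcoset[OF d] kcoset_nonsingular[OF d M(2)]])
  have "pdiag 1 \<in> torus_hits A M"
    using kcoset_self[of A M] by (auto simp: torus_hits_def pdiag_def simp flip: mat_eq_mat2 intro!: image_eqI[of _ _ A])
      (metis pdiag_def pdiag_torus mat_eq_mat2 one_neq_zero)
  then have "torus_hits A M \<noteq> {}" by blast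
  moreover have "\<forall>U. openin torus_topology U \<longrightarrow> U \<noteq> {} \<longrightarrow> 0 < emeasure MT U" using haar by (simp add: haar_measure_def)
  ultimately show "0 < emeasure MT (torus_hits A M)" using op by blast
  have "emeasure MT (torus_hits A M) \<le> emeasure MT (torus_ball 1 1)"
    using torus_hits_subset[OF A M(1)] by (intro emeasure_mono torus_ball_sets) auto
  then show "emeasure MT (torus_hits A M) < \<infinity>" using emeasure_torus_ball_finite[of 1 1] by (simp add: le_less_trans)
qed

text \<open>By left invariance all \<open>A K_M\<close> have the volume of \<open>K_M\<close>. So
  the volume of a double coset depends on \<open>A\<close> only through \<open>torus_hits\<close>,
  which is insensitive to integral right translation.\<close>

lemma emeasure_double_coset:
  assumes A: "det A \<noteq> 0" and M: "1 \<le> M"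
  shows "emeasure MT (torus_hits A M) * emeasure N (coset_of ` kcoset A M) = emeasure MG (pgl ` cong_subgroup M)"
proof -
  have "emeasure MT (torus_hits A M) * emeasure N (coset_of ` kcoset A M) = emeasure MG (pgl ` kcoset A M)"
    by (rule emeasure_quotient[OF open_kcoset[OF A] kcoset_nonsingular[OF A M]]) (simp add: torus_hits_eq[OF _ M])
  also have "\<dots> = emeasure MG (pgl ` cong_subgroup M)"
    unfolding kcoset_def using cong_subgroup_det(2)[OF _ M]
    by (intro emeasure_MG_left[OF A open_cong_subgroup]) auto
  finally show ?thesis .
qed

text \<open>The inner \<open>coset_fun\<close> passes from matrices to classes modulo scalars, the
  outer one from these to cosets of the torus.\<close>

definition qint :: "('f^2^2 \<Rightarrow> complex) \<Rightarrow> complex"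
  where "qint F = (\<integral>Y. coset_fun (coset_fun F) Y \<partial>N)"

lemma coset_fun_section:
  assumes "compact_section (\<lambda>_. 1) F"
  shows "coset_fun (coset_fun F) (coset_of A) = F A"
proof -
  have pg: "coset_fun F (pgl B) = F B" for B
    using compact_section_scale(1)[OF assms] by (intro coset_fun_pgl) (simp add: mat_eq_mat2)
  have "coset_fun (coset_fun F) (coset_of A) = coset_fun F (pgl A)"
    using compact_section_scale(1)[OF assms] by (intro coset_fun_coset_of) (simp add: pg)
  then show ?thesis by (simp add: pg)
qed

text \<open>The value does not mention \<open>k\<close>: translation by \<open>k\<close> replaces
  each double coset of \<open>A\<close> by that of \<open>A ** inv2 k\<close>, which has the same
  volume. Invariance and integrability both follow, the latter with
  \<open>k = mat 1\<close>.\<close>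

lemma has_qint_right:
  assumes F: "compact_section (\<lambda>_. 1) F" and k: "integral_mat k"
    and D: "1 \<le> M" "e \<le> M" "finite D" "D \<subseteq> prim_mats e"
    and dec: "\<forall>B. det B \<noteq> 0 \<longrightarrow> (\<Sum>A\<in>D. if coset_of B \<in> coset_of ` kcoset A M then F A else 0) = F B"
  shows "has_bochner_integral N (coset_fun (coset_fun (\<lambda>A. F (A ** k))))
    (\<Sum>A\<in>D. measure N (coset_of ` kcoset A M) *\<^sub>R F A)"
proof -
  have kd: "det k \<noteq> 0" using k by (simp add: integral_mat_def)
  have Fk: "compact_section (\<lambda>_. 1) (\<lambda>A. F (A ** k))" by (rule compact_section_right[OF F kd])
  have idk: "A ** inv2 k ** k = A" for A using inv2(2)[OF kd] by (simp flip: matrix_mul_assoc)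
  have idk': "A ** k ** inv2 k = A" for A using inv2(1)[OF kd] by (simp flip: matrix_mul_assoc)
  define W where "W A = coset_of ` kcoset (A ** inv2 k) M" for A
  have nz: "det A \<noteq> 0" "det (A ** inv2 k) \<noteq> 0" if "A \<in> D" for A
    using that D(4) kd by (auto simp: prim_mats_def det_mul det_inv2)
  have vol: "emeasure N (W A) = emeasure N (coset_of ` kcoset A M)" "emeasure N (W A) < \<infinity>" if A: "A \<in> D" for A
  proof -
    have hits: "torus_hits (A ** inv2 k) M = torus_hits A M"
      using torus_hits_right[OF k, of "A ** inv2 k" M] by (simp add: idk)
    have m: "0 < emeasure MT (torus_hits A M)" "emeasure MT (torus_hits A M) < \<infinity>"
      using emeasure_torus_hits[of A e M] A D by auto
    have e1: "emeasure MT (torus_hits A M) * emeasure N (W A) = emeasure MG (pgl ` cong_subgroup M)"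
      using emeasure_double_coset[OF nz(2)[OF A] D(1)] by (simp add: hits W_def)
    have e2: "emeasure MT (torus_hits A M) * emeasure N (coset_of ` kcoset A M) = emeasure MG (pgl ` cong_subgroup M)"
      by (rule emeasure_double_coset[OF nz(1)[OF A] D(1)])
    show "emeasure N (W A) = emeasure N (coset_of ` kcoset A M)"
      using e1 e2 m by (metis ennreal_mult_cancel_left infinity_ennreal_def less_irrefl)
    have "emeasure MG (pgl ` cong_subgroup M) < \<infinity>"
      using emeasure_MG_iwahori_finite[of M M] D(1) by (simp add: cong_subgroup_iwahori)
    then have "emeasure MT (torus_hits A M) * emeasure N (W A) < \<infinity>" using e1 by simp
    then show "emeasure N (W A) < \<infinity>" using m(1) by (auto simp: ennreal_mult_less_top)
  qed
  have "has_bochner_integral N (\<lambda>Y. \<Sum>A\<in>D. indicator (W A) Y *\<^sub>R F A) (\<Sum>A\<in>D. measure N (W A) *\<^sub>R F A)"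
  proof (intro has_bochner_integral_sum has_bochner_integral_indicator)
    fix A assume A: "A \<in> D"
    show "W A \<in> sets N" unfolding W_def
      by (rule coset_of_sets_N[OF open_kcoset[OF nz(2)[OF A]] kcoset_nonsingular[OF nz(2)[OF A] D(1)]])
    show "emeasure N (W A) < \<infinity>" by (rule vol(2)[OF A])
  qed
  moreover have "(\<Sum>A\<in>D. measure N (W A) *\<^sub>R F A) = (\<Sum>A\<in>D. measure N (coset_of ` kcoset A M) *\<^sub>R F A)"
    using vol(1) by (simp add: measure_def)
  moreover have "(\<Sum>A\<in>D. indicator (W A) Y *\<^sub>R F A) = coset_fun (coset_fun (\<lambda>A. F (A ** k))) Y" if Y: "Y \<in> space N" for Y
  proof -
    obtain B where B: "det B \<noteq> 0" "Y = coset_of B" using Y by (auto simp: space_N)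
    have eqv: "coset_of (B ** k) \<in> coset_of ` kcoset A M \<longleftrightarrow> Y \<in> W A" for A
    proof -
      have "kcoset A M = (\<lambda>B. B ** k) ` kcoset (A ** inv2 k) M" using kcoset_right[OF k, of "A ** inv2 k" M] by (simp add: idk)
      then have "coset_of (B ** k) \<in> coset_of ` kcoset A M \<longleftrightarrow> (\<exists>E\<in>kcoset (A ** inv2 k) M. coset_of (B ** k) = coset_of (E ** k))" by auto
      moreover have "coset_of (B ** k) = coset_of (E ** k) \<longleftrightarrow> coset_of B = coset_of E" for E
        using coset_of_left[of B E k] coset_of_left[of "B ** k" "E ** k" "inv2 k"] by (auto simp: idk')
      ultimately show ?thesis using B by (auto simp: W_def)
    qed
    have "(\<Sum>A\<in>D. indicator (W A) Y *\<^sub>R F A) = (\<Sum>A\<in>D. if coset_of (B ** k) \<in> coset_of ` kcoset A M then F A else 0)"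
      unfolding eqv by (intro sum.cong) (auto simp: indicator_def)
    also have "\<dots> = F (B ** k)" using B kd by (intro dec[rule_format]) (simp add: det_mul)
    also have "\<dots> = coset_fun (coset_fun (\<lambda>A. F (A ** k))) Y" using coset_fun_section[OF Fk, of B] B by simp
    finally show ?thesis .
  qed
  ultimately show ?thesis by (simp cong: has_bochner_integral_cong)
qed

lemma qint_right:
  assumes F: "compact_section (\<lambda>_. 1) F" and k: "integral_mat k"
  shows "qint (\<lambda>A. F (A ** k)) = qint F"
proof -
  obtain M e D where D: "1 \<le> M" "e \<le> M" "finite D" "D \<subseteq> prim_mats e"
    "\<forall>B. det B \<noteq> 0 \<longrightarrow> (\<Sum>A\<in>D. if coset_of B \<in> coset_of ` kcoset A M then F A else 0) = F B"
    by (rule section_decomposition[OF F])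
  note a = has_qint_right[OF F k D] and b = has_qint_right[OF F integral_mat_1 D]
  show ?thesis unfolding qint_def
    using has_bochner_integral_integral_eq[OF a] has_bochner_integral_integral_eq[OF b] by simp
qed

lemma qint_integrable:
  assumes F: "compact_section (\<lambda>_. 1) F"
  shows "integrable N (coset_fun (coset_fun F))"
proof -
  obtain M e D where D: "1 \<le> M" "e \<le> M" "finite D" "D \<subseteq> prim_mats e"
    "\<forall>B. det B \<noteq> 0 \<longrightarrow> (\<Sum>A\<in>D. if coset_of B \<in> coset_of ` kcoset A M then F A else 0) = F B"
    by (rule section_decomposition[OF F])
  show ?thesis using integrable.intros[OF has_qint_right[OF F integral_mat_1 D]] by simp
qed

lemma qint_add:
  assumes "compact_section (\<lambda>_. 1) F" "compact_section (\<lambda>_. 1) G"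
  shows "qint (\<lambda>A. F A + G A) = qint F + qint G"
proof -
  have "qint (\<lambda>A. F A + G A) = (\<integral>Y. coset_fun (coset_fun F) Y + coset_fun (coset_fun G) Y \<partial>N)"
    unfolding qint_def
    by (rule Bochner_Integration.integral_cong[OF refl])
      (auto simp: space_N coset_fun_section[OF assms(1)] coset_fun_section[OF assms(2)] coset_fun_section[OF compact_section_add[OF assms]])
  then show ?thesis unfolding qint_def using qint_integrable assms by (simp add: Bochner_Integration.integral_add)
qed

lemma qint_cmult:
  assumes "compact_section (\<lambda>_. 1) F"
  shows "qint (\<lambda>A. c * F A) = c * qint F"
proof -
  have "qint (\<lambda>A. c * F A) = (\<integral>Y. c * coset_fun (coset_fun F) Y \<partial>N)"
    unfolding qint_def
    by (rule Bochner_Integration.integral_cong[OF refl])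
      (auto simp: space_N coset_fun_section[OF assms(1)] coset_fun_section[OF compact_section_cmult[OF assms]])
  then show ?thesis unfolding qint_def by simp
qed

definition cell_volume :: "int \<Rightarrow> real"
  where "cell_volume a = measure MG (pgl ` (iwahori a 0 :: ('f^2^2) set)) / tvol"

text \<open>The volume of a cell is invariant under dilation: this is the unimodularity that the
  asymptotics need.\<close>

lemma qint_cell:
  assumes F: "compact_section (\<lambda>_. 1) F" and c: "c \<noteq> 0" "0 \<le> val c" and a: "val c + 1 \<le> J"
    and FA: "\<And>A. F A = (if A $ 1 $ 1 \<noteq> 0 \<and> A $ 2 $ 1 \<noteq> 0 \<and> A $ 1 $ 2 / A $ 1 $ 1 \<in> fideal J \<and>
      A $ 2 $ 2 / A $ 2 $ 1 - c \<in> fideal J then \<kappa> else 0)"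
  shows "qint F = of_real (cell_volume (J - val c)) * \<kappa>"
proof -
  \<comment> \<open>The radius relative to the distance of the two slopes 0 and \<open>c\<close>; a
    dilation leaves it unchanged.\<close>
  define a where "a = J - val c"
  have a1: "1 \<le> a" "1 \<le> J" "0 \<le> J" using assms by (auto simp: a_def)
  define y where "y = mat2 1 0 1 c"
  have y: "det y \<noteq> 0" using c by (simp add: y_def)
  define S where "S = (\<lambda>A. y ** A) ` iwahori a J"
  have iw: "iwahori a J \<subseteq> {A :: 'f^2^2. det A \<noteq> 0}" using iwahori_det[OF a1(1,3)] by blast
  have S: "open S" "S \<subseteq> {A. det A \<noteq> 0}" unfolding S_def using open_left_image[OF y open_iwahori] iw y by (auto simp: det_mul)
  \<comment> \<open>The translate by \<open>y\<close> in coordinates: two discs of slopes and, as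
    last condition, the torus coordinate. Modulo the torus the last condition disappears and the
    cell remains.\<close>
  define St where "St B \<longleftrightarrow> B $ 1 $ 1 \<noteq> 0 \<and> B $ 2 $ 1 \<noteq> 0 \<and> B $ 1 $ 2 / B $ 1 $ 1 \<in> fideal J \<and>
      B $ 2 $ 2 / B $ 2 $ 1 - c \<in> fideal J \<and> B $ 1 $ 1 / B $ 2 $ 1 - 1 \<in> fideal J" for B :: "'f^2^2"
  have S_iff: "pgl B \<in> pgl ` S \<longleftrightarrow> St B" for B
  proof -
    have "pgl B \<in> pgl ` S \<longleftrightarrow> pgl (inv2 y ** B) \<in> pgl ` iwahori a J"
    proof
      assume "pgl B \<in> pgl ` S"
      then obtain A where A: "A \<in> iwahori a J" "pgl (y ** A) = pgl B" unfolding S_def by auto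
      then obtain d where "d \<noteq> 0" "B = mat d ** (y ** A)" by (auto simp: pgl_eq_iff)
      then have "inv2 y ** B = mat d ** A" using inv2(2)[OF y] by (metis mat_commute matrix_mul_assoc matrix_mul_lid)
      then show "pgl (inv2 y ** B) \<in> pgl ` iwahori a J" using A \<open>d \<noteq> 0\<close> by (simp add: pgl_scale)
    next
      assume "pgl (inv2 y ** B) \<in> pgl ` iwahori a J"
      then obtain A where A: "A \<in> iwahori a J" "pgl (inv2 y ** B) = pgl A" by auto
      then have "pgl y \<otimes>\<^bsub>PGL2\<^esub> pgl (inv2 y ** B) = pgl (y ** A)" by simp
      then have "pgl B = pgl (y ** A)" using inv2(1)[OF y] by (simp add: matrix_mul_assoc)
      then show "pgl B \<in> pgl ` S" using A unfolding S_def by blast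
    qed
    also have "\<dots> \<longleftrightarrow> St B"
    proof (cases B rule: mat2_cases)
      case (mat2 p q r s)
      have i: "inv2 y ** B = mat2 p q ((r - p) / c) ((s - q) / c)"
        using c by (simp add: y_def inv2_def mat2 field_simps)
      have "p \<noteq> 0 \<and> q / p \<in> fideal J \<and> (r - p) / c / p \<in> fideal a \<and> (s - q) / c / p - 1 \<in> fideal a \<longleftrightarrow>
          p \<noteq> 0 \<and> r \<noteq> 0 \<and> q / p \<in> fideal J \<and> s / r - c \<in> fideal J \<and> p / r - 1 \<in> fideal J" (is "?L \<longleftrightarrow> ?R")
      proof (cases "p \<noteq> 0 \<and> q / p \<in> fideal J")
        case True
        define z w v where "z = q / p" and "w = r / p" and "v = s / p"
        have p: "p \<noteq> 0" "z \<in> fideal J" using True by (auto simp: z_def)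
        have co: "c \<in> fideal 0" using c by (simp add: fideal_iff)
        have 1: "(r - p) / c / p = (w - 1) / c" using p c by (simp add: w_def field_simps)
        have 2: "(s - q) / c / p - 1 = (v - z - c) / c" using p c by (simp add: v_def z_def field_simps)
        have L: "?L \<longleftrightarrow> w - 1 \<in> fideal J \<and> v - z - c \<in> fideal J"
          unfolding 1 2 using True c by (simp add: fideal_divide_iff a_def)
        have vz: "v - z - c \<in> fideal J \<longleftrightarrow> v - c \<in> fideal J"
          using fideal_add[of "v - z - c" J z] fideal_diff[of "v - c" J z] p by (auto simp: algebra_simps)
        have R: "?R \<longleftrightarrow> w \<noteq> 0 \<and> v / w - c \<in> fideal J \<and> inverse w - 1 \<in> fideal J"
          using True by (auto simp: w_def v_def field_simps)
        have inv: "w \<noteq> 0 \<and> inverse w - 1 \<in> fideal J \<longleftrightarrow> w - 1 \<in> fideal J"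
          using one_unit_inverse[of w J] one_unit_inverse[of "inverse w" J] one_unit[of w J] a1 by auto
        have "v / w - c \<in> fideal J \<longleftrightarrow> v - c \<in> fideal J" if w: "w - 1 \<in> fideal J"
        proof -
          have w0: "w \<noteq> 0" "val w = 0" using one_unit[OF w a1(2)] by auto
          have cw: "c * (w - 1) \<in> fideal J" using fideal_mult[OF co w, of J] by simp
          have "v / w - c = (v - c - c * (w - 1)) / w" using w0 by (simp add: field_simps)
          then have "v / w - c \<in> fideal J \<longleftrightarrow> v - c - c * (w - 1) \<in> fideal J" using w0 by (simp add: fideal_divide_iff)
          then show ?thesis using fideal_add[OF _ cw, of "v - c - c * (w - 1)"] fideal_diff[OF _ cw, of "v - c"] by auto
        qed
        then show ?thesis using L R inv vz by blast
      qed auto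
      then show ?thesis unfolding pgl_iwahori_iff[OF a1(1)] i St_def by (simp add: mat2)
    qed
    finally show ?thesis .
  qed
  \<comment> \<open>All fibres over the cell are the same ball of principal units of level
    \<open>J\<close>, as \<open>emeasure_quotient\<close> requires.\<close>
  have hits: "{h \<in> torus. h \<otimes>\<^bsub>PGL2\<^esub> pgl A \<in> pgl ` S} = torus_ball 1 J" if A: "A \<in> S" for A
  proof -
    have St: "St A" using S_iff[of A] A by blast
    define u where "u = A $ 1 $ 1 / A $ 2 $ 1"
    have u: "u - 1 \<in> fideal J" "u \<noteq> 0" using St by (auto simp: St_def u_def)
    have hit: "pdiag t \<otimes>\<^bsub>PGL2\<^esub> pgl A \<in> pgl ` S \<longleftrightarrow> t - 1 \<in> fideal J" if t: "t \<noteq> 0" for t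
    proof -
      have "pdiag t \<otimes>\<^bsub>PGL2\<^esub> pgl A \<in> pgl ` S \<longleftrightarrow> St (mat2 t 0 0 1 ** A)" by (simp add: pdiag_def S_iff)
      also have "\<dots> \<longleftrightarrow> t * u - 1 \<in> fideal J"
        using St t by (cases A rule: mat2_cases) (auto simp: St_def u_def)
      also have "\<dots> \<longleftrightarrow> t - 1 \<in> fideal J"
      proof
        assume "t * u - 1 \<in> fideal J"
        then have "(t * u) * inverse u - 1 \<in> fideal J" using u a1
          by (intro one_unit_mult[where u = "t * u" and w = "inverse u"] one_unit_inverse) auto
        moreover have "t * u * inverse u = t" using u(2) by (simp add: mult.assoc)
        ultimately show "t - 1 \<in> fideal J" by simp
      qed (use u a1 in \<open>auto intro: one_unit_mult\<close>)
      finally show ?thesis .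
    qed
    show ?thesis
    proof (intro equalityI subsetI)
      fix h assume h: "h \<in> {h \<in> torus. h \<otimes>\<^bsub>PGL2\<^esub> pgl A \<in> pgl ` S}"
      then have "h \<in> torus" by simp
      then obtain t where t: "t \<noteq> 0" "h = pdiag t" by (rule torusE)
      then show "h \<in> torus_ball 1 J" using h hit[OF t(1)] by (simp add: pdiag_torus_ball)
    next
      fix h :: "('f^2^2) set" assume "h \<in> torus_ball 1 J"
      then obtain t where t: "h = pdiag t" "t - 1 \<in> fideal J" unfolding torus_ball_def by blast
      then have "t \<noteq> 0" using one_unit(1)[OF _ a1(2)] by blast
      then show "h \<in> {h \<in> torus. h \<otimes>\<^bsub>PGL2\<^esub> pgl A \<in> pgl ` S}" using t hit[of t] by simp
    qed
  qed
  have vol: "emeasure MT (torus_ball 1 J) * emeasure N (coset_of ` S) = emeasure MG (pgl ` iwahori a J)"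
    using emeasure_quotient[OF S, of "emeasure MT (torus_ball 1 J)"] hits emeasure_MG_left[OF y open_iwahori iw]
    by (simp add: S_def)
  have mt: "measure MT (torus_ball 1 J) = tvol * rq TYPE('f) powi (- J)" "0 < emeasure MT (torus_ball 1 J)"
    using measure_torus_ball[of 1 J] emeasure_torus_ball_pos[of 1 J] a1 by auto
  have "measure MT (torus_ball 1 J) * measure N (coset_of ` S) = measure MG (pgl ` iwahori a J)"
    using arg_cong[OF vol, of enn2real] by (simp add: measure_def enn2real_mult)
  also have "\<dots> = measure MG (pgl ` iwahori a 0) * rq TYPE('f) powi (- J)" by (rule measure_iwahori[OF a1(1,3)])
  \<comment> \<open>The powers of q with exponent \<open>- J\<close> in the volumes of the ball and
    of the neighbourhood cancel, so only \<open>a\<close> is left.\<close>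
  finally have mN: "measure N (coset_of ` S) = cell_volume a"
    using tvol_pos rq_gt_1[where 'f='f] by (simp add: mt cell_volume_def field_simps)
  have fin: "emeasure N (coset_of ` S) < \<infinity>"
  proof -
    have "emeasure MT (torus_ball 1 J) * emeasure N (coset_of ` S) < \<infinity>"
      using emeasure_MG_iwahori_finite[OF a1(1,3)] vol by simp
    then show ?thesis using mt(2) by (auto simp: ennreal_mult_less_top)
  qed
  have S_coset: "coset_of B \<in> coset_of ` S \<longleftrightarrow> B $ 1 $ 1 \<noteq> 0 \<and> B $ 2 $ 1 \<noteq> 0 \<and> B $ 1 $ 2 / B $ 1 $ 1 \<in> fideal J \<and>
      B $ 2 $ 2 / B $ 2 $ 1 - c \<in> fideal J" for B
  proof
    assume "coset_of B \<in> coset_of ` S"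
    then obtain A where A: "A \<in> S" "coset_of A = coset_of B" by auto
    have "St A" using S_iff[of A] A by blast
    moreover obtain s s' where "s \<noteq> 0" "s' \<noteq> 0" "B = mat2 s 0 0 s' ** A" using A(2) by (auto simp: coset_of_eq_iff)
    ultimately show "B $ 1 $ 1 \<noteq> 0 \<and> B $ 2 $ 1 \<noteq> 0 \<and> B $ 1 $ 2 / B $ 1 $ 1 \<in> fideal J \<and> B $ 2 $ 2 / B $ 2 $ 1 - c \<in> fideal J"
      by (cases A rule: mat2_cases) (auto simp: St_def)
  next
    assume h: "B $ 1 $ 1 \<noteq> 0 \<and> B $ 2 $ 1 \<noteq> 0 \<and> B $ 1 $ 2 / B $ 1 $ 1 \<in> fideal J \<and> B $ 2 $ 2 / B $ 2 $ 1 - c \<in> fideal J"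
    define C where "C = mat2 (inverse (B $ 1 $ 1)) 0 0 (inverse (B $ 2 $ 1)) ** B"
    have "St C" using h by (cases B rule: mat2_cases) (auto simp: C_def St_def divide_inverse mult.commute)
    then obtain A where "A \<in> S" "pgl C = pgl A" using S_iff[of C] by auto
    moreover have "coset_of C = coset_of B" unfolding C_def using h by (intro coset_of_scale) auto
    ultimately show "coset_of B \<in> coset_of ` S" using coset_of_pgl by (metis imageI)
  qed
  have "has_bochner_integral N (\<lambda>Y. indicator (coset_of ` S) Y *\<^sub>R \<kappa>) (measure N (coset_of ` S) *\<^sub>R \<kappa>)"
    using fin by (intro has_bochner_integral_indicator coset_of_sets_N S)
  moreover have "indicator (coset_of ` S) Y *\<^sub>R \<kappa> = coset_fun (coset_fun F) Y" if Y: "Y \<in> space N" for Y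
  proof -
    obtain B where B: "Y = coset_of B" using Y by (auto simp: space_N)
    show ?thesis unfolding B coset_fun_section[OF F] FA indicator_def S_coset by simp
  qed
  ultimately have "has_bochner_integral N (coset_fun (coset_fun F)) (of_real (cell_volume a) * \<kappa>)"
    unfolding mN by (simp cong: has_bochner_integral_cong add: scaleR_conv_of_real)
  then show ?thesis unfolding qint_def a_def by (rule has_bochner_integral_integral_eq)
qed

end

section \<open>Linking numbers\<close>

context quotient_haar begin

definition pairing :: "'f \<Rightarrow> ('f^2^2 \<Rightarrow> complex) \<Rightarrow> ('f^2^2 \<Rightarrow> complex) \<Rightarrow> complex"
  where "pairing x F f = qint (\<lambda>A. orb x F A * f A)"

text \<open>Small shears are integral matrices that fix the orbital integral. The dilated cell at
  (0,c) is the cell at (0,bc) of the same relative radius, on which the integrand is constant; so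
  its pairing is a volume independent of \<open>b\<close> times the orbital integral at slopes 0 and
  bc.\<close>

lemma section_functional_pairing:
  assumes F: "compact_section \<theta> F" and \<theta>: "mult_character \<theta>" and x: "x \<noteq> 0" "x \<noteq> 1" and M: "level M F"
  shows "section_functional (\<lambda>s. inverse (\<theta> s)) (pairing x F) M"
proof -
  define \<eta> where "\<eta> = (\<lambda>s. inverse (\<theta> s))"
  have M1: "1 \<le> M" using M by (simp add: level_def)
  have oe: "equiv_section \<theta> (orb x F)" by (rule orb_equiv_section[OF F x(2)])
  have prod: "compact_section (\<lambda>_. 1) (\<lambda>A. orb x F A * f A)" if "compact_section \<eta> f" for f
    using mult_character_nz[OF \<theta>] by (intro compact_section_prod[OF oe that]) (simp add: \<eta>_def)
  have ch: "mult_character \<eta>" unfolding \<eta>_def by (rule mult_character_inv[OF \<theta>])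
  have lev: "level M (orb x F)" by (rule orb_level[OF M])
  obtain \<alpha> \<beta> n where n: "\<And>c. c \<noteq> 0 \<Longrightarrow> n \<le> val c \<Longrightarrow>
      orb x F (mat2 1 0 1 c) = of_real (abs_val c) * (\<alpha> * inverse (\<theta> c) + \<beta> * \<theta> c)"
    using orb_asymptotic[OF F \<theta> x] by blast
  obtain M0 where M0: "conductor_bound \<eta> M0"
    using mult_character_conductor[OF ch] by (metis conductor_bound_def)
  have "section_functional \<eta> (pairing x F) M"
  proof
    show "mult_character \<eta>" by (rule ch)
    fix f g :: "'f^2^2 \<Rightarrow> complex" and s :: 'f and c
    assume f: "compact_section \<eta> f"
    show "pairing x F (\<lambda>A. c * f A) = c * pairing x F f"
      using qint_cmult[OF prod[OF f], of c] by (simp add: pairing_def algebra_simps)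
    show "pairing x F (\<lambda>A. f A + g A) = pairing x F f + pairing x F g" if "compact_section \<eta> g"
      using qint_add[OF prod[OF f] prod[OF that]] by (simp add: pairing_def algebra_simps)
    show "pairing x F (shear s f) = pairing x F f" if s: "s \<in> fideal M"
    proof -
      have "integral_mat (mat2 1 s 0 1)"
        using fideal_mono[OF s, of 0] M1 by (auto simp: integral_mat_def inv2_def forall_2)
      from qint_right[OF prod[OF f] this]
      have "qint (\<lambda>A. orb x F (A ** mat2 1 s 0 1) * shear s f A) = pairing x F f" by (simp add: pairing_def shear_def)
      moreover have "orb x F (A ** mat2 1 s 0 1) = orb x F A" for A using s by (intro levelD[OF lev]) simp
      ultimately show ?thesis by (simp add: pairing_def)
    qed
  next
    have "pure_asymptotic \<eta> (\<lambda>b. pairing x F (dilate b (cell \<eta> 0 c j)))" if c: "c \<noteq> 0" "val c + max M M0 \<le> j" for c j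
      unfolding pure_asymptotic_def
    proof (intro exI allI impI)
      \<comment> \<open>The three bounds place \<open>b * c\<close> in the range of the orbital
        asymptotics, make it integral, and make the dilated radius at least the level
        \<open>M\<close>.\<close>
      fix b :: 'f assume b: "b \<noteq> 0" "max (n - val c) (max (- val c) (M - j)) \<le> val b"
      define c' where "c' = b * c"
      define J where "J = j + val b"
      have c': "c' \<noteq> 0" "val c' = val b + val c" using b c by (auto simp: c'_def val_mult)
      have cellJ: "dilate b (cell \<eta> 0 c j) = cell \<eta> 0 c' J"
        using dilate_cell[OF ch b(1), of 0 c j] by (simp add: c'_def J_def)
      have sec: "compact_section \<eta> (cell \<eta> 0 c' J)"
        using c c' by (intro cell_section[OF ch M0]) (auto simp: J_def)
      have J: "M \<le> J" using b by (simp add: J_def)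
      have val_at: "orb x F A * cell \<eta> 0 c' J A =
        (if A $ 1 $ 1 \<noteq> 0 \<and> A $ 2 $ 1 \<noteq> 0 \<and> A $ 1 $ 2 / A $ 1 $ 1 \<in> fideal J \<and> A $ 2 $ 2 / A $ 2 $ 1 - c' \<in> fideal J
         then orb x F (mat2 1 0 1 c') else 0)" for A
      proof (cases A rule: mat2_cases)
        case (mat2 p q r s)
        show ?thesis
        proof (cases "p \<noteq> 0 \<and> r \<noteq> 0 \<and> q / p \<in> fideal J \<and> s / r - c' \<in> fideal J")
          case True
          define z y where "z = q / p" and "y = s / r"
          have zy: "z \<in> fideal J" "y - c' \<in> fideal J" "z \<in> fideal M" using True J fideal_mono[of z J M] by (auto simp: z_def y_def)
          have "y - z - c' \<in> fideal J" using fideal_diff[OF zy(2,1)] by (simp add: algebra_simps)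
          then have "y - z - c' \<in> fideal (M + val c')" by (rule fideal_mono) (use c c' in \<open>simp add: J_def\<close>)
          then have u: "(y - z) / c' - 1 \<in> fideal M" using c' by (intro one_unit_divide) auto
          \<comment> \<open>A matrix with slopes \<open>z\<close> and \<open>y\<close> in the cell
            is the one with slopes 0 and \<open>c'\<close> times a diagonal and a unipotent matrix,
            both in the congruence subgroup of level \<open>M\<close>.\<close>
          have "orb x F (mat2 1 0 1 c' ** (mat2 1 0 0 ((y - z) / c') ** mat2 1 z 0 1)) = orb x F (mat2 1 0 1 c')"
            using zy u M1 by (intro levelD[OF lev] cong_subgroup_mult) auto
          moreover have "mat2 1 0 1 c' ** (mat2 1 0 0 ((y - z) / c') ** mat2 1 z 0 1) = mat2 1 z 1 y" using c' by simp
          ultimately have "orb x F (mat2 1 z 1 y) = orb x F (mat2 1 0 1 c')" by simp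
          moreover have "orb x F A = \<theta> p * inverse (\<theta> r) * orb x F (mat2 1 z 1 y)"
            using equiv_section_scale2[OF oe, of p r 1 z 1 y] True by (simp add: mat2 z_def y_def)
          moreover have "cell \<eta> 0 c' J A = inverse (\<theta> p) * \<theta> r" using True by (simp add: cell_def mat2 \<eta>_def)
          moreover have "\<theta> p * inverse (\<theta> r) * w * (inverse (\<theta> p) * \<theta> r) = w" for w
            using True mult_character_nz[OF \<theta>, of p] mult_character_nz[OF \<theta>, of r] by (simp add: field_simps)
          ultimately have "orb x F A * cell \<eta> 0 c' J A = orb x F (mat2 1 0 1 c')" by simp
          then show ?thesis using True by (simp add: mat2)
        next
          case False
          then have "cell \<eta> 0 c' J A = 0" by (auto simp: cell_def mat2)
          then show ?thesis using False by (auto simp: mat2)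
        qed
      qed
      have "val c' + 1 \<le> J" using c c' M1 by (simp add: J_def)
      then have "pairing x F (cell \<eta> 0 c' J) = of_real (cell_volume (J - val c')) * orb x F (mat2 1 0 1 c')"
        unfolding pairing_def using b c c' by (intro qint_cell[OF prod[OF sec] c'(1) _ _ val_at]) auto
      also have "J - val c' = j - val c" using c' by (simp add: J_def)
      also have "orb x F (mat2 1 0 1 c') = of_real (abs_val c') * (\<alpha> * \<eta> c' + \<beta> * inverse (\<eta> c'))"
        using n[of c'] b c' by (simp add: \<eta>_def)
      also have "of_real (cell_volume (j - val c)) * \<dots> = of_real (abs_val b) *
          ((of_real (cell_volume (j - val c)) * of_real (abs_val c) * \<alpha> * \<eta> c) * \<eta> b
          + (of_real (cell_volume (j - val c)) * of_real (abs_val c) * \<beta> * inverse (\<eta> c)) * inverse (\<eta> b))"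
        using b c by (simp add: c'_def abs_val_mult mult_character_mult[OF ch] algebra_simps)
      finally show "pairing x F (dilate b (cell \<eta> 0 c j)) = of_real (abs_val b) *
          ((of_real (cell_volume (j - val c)) * of_real (abs_val c) * \<alpha> * \<eta> c) * \<eta> b
          + (of_real (cell_volume (j - val c)) * of_real (abs_val c) * \<beta> * inverse (\<eta> c)) * inverse (\<eta> b))"
        unfolding cellJ .
    qed
    then show "\<exists>m'. \<forall>c j. c \<noteq> 0 \<longrightarrow> val c + m' \<le> j \<longrightarrow> pure_asymptotic \<eta> (\<lambda>b. pairing x F (dilate b (cell \<eta> 0 c j)))"
      by blast
  qed
  then show ?thesis by (simp only: \<eta>_def)
qed

lemma pairing_asymptotic:
  assumes F: "compact_section \<theta> F" and \<theta>: "mult_character \<theta>" and x: "x \<noteq> 0" "x \<noteq> 1"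
    and f: "compact_section (\<lambda>s. inverse (\<theta> s)) f"
  shows "asymptotic (\<lambda>s. inverse (\<theta> s)) (\<lambda>b. pairing x F (dilate b f))"
proof -
  obtain M where M: "level M F" using F by (rule compact_sectionE)
  interpret section_functional "\<lambda>s. inverse (\<theta> s)" "pairing x F" M
    by (rule section_functional_pairing[OF F \<theta> x M])
  show ?thesis using germ_asymptotic[OF f] by (simp add: germ_def[abs_def])
qed

text \<open>Right translation by the Weyl element is integral, hence preserves the integral, and it
  conjugates the dilation by \<open>b\<close> into the dilation by \<open>inverse b\<close> times a
  scalar, on which sections are invariant. Large \<open>b\<close> thus reduce to small ones.\<close>

lemma pairing_flip:
  assumes F: "compact_section \<theta> F" and \<theta>: "mult_character \<theta>" and x: "x \<noteq> 1"
    and f: "compact_section (\<lambda>s. inverse (\<theta> s)) f" and b: "b \<noteq> 0"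
  shows "pairing x F (dilate b f) =
    pairing x (\<lambda>A. F (A ** mat2 0 1 1 0)) (dilate (inverse b) (\<lambda>A. f (A ** mat2 0 1 1 0)))"
proof -
  have oe: "equiv_section \<theta> (orb x F)" by (rule orb_equiv_section[OF F x])
  have "compact_section (\<lambda>_. 1) (\<lambda>A. orb x F A * dilate b f A)"
    using mult_character_nz[OF \<theta>] by (intro compact_section_prod[OF oe dilate_section[OF f b]]) simp
  moreover have "integral_mat (mat2 0 1 1 0)" by (auto simp: integral_mat_def inv2_def forall_2)
  ultimately have "pairing x F (dilate b f) = qint (\<lambda>A. orb x F (A ** mat2 0 1 1 0) * dilate b f (A ** mat2 0 1 1 0))"
    unfolding pairing_def by (rule qint_right[symmetric])
  also have "(\<lambda>A. orb x F (A ** mat2 0 1 1 0) * dilate b f (A ** mat2 0 1 1 0)) =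
      (\<lambda>A. orb x (\<lambda>A. F (A ** mat2 0 1 1 0)) A * dilate (inverse b) (\<lambda>A. f (A ** mat2 0 1 1 0)) A)"
  proof
    fix A :: "'f^2^2"
    have "A ** mat2 0 1 1 0 ** mat2 b 0 0 1 = mat2 b 0 0 b ** (A ** mat2 (inverse b) 0 0 1 ** mat2 0 1 1 0)"
      using b by (cases A rule: mat2_cases) (simp add: field_simps)
    then have "dilate b f (A ** mat2 0 1 1 0) = f (A ** mat2 (inverse b) 0 0 1 ** mat2 0 1 1 0)"
      unfolding dilate_def using compact_section_scale(1)[OF f b b] mult_character_nz[OF \<theta> b] by simp
    then show "orb x F (A ** mat2 0 1 1 0) * dilate b f (A ** mat2 0 1 1 0) =
        orb x (\<lambda>A. F (A ** mat2 0 1 1 0)) A * dilate (inverse b) (\<lambda>A. f (A ** mat2 0 1 1 0)) A"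
      by (simp add: orb_def dilate_def matrix_mul_assoc)
  qed
  finally show ?thesis unfolding pairing_def .
qed

lemma torus_orbital_eq:
  assumes A: "det A \<noteq> 0" and x: "x \<noteq> 1"
  shows "torus_orbital MT \<phi> x (pgl A) = orb x (lift_fun \<phi>) A"
  unfolding torus_orbital_def orb_def
proof (rule Bochner_Integration.integral_cong[OF refl])
  fix h assume "h \<in> space MT"
  then have "h \<in> torus" by (simp add: space_MT)
  then obtain t where t: "t \<noteq> 0" "h = pdiag t" by (rule torusE)
  have "inv\<^bsub>PGL2\<^esub> h = pgl (mat2 (inverse t) 0 0 1)"
    unfolding t(2) pdiag_def using t(1) by (subst pgl_inv) (simp_all add: inv2_def divide_inverse)
  then have "inv\<^bsub>PGL2\<^esub> h \<otimes>\<^bsub>PGL2\<^esub> gamma x \<otimes>\<^bsub>PGL2\<^esub> h \<otimes>\<^bsub>PGL2\<^esub> pgl A = pgl (conj_gamma x t ** A)"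
    using t by (simp add: gamma_def pdiag_def conj_gamma_def field_simps)
  moreover have "det (conj_gamma x t ** A) \<noteq> 0" using A x t by (simp add: conj_gamma_def det_mul)
  ultimately show "\<phi> (inv\<^bsub>PGL2\<^esub> h \<otimes>\<^bsub>PGL2\<^esub> gamma x \<otimes>\<^bsub>PGL2\<^esub> h \<otimes>\<^bsub>PGL2\<^esub> pgl A) = lift_fun \<phi> (conj_gamma x (tcoord h) ** A)"
    using t by (simp add: lift_fun_def)
qed

text \<open>Unitarity makes the conjugate of \<psi> a section for the inverse character, so the
  integrand is constant on cosets and its \<open>coset_fun\<close> is its value at any
  representative.\<close>

lemma linking_number_eq:
  assumes \<theta>: "mult_character \<theta>" and \<phi>: "\<phi> \<in> schwartz_space (torus_character \<theta>)"
    and \<psi>: "\<psi> \<in> schwartz_space (torus_character \<theta>)" and x: "x \<noteq> 1" and b: "b \<noteq> 0"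
  shows "linking_number MT N \<phi> b \<psi> x = pairing x (lift_fun \<phi>) (dilate b (\<lambda>A. cnj (lift_fun \<psi> A)))"
proof -
  have F: "compact_section \<theta> (lift_fun \<phi>)" by (rule schwartz_compact_section[OF \<theta> \<phi>])
  have G: "compact_section (\<lambda>s. cnj (\<theta> s)) (\<lambda>A. cnj (lift_fun \<psi> A))"
    by (rule compact_section_cnj[OF schwartz_compact_section[OF \<theta> \<psi>]])
  define P where "P = (\<lambda>A. orb x (lift_fun \<phi>) A * dilate b (\<lambda>A. cnj (lift_fun \<psi> A)) A)"
  have P: "compact_section (\<lambda>_. 1) P" unfolding P_def
    using mult_character_cnj[OF \<theta>] mult_character_nz[OF \<theta>]
    by (intro compact_section_prod[OF orb_equiv_section[OF F x] dilate_section[OF G b]]) simp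
  let ?I = "\<lambda>y. torus_orbital MT \<phi> x y * cnj (\<psi> (y \<otimes>\<^bsub>PGL2\<^esub> pgl (mat2 b 0 0 1)))"
  have I: "?I (pgl A) = P A" if "det A \<noteq> 0" for A
    using that b torus_orbital_eq[OF that x] by (simp add: P_def dilate_def lift_fun_def det_mul)
  have "(\<integral>Y. coset_fun ?I Y \<partial>N) = (\<integral>Y. coset_fun (coset_fun P) Y \<partial>N)"
  proof (rule Bochner_Integration.integral_cong[OF refl])
    fix Y assume "Y \<in> space N"
    then obtain A where A: "det A \<noteq> 0" "Y = coset_of A" by (auto simp: space_N)
    have "coset_fun ?I (coset_of A) = ?I (pgl A)"
    proof (rule coset_fun_coset_of)
      fix s s' :: 'f assume s: "s \<noteq> 0" "s' \<noteq> 0"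
      have "det (mat2 s 0 0 s' ** A) \<noteq> 0" using s A by (simp add: det_mul)
      then show "?I (pgl (mat2 s 0 0 s' ** A)) = ?I (pgl A)"
        using I[of "mat2 s 0 0 s' ** A"] I[OF A(1)] compact_section_scale(1)[OF P s, of A] by simp
    qed
    then show "coset_fun ?I Y = coset_fun (coset_fun P) Y" using A I[OF A(1)] coset_fun_section[OF P, of A] by simp
  qed
  then show ?thesis using x by (simp add: linking_number_def pairing_def qint_def P_def)
qed

end

text \<open>Invariance under principal units gives discs of constancy of radius proportional to |b|,
  and bounded valuation keeps the support away from 0 and from infinity.\<close>

lemma test_function_annulus:
  fixes f :: "'f::nonarch_local_field \<Rightarrow> complex"
  assumes inv: "\<And>b u. b \<noteq> 0 \<Longrightarrow> u - 1 \<in> fideal M \<Longrightarrow> f (b * u) = f b" and M: "1 \<le> M"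
    and supp: "\<And>b. b \<noteq> 0 \<Longrightarrow> f b \<noteq> 0 \<Longrightarrow> - n \<le> val b \<and> val b \<le> n"
  shows "test_function (top_of_set (- {0})) f"
proof -
  have pert: "y \<noteq> 0 \<and> val y = val b \<and> f y = f b" if b: "b \<noteq> 0" and y: "y - b \<in> fideal (max 1 (M + val b))" for b y
  proof -
    have 1: "y - b \<in> fideal (M + val b)" using fideal_mono[OF y] by simp
    have "y \<noteq> 0" "val y = val b" using val_eqI[of b y] b M fideal_mono[OF 1, of "val b + 1"] by auto
    moreover have "f (b * (y / b)) = f b" using b one_unit_divide[OF b 1] by (intro inv) auto
    ultimately show ?thesis using b by simp
  qed
  have "locally_constant (top_of_set (- {0})) f"
    unfolding locally_constant_def
  proof
    fix b assume "b \<in> topspace (top_of_set (- {0 :: 'f}))"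
    then have b: "b \<noteq> 0" by simp
    let ?U = "{y. y - b \<in> fideal (max 1 (M + val b))}"
    have "?U \<subseteq> - {0}" using pert[OF b] by blast
    then have "openin (top_of_set (- {0})) ?U" using open_fideal_coset by (intro open_subset) auto
    moreover have "b \<in> ?U" by simp
    moreover have "\<forall>y\<in>?U. f y = f b" using pert[OF b] by blast
    ultimately show "\<exists>U. openin (top_of_set (- {0})) U \<and> b \<in> U \<and> (\<forall>y\<in>U. f y = f b)" by blast
  qed
  moreover have "compactin (top_of_set (- {0})) (top_of_set (- {0}) closure_of {b \<in> topspace (top_of_set (- {0})). f b \<noteq> 0})"
  proof -
    let ?S = "{b \<in> - {0}. f b \<noteq> 0}"
    have S: "?S \<subseteq> fideal (- n)" using supp by (auto simp: fideal_iff)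
    \<comment> \<open>Closed in the whole field and not just in its multiplicative group, so that
      compactness of fractional ideals applies.\<close>
    have "closed ?S" unfolding closed_def open_nonarch_iff
    proof (intro ballI)
      fix b assume b: "b \<in> - ?S"
      show "\<exists>J\<ge>1. \<forall>y. y - b \<in> fideal J \<longrightarrow> y \<in> - ?S"
      proof (cases "b = 0")
        case True
        have "y \<in> - ?S" if "y - b \<in> fideal (max 1 (n + 1))" for y
          using that True supp[of y] by (cases "y = 0") (auto simp: fideal_iff)
        moreover have "1 \<le> max 1 (n + 1)" by simp
        ultimately show ?thesis by blast
      next
        case False
        then have "f b = 0" using b by simp
        then have "y \<in> - ?S" if "y - b \<in> fideal (max 1 (M + val b))" for y using pert[OF False that] by simp
        moreover have "1 \<le> max 1 (M + val b)" by simp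
        ultimately show ?thesis by blast
      qed
    qed
    then have c: "compact ?S" using compact_Int_closed[OF compact_fideal[of "- n"], of ?S] S by (simp add: Int_absorb1)
    then have "top_of_set (- {0}) closure_of ?S = ?S"
      using \<open>closed ?S\<close> by (simp add: closure_of_closedin closedin_closed_subset closed_subset Collect_mono_iff subset_eq)
    then show ?thesis using c by (auto simp: compactin_subtopology)
  qed
  ultimately show ?thesis by (simp add: test_function_def)
qed

theorem theorem5p4:
  fixes chi1 :: "'f::nonarch_local_field \<Rightarrow> complex"
    and \<phi> \<psi> :: "('f^2^2) set \<Rightarrow> complex"
    and MT MG :: "('f^2^2) set measure"
    and N :: "('f^2^2) set set measure"
    and x :: 'f
  assumes "residue_char TYPE('f) \<noteq> 2"
    and "mult_character chi1"
    and "haar_torus MT"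
    and "haar_PGL2 MG"
    and "quotient_measure PGL2 PGL2_topology torus MG MT N"
    and "\<phi> \<in> schwartz_space (torus_character chi1)"
    and "\<psi> \<in> schwartz_space (torus_character chi1)"
    and "x \<noteq> 0"
  shows "\<exists>(ap1 :: complex) ap2 am1 am2 (cp1 :: complex) cp2 cm1 cm2 (n :: nat) A C.
    0 < n \<and> test_function (top_of_set (- {0})) A \<and> test_function (top_of_set (- {0})) C \<and>
    (\<forall>b::'f. b \<noteq> 0 \<longrightarrow>
      linking_number MT N \<phi> b \<psi> x =
        inverse (chi1 b) *
          (indicator (max_ideal_pow n) b * of_real (abs_val b) * (ap1 * of_int (val b) + ap2)
           + A b
           + indicator (max_ideal_pow n) (inverse b) * of_real (inverse (abs_val b)) *
               (am1 * of_int (val b) + am2))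
        + chi1 b *
          (indicator (max_ideal_pow n) b * of_real (abs_val b) * (cp1 * of_int (val b) + cp2)
           + C b
           + indicator (max_ideal_pow n) (inverse b) * of_real (inverse (abs_val b)) *
               (cm1 * of_int (val b) + cm2)))"
proof -
  have zero: "test_function (top_of_set (- {0})) (\<lambda>_ :: 'f. 0 :: complex)"
    by (rule test_function_annulus[of 1 _ 0]) auto
  show ?thesis
  proof (cases "x = 1")
    case True
    then show ?thesis
      by (intro exI[of _ 0] exI[of _ 1] exI[of _ "\<lambda>_. 0"]) (simp add: linking_number_def zero)
  next
    case False
    interpret quotient_haar MT MG N using assms by unfold_locales
    note chi = assms(2)
    define L where "L b = linking_number MT N \<phi> b \<psi> x" for b
    define F where "F = lift_fun \<phi>"
    define f where "f = (\<lambda>A. cnj (lift_fun \<psi> A))"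
    define W where "W = (mat2 0 1 1 0 :: 'f^2^2)"
    have F: "compact_section chi1 F" unfolding F_def by (rule schwartz_compact_section[OF chi assms(6)])
    have f: "compact_section (\<lambda>s. inverse (chi1 s)) f"
    proof -
      have "compact_section (\<lambda>s. cnj (chi1 s)) f"
        unfolding f_def by (rule compact_section_cnj[OF schwartz_compact_section[OF chi assms(7)]])
      then show ?thesis using mult_character_cnj[OF chi] by (simp add: compact_section_def equiv_section_def)
    qed
    have L: "L b = pairing x F (dilate b f)" if "b \<noteq> 0" for b
      unfolding L_def F_def f_def by (rule linking_number_eq[OF chi assms(6,7) False that])
    have W: "det W \<noteq> 0" by (simp add: W_def)
    have FW: "compact_section chi1 (\<lambda>A. F (A ** W))" "compact_section (\<lambda>s. inverse (chi1 s)) (\<lambda>A. f (A ** W))"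
      by (rule compact_section_right[OF F W], rule compact_section_right[OF f W])
    have L': "L b = pairing x (\<lambda>A. F (A ** W)) (dilate (inverse b) (\<lambda>A. f (A ** W)))" if "b \<noteq> 0" for b
      using L[OF that] pairing_flip[OF F chi False f that] by (simp add: W_def)
    obtain p1 p2 q1 q2 n1 where at0: "\<And>b. b \<noteq> 0 \<Longrightarrow> n1 \<le> val b \<Longrightarrow> L b = of_real (abs_val b) *
        (inverse (chi1 b) * (p1 * of_int (val b) + p2) + chi1 b * (q1 * of_int (val b) + q2))"
    proof -
      have "asymptotic (\<lambda>s. inverse (chi1 s)) (\<lambda>b. pairing x F (dilate b f))"
        by (rule pairing_asymptotic[OF F chi assms(8) False f])
      then obtain p1 p2 q1 q2 n1 where "\<forall>b. b \<noteq> 0 \<longrightarrow> n1 \<le> val b \<longrightarrow> pairing x F (dilate b f) = of_real (abs_val b) *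
        (inverse (chi1 b) * (p1 * of_int (val b) + p2) + inverse (inverse (chi1 b)) * (q1 * of_int (val b) + q2))"
        unfolding asymptotic_def by blast
      then show thesis using L by (intro that[of n1 p1 p2 q1 q2]) simp
    qed
    obtain r1 r2 s1 s2 n2 where atinf: "\<And>b. b \<noteq> 0 \<Longrightarrow> n2 \<le> val b \<Longrightarrow> L (inverse b) = of_real (abs_val b) *
        (inverse (chi1 b) * (r1 * of_int (val b) + r2) + chi1 b * (s1 * of_int (val b) + s2))"
    proof -
      have "asymptotic (\<lambda>s. inverse (chi1 s)) (\<lambda>b. pairing x (\<lambda>A. F (A ** W)) (dilate b (\<lambda>A. f (A ** W))))"
        by (rule pairing_asymptotic[OF FW(1) chi assms(8) False FW(2)])
      then obtain r1 r2 s1 s2 n2 where "\<forall>b. b \<noteq> 0 \<longrightarrow> n2 \<le> val b \<longrightarrow>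
        pairing x (\<lambda>A. F (A ** W)) (dilate b (\<lambda>A. f (A ** W))) = of_real (abs_val b) *
        (inverse (chi1 b) * (r1 * of_int (val b) + r2) + inverse (inverse (chi1 b)) * (s1 * of_int (val b) + s2))"
        unfolding asymptotic_def by blast
      then show thesis using L' by (intro that[of n2 r1 r2 s1 s2]) simp
    qed
    \<comment> \<open>At least 1, so that the two ranges covered by the asymptotics do not
      overlap.\<close>
    define n where "n = nat (max 1 (max n1 n2))"
    have n: "0 < n" "n1 \<le> int n" "n2 \<le> int n" "1 \<le> int n" by (auto simp: n_def)
    \<comment> \<open>The whole middle range goes into \<open>A\<close>; the factor
      \<open>chi1 b\<close> cancels the outer \<open>inverse (chi1 b)\<close>, and \<open>C\<close>
      can be taken to be 0.\<close>
    define A where "A b = (if - int n < val b \<and> val b < int n then chi1 b * L b else 0)" for b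
    obtain M where M: "level M f" using f by (rule compact_sectionE)
    obtain M0 where M0: "1 \<le> M0" "\<And>u. u - 1 \<in> fideal M0 \<Longrightarrow> chi1 u = 1" using mult_character_conductor[OF chi] by metis
    have tA: "test_function (top_of_set (- {0})) A"
    proof (rule test_function_annulus[of "max M M0" _ "int n"])
      show "1 \<le> max M M0" using M0 by simp
      fix b u :: 'f assume b: "b \<noteq> 0" and u: "u - 1 \<in> fideal (max M M0)"
      have u': "u - 1 \<in> fideal M" "u - 1 \<in> fideal M0" using fideal_mono[OF u] by auto
      have u0: "u \<noteq> 0" "val u = 0" using one_unit[OF u'(2) M0(1)] by auto
      \<comment> \<open>The diagonal matrix with entries u and 1 lies in the congruence subgroup of
        level \<open>M\<close>, which fixes \<open>f\<close>.\<close>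
      have "dilate u f = f"
        unfolding dilate_def[abs_def] using u' by (intro ext levelD[OF M]) simp
      then have "L (b * u) = L b" using L[OF b] L[of "b * u"] b u0 by (simp flip: dilate_dilate)
      then show "A (b * u) = A b" using b u0 M0(2)[OF u'(2)] by (simp add: A_def val_mult mult_character_mult[OF chi])
    qed (auto simp: A_def split: if_splits)
    \<comment> \<open>For large \<open>b\<close> the expansion is taken at \<open>inverse b\<close>:
      this interchanges \<open>chi1\<close> with its inverse and negates the valuation, so the
      coefficients change places and the linear ones change sign.\<close>
    have eq: "linking_number MT N \<phi> b \<psi> x =
        inverse (chi1 b) *
          (indicator (max_ideal_pow n) b * of_real (abs_val b) * (p1 * of_int (val b) + p2)
           + A b
           + indicator (max_ideal_pow n) (inverse b) * of_real (inverse (abs_val b)) *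
               ((- s1) * of_int (val b) + s2))
        + chi1 b *
          (indicator (max_ideal_pow n) b * of_real (abs_val b) * (q1 * of_int (val b) + q2)
           + 0
           + indicator (max_ideal_pow n) (inverse b) * of_real (inverse (abs_val b)) *
               ((- r1) * of_int (val b) + r2))" if b: "b \<noteq> 0" for b
    proof -
      have i1: "b \<in> max_ideal_pow n \<longleftrightarrow> int n \<le> val b" "inverse b \<in> max_ideal_pow n \<longleftrightarrow> int n \<le> - val b"
        using b by (simp_all add: max_ideal_pow_eq fideal_iff val_inverse)
      note nz = mult_character_nz[OF chi b]
      consider "int n \<le> val b" | "int n \<le> - val b" | "- int n < val b" "val b < int n" by linarith
      then show ?thesis
      proof cases
        case 1
        then show ?thesis unfolding L_def[symmetric] using n at0[OF b] i1 by (simp add: A_def indicator_def algebra_simps)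
      next
        case 2
        have "L b = of_real (inverse (abs_val b)) *
            (chi1 b * (- r1 * of_int (val b) + r2) + inverse (chi1 b) * (- s1 * of_int (val b) + s2))"
          using atinf[of "inverse b"] b n 2
          by (simp add: val_inverse abs_val_inverse mult_character_inverse[OF chi])
        then show ?thesis unfolding L_def[symmetric] using n 2 i1 by (simp add: A_def indicator_def algebra_simps)
      next
        case 3
        then show ?thesis unfolding L_def[symmetric] using i1 nz by (simp add: A_def indicator_def)
      qed
    qed
    show ?thesis
      by (rule exI[of _ p1], rule exI[of _ p2], rule exI[of _ "- s1"], rule exI[of _ s2], rule exI[of _ q1],
          rule exI[of _ q2], rule exI[of _ "- r1"], rule exI[of _ r2], rule exI[of _ n], rule exI[of _ A],
          rule exI[of _ "\<lambda>_. 0"], intro conjI allI impI, rule n(1), rule tA, rule zero, rule eq, assumption)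
  qed
qed

end
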